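(* Let $n\ge 2$, let $X_1$ and $X_2$ be two locally finite $(n-1)$-connected CW-complexes with base points $x_1\in X_1$ and $x_2\in X_2$, and let $(X,x_* )=(X_1,x_1)\vee(X_2,x_2)$. Then $$\mathcal{H}_n(X,x_* )\cong\mathcal{H}_n(X_1,x_1)\oplus\mathcal{H}_n(X_2,x_2).$$
   Context: For $n\ge 1$ the $n$-dimensional Hawaiian earring is $\mathbb{HE}^n=\{(r_0,\dots,r_n)\in\mathbb{R}^{n+1} : (r_0-1/k)^2+\sum_{i=1}^n r_i^2=(1/k)^2 \text{ for some } k\in\mathbb{N}\}$, with base point $\theta=(0,\dots,0)$; $\mathbb{S}^n_k$ denotes its sphere of radius $1/k$. All homotopies are relative to base points. The $n$th Hawaiian group $\mathcal{H}_n(X,x_0)$ is the set of pointed homotopy classes $[f]$ of pointed maps $f:(\mathbb{HE}^n,\theta)\to(X,x_0)$, with the operation induced sphere by sphere from that of the $n$th homotopy group: $[f][g]=[f*g]$, where $(f*g)|_{\mathbb{S}^n_k}=f|_{\mathbb{S}^n_k}*g|_{\mathbb{S}^n_k}$ for all $k$. For $n\ge 2$ this group is abelian. A space $Y$ is $m$-connected at $y$ if $\pi_j(Y,y)$ is trivial for $1\le j\le m$; it is $m$-connected if this holds at every point. *)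

theory Defs
  imports "HOL-Analysis.Analysis" "HOL-Algebra.Elementary_Groups"
begin

section \<open>Homotopy groups\<close>

text \<open>The cube \<open>I\<^sup>n\<close>; as in \<^const>\<open>Euclidean_space\<close>, points are functions vanishing from index
  \<open>n\<close> on. For \<open>n = 0\<close> it is a point with empty boundary.\<close>

definition cube :: "nat \<Rightarrow> (nat \<Rightarrow> real) topology" where
  "cube n = subtopology (Euclidean_space n) {s. \<forall>i<n. 0 \<le> s i \<and> s i \<le> 1}"

definition cube_boundary :: "nat \<Rightarrow> (nat \<Rightarrow> real) set" where
  "cube_boundary n = {s \<in> topspace (cube n). \<exists>i<n. s i = 0 \<or> s i = 1}"

definition cube_concat :: "((nat \<Rightarrow> real) \<Rightarrow> 'a) \<Rightarrow> ((nat \<Rightarrow> real) \<Rightarrow> 'a) \<Rightarrow> (nat \<Rightarrow> real) \<Rightarrow> 'a" where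
  "cube_concat f g s =
     (if s 0 \<le> 1/2 then f (s(0 := 2 * s 0)) else g (s(0 := 2 * s 0 - 1)))"

text \<open>The constraint imposed on every stage of a homotopy also holds at its two ends, so a class
  only contains continuous maps sending the boundary to the base point. Functions that agree on
  the domain are homotopic, so values outside the cube are irrelevant.\<close>

definition cube_homotopic ::
    "nat \<Rightarrow> 'a topology \<Rightarrow> 'a \<Rightarrow> ((nat \<Rightarrow> real) \<Rightarrow> 'a) \<Rightarrow> ((nat \<Rightarrow> real) \<Rightarrow> 'a) \<Rightarrow> bool" where
  "cube_homotopic n Y y = homotopic_with (\<lambda>h. h ` cube_boundary n \<subseteq> {y}) (cube n) Y"

definition homotopy_group :: "nat \<Rightarrow> 'a topology \<Rightarrow> 'a \<Rightarrow> ((nat \<Rightarrow> real) \<Rightarrow> 'a) set monoid" where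
  "homotopy_group n Y y =
     \<lparr>carrier = {Collect (cube_homotopic n Y y f) |f.
                   continuous_map (cube n) Y f \<and> f ` cube_boundary n \<subseteq> {y}},
      monoid.mult = (\<lambda>A B. {h. \<exists>f\<in>A. \<exists>g\<in>B. cube_homotopic n Y y (cube_concat f g) h}),
      one = Collect (cube_homotopic n Y y (\<lambda>_. y))\<rparr>"

text \<open>Only \<open>\<pi>\<^sub>j\<close> with \<open>1 \<le> j\<close> is involved: path-connectedness is not part of the notion.\<close>

definition m_connected_at :: "nat \<Rightarrow> 'a topology \<Rightarrow> 'a \<Rightarrow> bool" where
  "m_connected_at m Y y \<longleftrightarrow> (\<forall>j. 1 \<le> j \<and> j \<le> m \<longrightarrow> trivial_group (homotopy_group j Y y))"

definition m_connected :: "nat \<Rightarrow> 'a topology \<Rightarrow> bool" where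
  "m_connected m Y \<longleftrightarrow> (\<forall>y\<in>topspace Y. m_connected_at m Y y)"


section \<open>Hawaiian earrings and Hawaiian groups\<close>

definition earring_sphere :: "nat \<Rightarrow> nat \<Rightarrow> (nat \<Rightarrow> real) set" where
  "earring_sphere n k = {r \<in> topspace (Euclidean_space (Suc n)).
      (r 0 - 1 / real k)\<^sup>2 + (\<Sum>i=1..n. (r i)\<^sup>2) = (1 / real k)\<^sup>2}"

definition hawaiian_earring :: "nat \<Rightarrow> (nat \<Rightarrow> real) topology" where
  "hawaiian_earring n = subtopology (Euclidean_space (Suc n)) (\<Union>k\<in>{1..}. earring_sphere n k)"

abbreviation earring_base :: "nat \<Rightarrow> real" where
  "earring_base \<equiv> (\<lambda>_. 0)"

text \<open>A relative homeomorphism from \<open>(I\<^sup>n, \<partial>I\<^sup>n)\<close> to the \<open>k\<close>th sphere and its base point, the same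
  for all \<open>k\<close> up to scaling. Put \<open>x = 2s - 1\<close> and \<open>d = \<Prod>\<^sub>i (1 - x\<^sub>i\<^sup>2)\<close>, which vanishes exactly on
  the boundary. Then \<open>s \<mapsto> w = x/d\<close> maps the open cube homeomorphically onto \<open>\<real>\<^sup>n\<close>, and
  \<open>w \<mapsto> (2/k) (1, w) / (1 + |w|\<^sup>2)\<close> is inverse stereographic projection onto the sphere, with
  infinity going to the base point. Clearing denominators gives the formula below.\<close>

definition sphere_param :: "nat \<Rightarrow> nat \<Rightarrow> (nat \<Rightarrow> real) \<Rightarrow> nat \<Rightarrow> real" where
  "sphere_param n k s =
     (let x = (\<lambda>i. 2 * s i - 1);
          d = (\<Prod>i<n. 1 - (x i)\<^sup>2)
      in (\<lambda>j. (2 / real k) * (if j = 0 then d\<^sup>2 else if j \<le> n then d * x (j - 1) else 0)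
               / (d\<^sup>2 + (\<Sum>i<n. (x i)\<^sup>2))))"

text \<open>The product on the \<open>k\<close>th sphere is that of \<open>\<pi>\<^sub>n\<close>, transported along \<^term>\<open>sphere_param n k\<close>;
  it does not depend on the choice of \<open>(k, s)\<close> (lemma \<open>hawaiian_concat_sphere_param\<close>).\<close>

definition hawaiian_concat ::
    "nat \<Rightarrow> ((nat \<Rightarrow> real) \<Rightarrow> 'a) \<Rightarrow> ((nat \<Rightarrow> real) \<Rightarrow> 'a) \<Rightarrow> (nat \<Rightarrow> real) \<Rightarrow> 'a" where
  "hawaiian_concat n f g r =
     (let (k, s) = (SOME (k, s). 1 \<le> k \<and> s \<in> topspace (cube n) \<and> sphere_param n k s = r)
      in cube_concat (f \<circ> sphere_param n k) (g \<circ> sphere_param n k) s)"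

lemma topspace_cube: "topspace (cube n) = {s. (\<forall>i<n. 0 \<le> s i \<and> s i \<le> 1) \<and> (\<forall>i\<ge>n. s i = 0)}"
  by (auto simp: cube_def topspace_Euclidean_space)

context
  fixes n :: nat and x :: "(nat \<Rightarrow> real) \<Rightarrow> nat \<Rightarrow> real" and d D :: "(nat \<Rightarrow> real) \<Rightarrow> real"
  defines "x \<equiv> \<lambda>s i. 2 * s i - 1" and "d \<equiv> \<lambda>s. \<Prod>i<n. 1 - (x s i)\<^sup>2"
    and "D \<equiv> \<lambda>s. (d s)\<^sup>2 + (\<Sum>i<n. (x s i)\<^sup>2)"
begin

private lemma param_eq: "sphere_param n k s =
  (\<lambda>j. (2 / real k) * (if j = 0 then (d s)\<^sup>2 else if j \<le> n then d s * x s (j - 1) else 0) / D s)"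
  unfolding sphere_param_def d_def D_def x_def Let_def by (rule refl)

private lemma x_sq: "s \<in> topspace (cube n) \<Longrightarrow> i < n \<Longrightarrow> (x s i)\<^sup>2 \<le> 1"
  by (auto simp: topspace_cube x_def abs_square_le_1)

private lemma d_zero_iff: "s \<in> topspace (cube n) \<Longrightarrow> d s = 0 \<longleftrightarrow> s \<in> cube_boundary n"
proof -
  have "1 - (x s i)\<^sup>2 = 0 \<longleftrightarrow> s i = 0 \<or> s i = 1" for i
    unfolding x_def power2_eq_square by algebra
  then show "s \<in> topspace (cube n) \<Longrightarrow> ?thesis"
    by (auto simp: d_def cube_boundary_def)
qed

private lemma d_nonneg: "s \<in> topspace (cube n) \<Longrightarrow> d s \<ge> 0"
  unfolding d_def by (intro prod_nonneg) (simp add: x_sq)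

private lemma D_pos: "D s > 0"
proof (cases "d s = 0")
  case True
  then obtain i where i: "i < n" "(x s i)\<^sup>2 = 1"
    by (auto simp: d_def)
  have "(x s i)\<^sup>2 \<le> (\<Sum>i<n. (x s i)\<^sup>2)"
    using i by (intro member_le_sum) auto
  then show ?thesis
    using i True by (simp add: D_def)
next
  case False
  then show ?thesis
    unfolding D_def by (intro add_pos_nonneg sum_nonneg) auto
qed

private lemma param_sq:
  "(\<Sum>i=1..n. (sphere_param n k s i)\<^sup>2) = 4 / (real k)\<^sup>2 * (d s)\<^sup>2 * (D s - (d s)\<^sup>2) / (D s)\<^sup>2"
proof -
  have "(\<Sum>i=1..n. (sphere_param n k s i)\<^sup>2) = (\<Sum>i<n. (sphere_param n k s (Suc i))\<^sup>2)"
    by (simp add: sum.atLeast1_atMost_eq)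
  also have "\<dots> = (\<Sum>i<n. 4 / (real k)\<^sup>2 * (d s)\<^sup>2 / (D s)\<^sup>2 * (x s i)\<^sup>2)"
    by (intro sum.cong) (auto simp: param_eq power_mult_distrib power_divide)
  also have "\<dots> = 4 / (real k)\<^sup>2 * (d s)\<^sup>2 / (D s)\<^sup>2 * (D s - (d s)\<^sup>2)"
    unfolding D_def add_diff_cancel_left' by (rule sum_distrib_left[symmetric])
  finally show ?thesis
    by simp
qed

private lemma param_norm:
  "(sphere_param n k s 0)\<^sup>2 + (\<Sum>i=1..n. (sphere_param n k s i)\<^sup>2) = 2 / real k * sphere_param n k s 0"
  unfolding param_sq using D_pos[of s]
  by (cases "k = 0") (simp_all add: param_eq field_simps power2_eq_square)

private lemma param_in_sphere: "k \<ge> 1 \<Longrightarrow> sphere_param n k s \<in> earring_sphere n k"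
  using param_norm[of k s]
  by (auto simp: earring_sphere_def topspace_Euclidean_space power2_diff) (auto simp: param_eq)

private lemma param_eq_0_iff:
  assumes "k \<ge> 1" "s \<in> topspace (cube n)"
  shows "sphere_param n k s 0 = 0 \<longleftrightarrow> s \<in> cube_boundary n"
  using assms D_pos[of s] by (simp add: param_eq d_zero_iff)

private lemma param_boundary:
  "s \<in> cube_boundary n \<Longrightarrow> sphere_param n k s = earring_base"
  using d_zero_iff[of s] by (auto simp: param_eq cube_boundary_def)

private lemma param_inj:
  assumes k: "k \<ge> 1" "k' \<ge> 1" and s: "s \<in> topspace (cube n) - cube_boundary n" and s': "s' \<in> topspace (cube n)"
    and eq: "sphere_param n k s = sphere_param n k' s'"
  shows "k = k' \<and> s = s'"
proof -
  have ne: "sphere_param n k s 0 \<noteq> 0"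
    using param_eq_0_iff k s by auto
  then have "s' \<notin> cube_boundary n"
    using eq param_boundary by metis
  then have d: "d s > 0" "d s' > 0"
    using d_zero_iff[of s] d_zero_iff[of s'] d_nonneg[of s] d_nonneg[of s'] s s' by auto
  have kk: "k = k'"
    using param_norm[of k s] param_norm[of k' s'] ne k unfolding eq by (simp add: frac_eq_eq)
  have A: "x s i / d s = x s' i / d s'" if "i < n" for i
  proof -
    have *: "sphere_param n k t (Suc i) / sphere_param n k t 0 = x t i / d t" if "d t > 0" for t
      using \<open>i < n\<close> that k D_pos[of t] by (simp add: param_eq field_simps power2_eq_square)
    show ?thesis
      using *[OF d(1)] *[OF d(2)] eq kk by simp
  qed
  have mono: "d t' \<le> d t" if "d t \<le> d t'" "0 < d t" "t' \<in> topspace (cube n)" "\<forall>i<n. x t i / d t = x t' i / d t'" for t t'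
  proof -
    have "(x t i)\<^sup>2 \<le> (x t' i)\<^sup>2" if "i < n" for i
    proof -
      have "x t i = x t' i * (d t / d t')"
        using that \<open>\<forall>i<n. _\<close> \<open>0 < d t\<close> \<open>d t \<le> d t'\<close> by (auto simp: field_simps)
      moreover have "(d t / d t')\<^sup>2 \<le> 1"
        using \<open>0 < d t\<close> \<open>d t \<le> d t'\<close> by (simp add: power_le_one)
      ultimately show ?thesis
        by (metis mult_left_le power_mult_distrib zero_le_power2)
    qed
    then show ?thesis
      unfolding d_def using x_sq[OF \<open>t' \<in> _\<close>] by (intro prod_mono) (auto)
  qed
  have "d s = d s'"
  proof (cases "d s \<le> d s'")
    case True
    then have "d s' \<le> d s"
      using A d s' by (intro mono[of s s']) auto
    then show ?thesis
      using True by simp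
  next
    case False
    then have "d s \<le> d s'"
      using A d s by (intro mono[of s' s]) auto
    then show ?thesis
      using False by simp
  qed
  then have "s i = s' i" if "i < n" for i
    using A[OF that] d by (simp add: x_def)
  moreover have "s i = s' i" if "i \<ge> n" for i
    using that s s' by (simp add: topspace_cube)
  ultimately show ?thesis
    using kk by (auto simp: fun_eq_iff) (meson leI)
qed

private lemma upd_boundary:
  assumes s: "s \<in> cube_boundary n" and c: "0 \<le> c" "c \<le> 1" "s 0 = 0 \<or> s 0 = 1 \<Longrightarrow> c = 0 \<or> c = 1"
  shows "s(0 := c) \<in> cube_boundary n"
proof -
  obtain i where i: "i < n" "s i = 0 \<or> s i = 1"
    and sc: "\<And>j. j < n \<Longrightarrow> 0 \<le> s j \<and> s j \<le> 1" "\<And>j. j \<ge> n \<Longrightarrow> s j = 0"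
    using s by (auto simp: cube_boundary_def topspace_cube)
  have "(s(0 := c)) i = 0 \<or> (s(0 := c)) i = 1"
    using i c by (cases "i = 0") auto
  moreover have "s(0 := c) \<in> topspace (cube n)"
    using sc c i by (simp add: topspace_cube)
  ultimately show ?thesis
    using i(1) unfolding cube_boundary_def by blast
qed

private lemma concat_boundary:
  assumes s: "s \<in> cube_boundary n" and fg: "f earring_base = g earring_base"
  shows "cube_concat (f \<circ> sphere_param n k) (g \<circ> sphere_param n k) s = f earring_base"
proof -
  have s0: "0 \<le> s 0" "s 0 \<le> 1"
    using s by (auto simp: cube_boundary_def topspace_cube)
  show ?thesis
  proof (cases "s 0 \<le> 1/2")
    case True
    have "s(0 := 2 * s 0) \<in> cube_boundary n"
      using True s0 by (intro upd_boundary s) auto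
    then show ?thesis
      using True by (simp add: cube_concat_def param_boundary)
  next
    case False
    have "s(0 := 2 * s 0 - 1) \<in> cube_boundary n"
      using False s0 by (intro upd_boundary s) auto
    then show ?thesis
      using False fg by (simp add: cube_concat_def param_boundary)
  qed
qed

lemma hawaiian_concat_sphere_param:
  assumes k: "k \<ge> 1" and s: "s \<in> topspace (cube n)" and fg: "f earring_base = g earring_base"
  shows "hawaiian_concat n f g (sphere_param n k s)
           = cube_concat (f \<circ> sphere_param n k) (g \<circ> sphere_param n k) s"
proof -
  let ?P = "\<lambda>(k', s'). 1 \<le> k' \<and> s' \<in> topspace (cube n) \<and> sphere_param n k' s' = sphere_param n k s"
  obtain k' s' where ks': "(SOME p. ?P p) = (k', s')"
    by (cases "SOME p. ?P p") simp
  have "?P (k, s)"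
    using k s by simp
  then have "?P (k', s')"
    using someI[of ?P "(k, s)"] ks' by simp
  then have P: "1 \<le> k'" "s' \<in> topspace (cube n)" "sphere_param n k' s' = sphere_param n k s"
    by simp_all
  have *: "hawaiian_concat n f g (sphere_param n k s)
             = cube_concat (f \<circ> sphere_param n k') (g \<circ> sphere_param n k') s'"
    using ks' by (simp add: hawaiian_concat_def)
  show ?thesis
  proof (cases "s \<in> cube_boundary n")
    case True
    then have "s' \<in> cube_boundary n"
      using P param_eq_0_iff[of k' s'] param_boundary[of s k] by simp
    then show ?thesis
      using * True concat_boundary[of s f g k] concat_boundary[of s' f g k'] fg by simp
  next
    case False
    then show ?thesis
      using * param_inj[of k k' s s'] P k s by simp
  qed
qed

lemma sphere_param_image:
  assumes k: "k \<ge> 1" and n: "n \<ge> 1"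
  shows "sphere_param n k ` topspace (cube n) = earring_sphere n k"
proof
  show "sphere_param n k ` topspace (cube n) \<subseteq> earring_sphere n k"
    using param_in_sphere k by blast
  show "earring_sphere n k \<subseteq> sphere_param n k ` topspace (cube n)"
  proof
    fix r
    assume "r \<in> earring_sphere n k"
    then have r: "\<And>i. i > n \<Longrightarrow> r i = 0" and nrm: "(r 0)\<^sup>2 + (\<Sum>i=1..n. (r i)\<^sup>2) = 2 / real k * r 0"
      by (auto simp: earring_sphere_def topspace_Euclidean_space power2_diff)
    show "r \<in> sphere_param n k ` topspace (cube n)"
    proof (cases "r 0 = 0")
      case True
      then have "(\<Sum>i=1..n. (r i)\<^sup>2) = 0"
        using nrm by simp
      then have "\<forall>i\<in>{1..n}. (r i)\<^sup>2 = 0"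
        by (subst (asm) sum_nonneg_eq_0_iff) auto
      then have "r i = 0" for i
        using True r[of i] by (cases "i = 0"; cases "i > n") auto
      moreover have "earring_base \<in> cube_boundary n"
        using n by (auto simp: cube_boundary_def topspace_cube intro: exI[of _ 0])
      ultimately have "r = sphere_param n k earring_base" "earring_base \<in> topspace (cube n)"
        using param_boundary by (auto simp: cube_boundary_def)
      then show ?thesis
        by blast
    next
      case False
      have "2 / real k * r 0 \<ge> 0"
        unfolding nrm[symmetric] by (intro add_nonneg_nonneg sum_nonneg) auto
      then have r0: "r 0 > 0"
        using False k by (auto simp: zero_le_mult_iff zero_le_divide_iff)
      define w where "w i = r (Suc i) / r 0" for i
      define W where "W = Max (insert 1 ((\<lambda>i. \<bar>w i\<bar>) ` {..<n}))"
      have W: "W \<ge> 1" "\<And>i. i < n \<Longrightarrow> \<bar>w i\<bar> \<le> W"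
        unfolding W_def by (auto intro: Max_ge)
      define h where "h t = (\<Prod>i<n. 1 - (t * w i)\<^sup>2) - t" for t
      have "\<exists>t\<ge>0. t \<le> 1 / W \<and> h t = 0"
      proof (rule IVT2')
        have M: "\<exists>i<n. \<bar>w i\<bar> = W" if "W \<noteq> 1"
        proof -
          have "W \<in> insert 1 ((\<lambda>i. \<bar>w i\<bar>) ` {..<n})"
            unfolding W_def by (rule Max_in) auto
          with that show ?thesis by auto
        qed
        have Z: "(\<Prod>i<n. 1 - (1 / W * w i)\<^sup>2) = 0" if "i < n" "\<bar>w i\<bar> = W" for i
        proof -
          have "(w i)\<^sup>2 = W\<^sup>2"
            using that(2) power2_abs by metis
          then have "1 - (1 / W * w i)\<^sup>2 = 0"
            using W by (simp add: power_divide)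
          then show ?thesis
            using that(1) by (meson finite_lessThan lessThan_iff prod_zero)
        qed
        have L: "(\<Prod>i<n. 1 - (1 / W * w i)\<^sup>2) \<le> 1"
        proof (rule prod_le_1)
          fix i assume "i \<in> {..<n}"
          then have "\<bar>w i / W\<bar> \<le> 1"
            using W by auto
          then have "(w i / W)\<^sup>2 \<le> 1"
            by (simp add: abs_square_le_1)
          then show "0 \<le> 1 - (1 / W * w i)\<^sup>2 \<and> 1 - (1 / W * w i)\<^sup>2 \<le> 1"
            by simp
        qed
        show "h (1 / W) \<le> 0"
        proof (cases "W = 1")
          case True
          then show ?thesis
            using L by (simp add: h_def)
        next
          case False
          then have p0: "(\<Prod>i<n. 1 - (1 / W * w i)\<^sup>2) = 0"
            using M Z by blast
          show ?thesis
            unfolding h_def p0 using W by simp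
        qed
        show "0 \<le> h 0"
          by (simp add: h_def)
        show "0 \<le> 1 / W"
          using W by simp
        show "continuous_on {0..1 / W} h"
          unfolding h_def by (intro continuous_intros)
      qed
      then obtain t where t: "0 \<le> t" "t \<le> 1 / W" "h t = 0"
        by blast
      have tw: "\<bar>t * w i\<bar> \<le> 1" if "i < n" for i
      proof -
        have "\<bar>t * w i\<bar> \<le> (1 / W) * W"
          unfolding abs_mult using t W that by (intro mult_mono) auto
        then show ?thesis
          using W by simp
      qed
      define s where "s i = (if i < n then (t * w i + 1) / 2 else 0)" for i
      have s: "s \<in> topspace (cube n)"
        using tw by (auto simp: topspace_cube s_def abs_le_iff field_simps) (smt (verit))
      have xs: "x s i = t * w i" if "i < n" for i
        using that by (simp add: x_def s_def field_simps)
      then have ds: "d s = t"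
        using t(3) by (simp add: d_def h_def)
      have "t \<noteq> 0"
        using t(3) by (auto simp: h_def)
      have "(\<Sum>i<n. (w i)\<^sup>2) = (\<Sum>i=1..n. (r i)\<^sup>2) / (r 0)\<^sup>2"
        unfolding w_def power_divide sum_divide_distrib[symmetric]
        by (simp add: sum.atLeast1_atMost_eq)
      moreover have "(\<Sum>i=1..n. (r i)\<^sup>2) = 2 / real k * r 0 - (r 0)\<^sup>2"
        using nrm by simp
      ultimately have ww: "1 + (\<Sum>i<n. (w i)\<^sup>2) = 2 / real k / r 0"
        using r0 by (simp add: diff_divide_distrib power2_eq_square)
      have Ds: "D s = t\<^sup>2 * (2 / real k / r 0)"
        unfolding ww[symmetric] by (simp add: D_def ds xs power_mult_distrib sum_distrib_left algebra_simps)
      have "sphere_param n k s j = r j" for j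
      proof -
        consider "j = 0" | i where "j = Suc i" "i < n" | "j > n"
          by (metis Suc_le_eq not_less not0_implies_Suc)
        then show ?thesis
        proof cases
          case 1
          then show ?thesis
            using k r0 \<open>t \<noteq> 0\<close> by (simp add: param_eq Ds ds)
        next
          case 2
          then show ?thesis
            using k r0 \<open>t \<noteq> 0\<close> by (simp add: param_eq Ds ds xs w_def power2_eq_square)
        next
          case 3
          then show ?thesis
            using r by (simp add: param_eq)
        qed
      qed
      then have "sphere_param n k s = r"
        by (rule ext)
      then show ?thesis
        using s by blast
    qed
  qed
qed

end

definition hawaiian_homotopic ::
    "nat \<Rightarrow> 'a topology \<Rightarrow> 'a \<Rightarrow> ((nat \<Rightarrow> real) \<Rightarrow> 'a) \<Rightarrow> ((nat \<Rightarrow> real) \<Rightarrow> 'a) \<Rightarrow> bool" where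
  "hawaiian_homotopic n X x0 =
     homotopic_with (\<lambda>h. h earring_base = x0) (hawaiian_earring n) X"

definition hawaiian_group :: "nat \<Rightarrow> 'a topology \<Rightarrow> 'a \<Rightarrow> ((nat \<Rightarrow> real) \<Rightarrow> 'a) set monoid" where
  "hawaiian_group n X x0 =
     \<lparr>carrier = {Collect (hawaiian_homotopic n X x0 f) |f.
                   continuous_map (hawaiian_earring n) X f \<and> f earring_base = x0},
      monoid.mult = (\<lambda>A B. {h. \<exists>f\<in>A. \<exists>g\<in>B. hawaiian_homotopic n X x0 (hawaiian_concat n f g) h}),
      one = Collect (hawaiian_homotopic n X x0 (\<lambda>_. x0))\<rparr>"


section \<open>CW-complexes\<close>

text \<open>\<open>E\<close> is the set of open cells, \<open>d e\<close> the dimension of the cell \<open>e\<close> and \<open>\<Phi> e\<close> its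
  characteristic map. The last two conditions are closure finiteness and the weak topology.\<close>

definition CW_structure ::
    "'a topology \<Rightarrow> 'a set set \<Rightarrow> ('a set \<Rightarrow> nat) \<Rightarrow> ('a set \<Rightarrow> (nat \<Rightarrow> real) \<Rightarrow> 'a) \<Rightarrow> bool" where
  "CW_structure X E d \<Phi> \<longleftrightarrow>
     Hausdorff_space X \<and> \<Union>E = topspace X \<and> pairwise disjnt E \<and>
     (\<forall>e\<in>E. continuous_map (subtopology (Euclidean_space (d e)) {x. (\<Sum>i<d e. (x i)\<^sup>2) \<le> 1}) X (\<Phi> e) \<and>
            homeomorphic_map (subtopology (Euclidean_space (d e)) {x. (\<Sum>i<d e. (x i)\<^sup>2) < 1})
                             (subtopology X e) (\<Phi> e) \<and>
            (\<exists>F\<subseteq>E. finite F \<and> (\<forall>c\<in>F. d c < d e) \<and>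
               \<Phi> e ` {x \<in> topspace (Euclidean_space (d e)). (\<Sum>i<d e. (x i)\<^sup>2) = 1} \<subseteq> \<Union>F)) \<and>
     (\<forall>A\<subseteq>topspace X. (\<forall>e\<in>E. closedin X (A \<inter> X closure_of e)) \<longrightarrow> closedin X A)"

text \<open>An open set meets a cell iff it meets the closure of that cell.\<close>

definition locally_finite_CW_complex :: "'a topology \<Rightarrow> bool" where
  "locally_finite_CW_complex X \<longleftrightarrow>
     (\<exists>E d \<Phi>. CW_structure X E d \<Phi> \<and>
        (\<forall>x\<in>topspace X. \<exists>U. openin X U \<and> x \<in> U \<and> finite {e \<in> E. e \<inter> U \<noteq> {}}))"


section \<open>Wedge sums\<close>

text \<open>The quotient of the disjoint union in which \<^term>\<open>Inr x2\<close> is identified with \<^term>\<open>Inl x1\<close>;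
  the latter represents the common base point.\<close>

definition wedge_inr :: "'a \<Rightarrow> 'b \<Rightarrow> 'b \<Rightarrow> 'a + 'b" where
  "wedge_inr x1 x2 y = (if y = x2 then Inl x1 else Inr y)"

definition wedge :: "'a topology \<Rightarrow> 'a \<Rightarrow> 'b topology \<Rightarrow> 'b \<Rightarrow> ('a + 'b) topology" where
  "wedge X1 x1 X2 x2 = topology (\<lambda>U.
     U \<subseteq> Inl ` topspace X1 \<union> wedge_inr x1 x2 ` topspace X2 \<and>
     openin X1 {x \<in> topspace X1. Inl x \<in> U} \<and>
     openin X2 {y \<in> topspace X2. wedge_inr x1 x2 y \<in> U})"

lemma openin_wedge:
  "openin (wedge X1 x1 X2 x2) U \<longleftrightarrow>
     U \<subseteq> Inl ` topspace X1 \<union> wedge_inr x1 x2 ` topspace X2 \<and>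
     openin X1 {x \<in> topspace X1. Inl x \<in> U} \<and>
     openin X2 {y \<in> topspace X2. wedge_inr x1 x2 y \<in> U}"
proof -
  have 1: "{x \<in> topspace X. j x \<in> S \<inter> T} = {x \<in> topspace X. j x \<in> S} \<inter> {x \<in> topspace X. j x \<in> T}"
    for X :: "'c topology" and j :: "'c \<Rightarrow> 'a + 'b" and S T
    by auto
  have 2: "{x \<in> topspace X. j x \<in> \<Union>\<K>} = (\<Union>K\<in>\<K>. {x \<in> topspace X. j x \<in> K})"
    for X :: "'c topology" and j :: "'c \<Rightarrow> 'a + 'b" and \<K>
    by auto
  have "istopology (\<lambda>U. U \<subseteq> Inl ` topspace X1 \<union> wedge_inr x1 x2 ` topspace X2 \<and>
     openin X1 {x \<in> topspace X1. Inl x \<in> U} \<and>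
     openin X2 {y \<in> topspace X2. wedge_inr x1 x2 y \<in> U})"
    unfolding istopology_def 1 2 by blast
  then show ?thesis
    by (simp add: wedge_def)
qed

lemma topspace_wedge:
  "topspace (wedge X1 x1 X2 x2) = Inl ` topspace X1 \<union> wedge_inr x1 x2 ` topspace X2" (is "?L = ?R")
proof
  show "?L \<subseteq> ?R"
    using openin_wedge[of X1 x1 X2 x2 "topspace (wedge X1 x1 X2 x2)"] by simp
  have "{x \<in> topspace X1. Inl x \<in> ?R} = topspace X1"
    "{y \<in> topspace X2. wedge_inr x1 x2 y \<in> ?R} = topspace X2"
    by auto
  then have "openin (wedge X1 x1 X2 x2) ?R"
    unfolding openin_wedge by simp
  then show "?R \<subseteq> ?L"
    by (rule openin_subset)
qed

end

theory Submission
  imports Defs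
begin

text \<open>A class \<open>[f]\<close> goes to the classes of its two projections, and the inverse adds the two inclusions.
  This is well defined on both sides once every \<open>f\<close> is homotopic to the product of its two
  projections, included in the wedge. Maps into the wedge are pairs of maps of which, at each point,
  one is at the base point; all homotopies below are pairs of homotopies with this property.

  Each \<open>X\<^sub>i\<close> has a homotopy from the identity, fixing the base point, to a map that is constant near it.
  After applying it, \<open>f\<close> is constant on almost all spheres, and every point of the earring has a
  neighbourhood on which one component of \<open>f\<close> is constant. On the cube over one of the finitely many
  remaining spheres there is a cubical grid such that on each cell one component is constant. As the
  \<open>X\<^sub>i\<close> are \<open>(n-1)\<close>-connected, both components can be made constant on the \<open>(n-1)\<close>-skeleton of the grid
  without disturbing the cells where they are constant. Now shrink the support of the first
  component towards one corner of each cell and that of the second towards the opposite corner. Then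
  the supports are disjoint already in coordinate 1 (this uses \<open>n \<ge> 2\<close>), so the components
  can be moved freely in coordinate 0: the first to the left half of the cube and the second to
  the right half. The result is the product.\<close>


section \<open>Maps into a wedge\<close>

text \<open>Homotopies chosen on single spheres combine to a continuous homotopy on the earring only
  if, for every neighbourhood of the base point, almost all of them stay inside it. Nothing bounds
  the size of the null-homotopies that connectivity provides, so only finitely many spheres may use
  them; this is why \<open>f\<close> is first made constant on the others. The same deformation
  removes a local obstacle: the preimage of the wedge point can be any closed set, and the supports
  of the two components may touch there, so that no grid separates them. Once the component that is
  trivial at a point is trivial near it, a Lebesgue number gives the grid. The deformation comes
  from local finiteness: a finite subcomplex is compact and arises by attaching one cell at a time,
  and surjections from compact onto Hausdorff spaces are quotient maps, also after multiplication
  with the interval. Connectivity speaks of positive dimensions only. Vertices of the grid are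
  trivialised along segments to a corner of the box, where the map has the base value.\<close>

definition wedge_fst :: "'a \<Rightarrow> 'a + 'b \<Rightarrow> 'a" where
  "wedge_fst x1 z = (case z of Inl a \<Rightarrow> a | Inr b \<Rightarrow> x1)"

definition wedge_snd :: "'b \<Rightarrow> 'a + 'b \<Rightarrow> 'b" where
  "wedge_snd x2 z = (case z of Inl a \<Rightarrow> x2 | Inr b \<Rightarrow> b)"

text \<open>Meaningful only where \<open>a\<close> or \<open>b\<close> is a base point. For
  \<open>b = x2\<close> the value has to be \<open>Inl a\<close>, because \<open>Inr x2\<close> is
  not a point of the wedge.\<close>

definition wedge_pair :: "'b \<Rightarrow> 'a \<Rightarrow> 'b \<Rightarrow> 'a + 'b" where
  "wedge_pair x2 a b = (if b = x2 then Inl a else Inr b)"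

lemma wedge_fst_pair: "a = x1 \<or> b = x2 \<Longrightarrow> wedge_fst x1 (wedge_pair x2 a b) = a"
  by (auto simp: wedge_fst_def wedge_pair_def)

lemma wedge_snd_pair: "wedge_snd x2 (wedge_pair x2 a b) = b"
  by (auto simp: wedge_snd_def wedge_pair_def)

lemma wedge_pair_fst_snd:
  "z \<in> topspace (wedge X1 x1 X2 x2) \<Longrightarrow> wedge_pair x2 (wedge_fst x1 z) (wedge_snd x2 z) = z"
  by (auto simp: topspace_wedge wedge_pair_def wedge_fst_def wedge_snd_def wedge_inr_def)

lemma wedge_fst_or_snd: "wedge_fst x1 z = x1 \<or> wedge_snd x2 z = x2"
  by (cases z) (auto simp: wedge_fst_def wedge_snd_def)

lemma continuous_map_wedge_fst:
  assumes "x1 \<in> topspace X1"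
  shows "continuous_map (wedge X1 x1 X2 x2) X1 (wedge_fst x1)"
  unfolding continuous_map_def
proof (intro conjI allI impI)
  show "wedge_fst x1 \<in> topspace (wedge X1 x1 X2 x2) \<rightarrow> topspace X1"
    using assms by (auto simp: topspace_wedge wedge_fst_def wedge_inr_def)
  fix U assume U: "openin X1 U"
  let ?P = "{z \<in> topspace (wedge X1 x1 X2 x2). wedge_fst x1 z \<in> U}"
  have "{x \<in> topspace X1. Inl x \<in> ?P} = U"
    using openin_subset[OF U] by (auto simp: topspace_wedge wedge_fst_def)
  moreover have "{y \<in> topspace X2. wedge_inr x1 x2 y \<in> ?P} = (if x1 \<in> U then topspace X2 else {})"
    by (auto simp: topspace_wedge wedge_fst_def wedge_inr_def)
  ultimately show "openin (wedge X1 x1 X2 x2) ?P"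
    unfolding openin_wedge using U by (auto simp: topspace_wedge)
qed

lemma continuous_map_wedge_snd:
  assumes "x2 \<in> topspace X2"
  shows "continuous_map (wedge X1 x1 X2 x2) X2 (wedge_snd x2)"
  unfolding continuous_map_def
proof (intro conjI allI impI)
  show "wedge_snd x2 \<in> topspace (wedge X1 x1 X2 x2) \<rightarrow> topspace X2"
    using assms by (auto simp: topspace_wedge wedge_snd_def wedge_inr_def)
  fix U assume U: "openin X2 U"
  let ?P = "{z \<in> topspace (wedge X1 x1 X2 x2). wedge_snd x2 z \<in> U}"
  have "{y \<in> topspace X2. wedge_inr x1 x2 y \<in> ?P} = U"
    using openin_subset[OF U] by (auto simp: topspace_wedge wedge_snd_def wedge_inr_def)
  moreover have "{x \<in> topspace X1. Inl x \<in> ?P} = (if x2 \<in> U then topspace X1 else {})"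
    by (auto simp: topspace_wedge wedge_snd_def)
  ultimately show "openin (wedge X1 x1 X2 x2) ?P"
    unfolding openin_wedge using U by (auto simp: topspace_wedge)
qed

text \<open>The preimage of an open \<open>U\<close> is the intersection of two component preimages
  if the wedge point lies in \<open>U\<close>, since a component at its base point then imposes no
  condition. Otherwise it is their union, since such a component never contributes.\<close>

lemma continuous_map_wedge_pair:
  assumes f: "continuous_map T X1 f" and g: "continuous_map T X2 g"
    and x: "x1 \<in> topspace X1" "x2 \<in> topspace X2"
    and sep: "\<And>t. t \<in> topspace T \<Longrightarrow> f t = x1 \<or> g t = x2"
  shows "continuous_map T (wedge X1 x1 X2 x2) (\<lambda>t. wedge_pair x2 (f t) (g t))"
  unfolding continuous_map_def
proof (intro conjI allI impI)
  have fg: "\<And>t. t \<in> topspace T \<Longrightarrow> f t \<in> topspace X1 \<and> g t \<in> topspace X2"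
    using f g by (auto simp: continuous_map_def)
  show "(\<lambda>t. wedge_pair x2 (f t) (g t)) \<in> topspace T \<rightarrow> topspace (wedge X1 x1 X2 x2)"
    using fg by (force simp: topspace_wedge wedge_pair_def wedge_inr_def)
  fix U assume U: "openin (wedge X1 x1 X2 x2) U"
  define U1 where "U1 = {x \<in> topspace X1. Inl x \<in> U}"
  define U2 where "U2 = {y \<in> topspace X2. wedge_inr x1 x2 y \<in> U}"
  have op: "openin X1 U1" "openin X2 U2"
    using U by (auto simp: openin_wedge U1_def U2_def)
  then have op': "openin T {t \<in> topspace T. f t \<in> U1}" "openin T {t \<in> topspace T. g t \<in> U2}"
    using f g by (auto simp: continuous_map_def)
  show "openin T {t \<in> topspace T. wedge_pair x2 (f t) (g t) \<in> U}"
  proof (cases "Inl x1 \<in> U")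
    case True
    have "{t \<in> topspace T. wedge_pair x2 (f t) (g t) \<in> U}
        = {t \<in> topspace T. f t \<in> U1} \<inter> {t \<in> topspace T. g t \<in> U2}"
      using True fg sep x by (auto simp: U1_def U2_def wedge_pair_def wedge_inr_def split: if_splits)
    then show ?thesis
      using op' by auto
  next
    case False
    have "{t \<in> topspace T. wedge_pair x2 (f t) (g t) \<in> U}
        = {t \<in> topspace T. f t \<in> U1} \<union> {t \<in> topspace T. g t \<in> U2}"
      using False fg sep x by (auto simp: U1_def U2_def wedge_pair_def wedge_inr_def split: if_splits)
    then show ?thesis
      using op' by auto
  qed
qed

text \<open>As \<open>B\<close> lies in the space, the side condition does not see values outside
  it; so the ends have to match on the space only.\<close>

lemma homotopic_with_imageI:
  assumes "continuous_map (prod_topology (top_of_set {0..1::real}) T) Y H" "B \<subseteq> topspace T"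
    and "\<And>s. s \<in> topspace T \<Longrightarrow> H (0, s) = p s" "\<And>s. s \<in> topspace T \<Longrightarrow> H (1, s) = q s"
    and "\<And>t s. t \<in> {0..1::real} \<Longrightarrow> s \<in> B \<Longrightarrow> H (t, s) = y"
  shows "homotopic_with (\<lambda>h. h ` B \<subseteq> {y}) T Y p q"
proof (subst homotopic_with)
  show "(h ` B \<subseteq> {y}) = (k ` B \<subseteq> {y})" if "\<And>x. x \<in> topspace T \<Longrightarrow> h x = k x" for h k
    using that assms(2) by (metis image_cong subset_iff)
  show "\<exists>h. continuous_map (prod_topology (top_of_set {0..1::real}) T) Y h \<and>
         (\<forall>x\<in>topspace T. h (0, x) = p x) \<and> (\<forall>x\<in>topspace T. h (1, x) = q x) \<and>
         (\<forall>t\<in>{0..1::real}. (\<lambda>x. h (t, x)) ` B \<subseteq> {y})"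
    by (intro exI[of _ H] conjI ballI image_subsetI) (use assms in simp_all)
qed

lemma homotopic_with_imageE:
  assumes "homotopic_with (\<lambda>h. h ` B \<subseteq> {y}) T Y p q"
  obtains H where "continuous_map (prod_topology (top_of_set {0..1::real}) T) Y H"
    "\<And>s. H (0, s) = p s" "\<And>s. H (1, s) = q s" "\<And>t s. t \<in> {0..1::real} \<Longrightarrow> s \<in> B \<Longrightarrow> H (t, s) = y"
proof -
  from assms obtain H where H: "continuous_map (prod_topology (top_of_set {0..1::real}) T) Y H"
    "\<forall>s. H (0, s) = p s" "\<forall>s. H (1, s) = q s" "\<forall>t\<in>{0..1}. (\<lambda>s. H (t, s)) ` B \<subseteq> {y}"
    unfolding homotopic_with_def by blast
  show thesis
    by (rule that[of H]) (use H in \<open>simp_all add: image_subset_iff\<close>)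
qed

lemma homotopic_with_image_cong:
  assumes "homotopic_with (\<lambda>h. h ` B \<subseteq> {y}) T Y p q" "B \<subseteq> topspace T"
    and "\<And>s. s \<in> topspace T \<Longrightarrow> p s = p' s" "\<And>s. s \<in> topspace T \<Longrightarrow> q s = q' s"
  shows "homotopic_with (\<lambda>h. h ` B \<subseteq> {y}) T Y p' q'"
proof -
  obtain H where "continuous_map (prod_topology (top_of_set {0..1::real}) T) Y H"
    "\<And>s. H (0, s) = p s" "\<And>s. H (1, s) = q s" "\<And>t s. t \<in> {0..1} \<Longrightarrow> s \<in> B \<Longrightarrow> H (t, s) = y"
    using assms(1) by (rule homotopic_with_imageE) blast
  then show ?thesis
    using assms(2-) by (intro homotopic_with_imageI[of T Y H]) auto
qed

lemma homotopic_with_wedge_pair: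
  assumes F: "continuous_map (prod_topology (top_of_set {0..1::real}) T) X1 F"
    and G: "continuous_map (prod_topology (top_of_set {0..1::real}) T) X2 G"
    and x: "x1 \<in> topspace X1" "x2 \<in> topspace X2"
    and sep: "\<And>t s. t \<in> {0..1::real} \<Longrightarrow> s \<in> topspace T \<Longrightarrow> F (t, s) = x1 \<or> G (t, s) = x2"
    and B: "B \<subseteq> topspace T" "\<And>t s. t \<in> {0..1::real} \<Longrightarrow> s \<in> B \<Longrightarrow> F (t, s) = x1 \<and> G (t, s) = x2"
    and p: "\<And>s. s \<in> topspace T \<Longrightarrow> wedge_pair x2 (F (0, s)) (G (0, s)) = p s"
    and q: "\<And>s. s \<in> topspace T \<Longrightarrow> wedge_pair x2 (F (1, s)) (G (1, s)) = q s"
  shows "homotopic_with (\<lambda>h. h ` B \<subseteq> {Inl x1}) T (wedge X1 x1 X2 x2) p q"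
proof (rule homotopic_with_imageI)
  show "continuous_map (prod_topology (top_of_set {0..1::real}) T) (wedge X1 x1 X2 x2)
          (\<lambda>z. wedge_pair x2 (F z) (G z))"
    by (intro continuous_map_wedge_pair F G x) (use sep in \<open>simp add: mem_Times_iff split_paired_all\<close>)
  show "wedge_pair x2 (F (t, s)) (G (t, s)) = Inl x1" if "t \<in> {0..1}" "s \<in> B" for t s
    using B(2)[OF that] by (simp add: wedge_pair_def)
qed (simp_all add: B p q)

section \<open>Points of locally finite CW-complexes are nondegenerate\<close>

lemma Euclidean_space_eq_top_of_set: "Euclidean_space n = top_of_set {x. \<forall>i\<ge>n. x i = 0}"
  unfolding Euclidean_space_def euclidean_product_topology ..

lemma compact_PiE_UNIV:
  fixes K :: "'i \<Rightarrow> 'b::topological_space set"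
  assumes "\<And>i. compact (K i)"
  shows "compact {s. \<forall>i. s i \<in> K i}"
proof -
  have "compactin (product_topology (\<lambda>i. euclidean) UNIV) (PiE UNIV K)"
    using assms by (simp add: compactin_PiE)
  moreover have "PiE UNIV K = {s. \<forall>i. s i \<in> K i}"
    by auto
  ultimately show ?thesis
    by (simp add: euclidean_product_topology)
qed

section \<open>Discs, and spaces with one cell attached\<close>

definition disc :: "nat \<Rightarrow> (nat \<Rightarrow> real) set" where
  "disc d = {p. (\<forall>i\<ge>d. p i = 0) \<and> L2_set p {..<d} \<le> 1}"

lemma continuous_on_L2_set [continuous_intros]:
  assumes "\<And>i. i \<in> A \<Longrightarrow> continuous_on S (\<lambda>x. f x i)"
  shows "continuous_on S (\<lambda>x. L2_set (f x) A)"
  unfolding L2_set_def using assms by (intro continuous_intros) auto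

lemma continuous_on_coord [continuous_intros]: "continuous_on S (\<lambda>s::'i \<Rightarrow> 'b::topological_space. s i)"
  by (rule continuous_on_subset[OF continuous_on_product_coordinates subset_UNIV])

lemma continuous_on_snd_coord [continuous_intros]:
  "continuous_on S (\<lambda>z::'c::topological_space \<times> ('i \<Rightarrow> 'b::topological_space). snd z i)"
  by (rule continuous_on_product_then_coordinatewise) (intro continuous_intros)

lemma compact_disc: "compact (disc d)"
proof -
  have 1: "compact {s::nat\<Rightarrow>real. \<forall>i. s i \<in> (if i < d then {-1..1} else {0})}"
    by (rule compact_PiE_UNIV) auto
  have 2: "closed {p::nat\<Rightarrow>real. L2_set p {..<d} \<le> 1}"
    by (intro closed_Collect_le continuous_intros)
  have "\<bar>p i\<bar> \<le> 1" if "L2_set p {..<d} \<le> 1" "i < d" for p :: "nat \<Rightarrow> real" and i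
  proof -
    have "L2_set (\<lambda>i. \<bar>p i\<bar>) {..<d} = L2_set p {..<d}"
      by (simp add: L2_set_def)
    then show ?thesis
      using member_le_L2_set[of "{..<d}" i "\<lambda>i. \<bar>p i\<bar>"] that by simp
  qed
  then have "disc d = {s. \<forall>i. s i \<in> (if i < d then {-1..1} else {0})} \<inter> {p. L2_set p {..<d} \<le> 1}"
    by (auto simp: disc_def abs_le_iff split: if_splits)
  then show ?thesis
    using compact_Int_closed[OF 1 2] by simp
qed

lemma L2_set_scale: "c \<ge> 0 \<Longrightarrow> L2_set (\<lambda>i. c * p i) A = c * L2_set p A"
  by (simp add: L2_set_right_distrib)

text \<open>A weak form of nondegeneracy: points of \<open>N\<close> may leave \<open>N\<close>
  during the homotopy, only its end has to send them to \<open>x\<close>.\<close>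

definition well_pointed :: "'a topology \<Rightarrow> 'a \<Rightarrow> bool" where
  "well_pointed X x \<longleftrightarrow>
     (\<exists>h N. continuous_map (prod_topology (top_of_set {0..1::real}) X) X h \<and>
        (\<forall>y\<in>topspace X. h (0, y) = y) \<and> (\<forall>t\<in>{0..1}. h (t, x) = x) \<and>
        openin X N \<and> x \<in> N \<and> (\<forall>y\<in>N. h (1, y) = x))"

text \<open>\<open>X\<close> is \<open>A\<close> with \<open>D\<close> attached. A homotopy of
  \<open>A\<close> and one of \<open>D\<close> that agree over \<open>A\<close> descend to
  \<open>X\<close>, because a continuous surjection from a compact space onto a Hausdorff space is a
  quotient map; the interval being compact, this applies directly to the product with it.\<close>

lemma attached_homotopy:
  fixes X :: "'a topology" and D :: "(nat \<Rightarrow> real) set" and Y :: "'b topology"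
  assumes X: "Hausdorff_space X" and A: "closedin X A" and D: "compact D"
    and \<Phi>: "continuous_map (top_of_set D) X \<Phi>" and cov: "topspace X = A \<union> \<Phi> ` D"
    and inj: "\<And>p q. p \<in> D \<Longrightarrow> q \<in> D \<Longrightarrow> \<Phi> p = \<Phi> q \<Longrightarrow> \<Phi> p \<notin> A \<Longrightarrow> p = q"
    and HA: "continuous_map (prod_topology (top_of_set {0..1::real}) (subtopology X A)) Y HA"
    and G: "continuous_map (prod_topology (top_of_set {0..1::real}) (top_of_set D)) Y G"
    and compat: "\<And>t p. t \<in> {0..1} \<Longrightarrow> p \<in> D \<Longrightarrow> \<Phi> p \<in> A \<Longrightarrow> G (t, p) = HA (t, \<Phi> p)"
  obtains h where "continuous_map (prod_topology (top_of_set {0..1::real}) X) Y h"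
    "\<And>t y. y \<in> A \<Longrightarrow> h (t, y) = HA (t, y)"
    "\<And>t p. t \<in> {0..1} \<Longrightarrow> p \<in> D \<Longrightarrow> h (t, \<Phi> p) = G (t, p)"
proof -
  let ?I = "top_of_set {0..1::real}"
  \<comment> \<open>Off \<open>A\<close> the preimage under \<open>\<Phi>\<close> is unique by
    \<open>inj\<close>, so \<open>inv_into\<close> makes no real choice; over \<open>A\<close> it is
    not consulted.\<close>
  define h where "h = (\<lambda>(t, y). if y \<in> A then HA (t, y) else G (t, inv_into D \<Phi> y))"
  have hA: "h (t, y) = HA (t, y)" if "y \<in> A" for t y
    using that by (simp add: h_def)
  have hG: "h (t, \<Phi> p) = G (t, p)" if "t \<in> {0..1}" "p \<in> D" for t p
  proof (cases "\<Phi> p \<in> A")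
    case False
    then have "inv_into D \<Phi> (\<Phi> p) = p"
      using inj[of "inv_into D \<Phi> (\<Phi> p)" p] that(2)
      by (metis f_inv_into_f image_eqI inv_into_into)
    with False show ?thesis
      by (simp add: h_def)
  qed (use compat that in \<open>simp add: h_def\<close>)
  let ?C = "\<Phi> ` D"
  have cD: "compactin X ?C"
    using D \<Phi> by (intro image_compactin[of "top_of_set D"]) (simp_all add: compactin_subtopology)
  then have clC: "closedin X ?C"
    using X compactin_imp_closedin by blast
  have "continuous_map (prod_topology ?I (subtopology X ?C)) Y h"
  proof (rule continuous_compose_quotient_map)
    let ?f = "\<lambda>(t, p). (t, \<Phi> p)"
    show "quotient_map (prod_topology ?I (top_of_set D)) (prod_topology ?I (subtopology X ?C)) ?f"
    proof (rule continuous_imp_quotient_map)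
      have "continuous_map (top_of_set D) (subtopology X ?C) \<Phi>"
        using \<Phi> by (simp add: continuous_map_in_subtopology)
      then show "continuous_map (prod_topology ?I (top_of_set D)) (prod_topology ?I (subtopology X ?C)) ?f"
        unfolding continuous_map_prod_top by simp
      show "compact_space (prod_topology ?I (top_of_set D))"
        using D by (simp add: compact_space_subtopology compact_Times)
      show "Hausdorff_space (prod_topology ?I (subtopology X ?C))"
        using X by (simp add: Hausdorff_space_prod_topology Hausdorff_space_subtopology)
      show "?f ` topspace (prod_topology ?I (top_of_set D)) = topspace (prod_topology ?I (subtopology X ?C))"
        using cov by force
    qed
    show "continuous_map (prod_topology ?I (top_of_set D)) Y (h \<circ> ?f)"
      using G by (rule continuous_map_eq) (auto simp: hG)
  qed
  moreover have "continuous_map (prod_topology ?I (subtopology X A)) Y h"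
    using HA by (rule continuous_map_eq) (use hA in \<open>auto simp del: continuous_map_prod_top\<close>)
  ultimately have B: "continuous_map (prod_topology ?I (subtopology X (if b then A else ?C))) Y h" for b
    by auto
  have "continuous_map (prod_topology ?I X) Y h"
  proof (rule pasting_lemma_closed[of "UNIV::bool set" _ "\<lambda>b. {0..1} \<times> (if b then A else ?C)" _ "\<lambda>_. h"])
    show "closedin (prod_topology ?I X) ({0..1} \<times> (if b then A else ?C))" for b
      using A clC closedin_topspace[of ?I] by (auto simp: closedin_prod_Times_iff)
    show "continuous_map (subtopology (prod_topology ?I X) ({0..1} \<times> (if b then A else ?C))) Y h" for b
      using B[of b] by (simp add: subtopology_Times subtopology_subtopology)
    show "\<exists>j. j \<in> UNIV \<and> x \<in> {0..1} \<times> (if j then A else ?C) \<and> h x = h x"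
      if "x \<in> topspace (prod_topology ?I X)" for x
      using that cov by (cases "snd x \<in> A") (auto intro: exI[of _ True] exI[of _ False])
  qed auto
  then show ?thesis
    using that hA hG by blast
qed


lemma continuous_map_top_of_set_comp:
  assumes "continuous_map (top_of_set D) X \<Phi>" "continuous_on S m" "\<And>z. z \<in> S \<Longrightarrow> m z \<in> D"
  shows "continuous_map (top_of_set S) X (\<lambda>z. \<Phi> (m z))"
  using continuous_map_compose[of "top_of_set S" "top_of_set D" m X \<Phi>] assms
  by (auto simp: o_def continuous_map_in_subtopology)

text \<open>Stretch the disc radially by \<open>1 + t\<close>; the excess of the radius over 1 becomes time in the
  homotopy of \<open>A\<close>, run at double speed so that it is complete near the boundary of the disc.\<close>

lemma well_pointed_attach:
  fixes X :: "'a topology" and d :: nat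
  defines "S \<equiv> {p \<in> disc d. L2_set p {..<d} = 1}" and "B \<equiv> {p \<in> disc d. L2_set p {..<d} < 1}"
  assumes X: "Hausdorff_space X" and A: "closedin X A"
    and \<Phi>: "continuous_map (top_of_set (disc d)) X \<Phi>" and cov: "topspace X = A \<union> \<Phi> ` B"
    and S: "\<Phi> ` S \<subseteq> A" and B: "\<Phi> ` B \<inter> A = {}" and inj: "inj_on \<Phi> B"
    and wp: "well_pointed (subtopology X A) x"
  shows "well_pointed X x"
proof -
  let ?I = "top_of_set {0..1::real}" and ?r = "\<lambda>p. L2_set p {..<d}"
  have disc: "disc d = S \<union> B"
    by (auto simp: S_def B_def disc_def)
  obtain h0 N0 where h0: "continuous_map (prod_topology ?I (subtopology X A)) (subtopology X A) h0"
    "\<And>y. y \<in> A \<Longrightarrow> h0 (0, y) = y" "\<And>t. t \<in> {0..1} \<Longrightarrow> h0 (t, x) = x"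
    and N0: "openin (subtopology X A) N0" "x \<in> N0" "\<And>y. y \<in> N0 \<Longrightarrow> h0 (1, y) = x"
    using wp unfolding well_pointed_def topspace_subtopology_subset[OF closedin_subset[OF A]] by blast
  have xA: "x \<in> A" "x \<in> topspace X" "N0 \<subseteq> A"
    using N0(2) openin_subset[OF N0(1)] by auto
  define HA where "HA = (\<lambda>(t, y). h0 (min 1 (2 * t), y))"
  define G where "G = (\<lambda>(t, p). if (1 + t) * ?r p \<le> 1 then \<Phi> (\<lambda>i. (1 + t) * p i)
       else h0 (min 1 (2 * ((1 + t) * ?r p - 1)), \<Phi> (\<lambda>i. p i / ?r p)))"
  have h0X: "continuous_map (prod_topology ?I (subtopology X A)) X h0"
    using h0(1) continuous_map_into_fulltopology by blast
  have HA: "continuous_map (prod_topology ?I (subtopology X A)) X HA"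
  proof -
    have "continuous_map (prod_topology ?I (subtopology X A)) (prod_topology ?I (subtopology X A))
        (\<lambda>(t, y). (min 1 (2 * t), y))"
      unfolding continuous_map_prod_top
      by (auto simp: continuous_map_in_subtopology intro!: continuous_intros)
    from continuous_map_compose[OF this h0X] show ?thesis
      by (simp add: HA_def o_def case_prod_unfold)
  qed
  have normalize: "(\<lambda>i. p i / ?r p) \<in> S" if "p \<in> disc d" "?r p > 0" for p
    using that L2_set_scale[of "1 / ?r p" p "{..<d}"] by (simp add: S_def disc_def)
  have G: "continuous_map (prod_topology ?I (top_of_set (disc d))) X G"
    unfolding G_def case_prod_unfold prod_topology_subtopology_eu
  proof (rule continuous_map_cases_le)
    let ?T = "{0..1} \<times> disc d"
    let ?L = "\<lambda>z. (1 + fst z) * ?r (snd z)"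
    show "continuous_map (top_of_set ?T) euclideanreal ?L"
      by (auto intro!: continuous_intros)
    show "continuous_map (top_of_set ?T) euclideanreal (\<lambda>z. 1)"
      by simp
    let ?T1 = "?T \<inter> {z. ?L z \<le> 1}" and ?T2 = "?T \<inter> {z. 1 \<le> ?L z}"
    have "continuous_map (top_of_set ?T1) X (\<lambda>z. \<Phi> (\<lambda>i. (1 + fst z) * snd z i))"
    proof (rule continuous_map_top_of_set_comp[OF \<Phi>])
      show "continuous_on ?T1 (\<lambda>z i. (1 + fst z) * snd z i)"
        by (intro continuous_on_coordinatewise_then_product continuous_intros)
      show "(\<lambda>i. (1 + fst z) * snd z i) \<in> disc d" if "z \<in> ?T1" for z
        using that by (auto simp: disc_def L2_set_scale)
    qed
    then show "continuous_map (subtopology (top_of_set ?T) {z \<in> topspace (top_of_set ?T). ?L z \<le> 1}) X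
        (\<lambda>z. \<Phi> (\<lambda>i. (1 + fst z) * snd z i))"
      by (simp add: subtopology_subtopology Int_def)
    have pos: "?r (snd z) > 0" if "z \<in> ?T2" for z
    proof (rule ccontr)
      assume "\<not> ?r (snd z) > 0"
      then have "?r (snd z) = 0"
        using L2_set_nonneg[of "snd z" "{..<d}"] by linarith
      then show False
        using that by auto
    qed
    have "continuous_map (top_of_set ?T2) X (\<lambda>z. \<Phi> (\<lambda>i. snd z i / ?r (snd z)))"
    proof (rule continuous_map_top_of_set_comp[OF \<Phi>])
      show "continuous_on ?T2 (\<lambda>z i. snd z i / ?r (snd z))"
        using pos by (intro continuous_on_coordinatewise_then_product continuous_intros) fastforce
      show "(\<lambda>i. snd z i / ?r (snd z)) \<in> disc d" if "z \<in> ?T2" for z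
        using normalize[of "snd z"] pos[OF that] that by (auto simp: S_def)
    qed
    then have 1: "continuous_map (top_of_set ?T2) (subtopology X A) (\<lambda>z. \<Phi> (\<lambda>i. snd z i / ?r (snd z)))"
      using normalize pos S by (fastforce simp: continuous_map_in_subtopology)
    have 2: "continuous_map (top_of_set ?T2) ?I (\<lambda>z. min 1 (2 * (?L z - 1)))"
      by (auto simp: continuous_map_in_subtopology intro!: continuous_intros)
    from continuous_map_compose[OF continuous_map_pairedI[OF 2 1] h0X]
    show "continuous_map (subtopology (top_of_set ?T) {z \<in> topspace (top_of_set ?T). 1 \<le> ?L z}) X
        (\<lambda>z. h0 (min 1 (2 * (?L z - 1)), \<Phi> (\<lambda>i. snd z i / ?r (snd z))))"
      by (simp add: subtopology_subtopology Int_def o_def)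
    show "\<Phi> (\<lambda>i. (1 + fst z) * snd z i) = h0 (min 1 (2 * (?L z - 1)), \<Phi> (\<lambda>i. snd z i / ?r (snd z)))"
      if "z \<in> topspace (top_of_set ?T)" "?L z = 1" for z
    proof -
      have p: "?r (snd z) > 0"
        using that by (intro pos) auto
      have "\<Phi> (\<lambda>i. snd z i / ?r (snd z)) \<in> A"
        using normalize[of "snd z"] p S that by auto
      moreover have "1 + fst z = 1 / ?r (snd z)"
        using that(2) p by (simp add: field_simps)
      ultimately show ?thesis
        using that(2) h0(2) by simp
    qed
  qed
  have inA: "\<Phi> p \<in> A \<longleftrightarrow> p \<in> S" if "p \<in> disc d" for p
    using that S B disc by blast
  obtain h where h: "continuous_map (prod_topology ?I X) X h"
    "\<And>t y. y \<in> A \<Longrightarrow> h (t, y) = HA (t, y)"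
    "\<And>t p. t \<in> {0..1} \<Longrightarrow> p \<in> disc d \<Longrightarrow> h (t, \<Phi> p) = G (t, p)"
  proof (rule attached_homotopy[OF X A compact_disc \<Phi> _ _ HA G])
    show "topspace X = A \<union> \<Phi> ` disc d"
      using cov S disc by auto
    show "p = q" if "p \<in> disc d" "q \<in> disc d" "\<Phi> p = \<Phi> q" "\<Phi> p \<notin> A" for p q
      using that inA inj disc by (metis UnE inj_onD)
    show "G (t, p) = HA (t, \<Phi> p)" if t: "t \<in> {0..1}" "p \<in> disc d" "\<Phi> p \<in> A" for t p
    proof -
      have "?r p = 1"
        using that inA S_def by auto
      then show ?thesis
        using t h0(2) by (auto simp: G_def HA_def)
    qed
  qed (rule that)
  \<comment> \<open>The part of the disc to be kept out of the new neighbourhood. At time 1 a point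
    of radius \<open>r\<close> has run the homotopy of \<open>A\<close> up to time
    \<open>2 * (2 * r - 1)\<close>, which is at least 1 from radius 3/4 on; beyond that radius, the
    radial projection to the sphere decides.\<close>
  define D' where "D' = {p \<in> disc d. ?r p \<le> 3/4} \<union> {p \<in> disc d. 3/4 \<le> ?r p \<and> \<Phi> (\<lambda>i. p i / ?r p) \<in> A - N0}"
  define N where "N = topspace X - ((A - N0) \<union> \<Phi> ` D')"
  have clA: "closedin X (A - N0)"
  proof -
    have "closedin (subtopology X A) (A - N0)"
      using closedin_diff[OF closedin_topspace N0(1)] topspace_subtopology_subset[OF closedin_subset[OF A]] by simp
    then show ?thesis
      using A closedin_trans_full by blast
  qed
  have "compact D'"
  proof -
    have cd: "closed (disc d)"
      using compact_disc compact_imp_closed by blast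
    let ?E = "{p \<in> disc d. 3/4 \<le> ?r p}"
    have cE: "closed ?E"
      unfolding Collect_conj_eq Collect_mem_eq using cd by (intro closed_Int closed_Collect_le continuous_intros)
    have "continuous_map (top_of_set ?E) X (\<lambda>p. \<Phi> (\<lambda>i. p i / ?r p))"
    proof (rule continuous_map_top_of_set_comp[OF \<Phi>])
      show "continuous_on ?E (\<lambda>p i. p i / ?r p)"
        by (intro continuous_on_coordinatewise_then_product continuous_intros) auto
      show "(\<lambda>i. p i / ?r p) \<in> disc d" if "p \<in> ?E" for p
        using normalize[of p] that by (auto simp: S_def)
    qed
    from closedin_continuous_map_preimage[OF this clA]
    have "closedin (top_of_set ?E) {p \<in> ?E. \<Phi> (\<lambda>i. p i / ?r p) \<in> A - N0}"
      by simp
    then have "closed {p \<in> ?E. \<Phi> (\<lambda>i. p i / ?r p) \<in> A - N0}"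
      using cE closedin_closed_trans by blast
    moreover have "closed {p \<in> disc d. ?r p \<le> 3/4}"
      unfolding Collect_conj_eq Collect_mem_eq using cd by (intro closed_Int closed_Collect_le continuous_intros)
    ultimately have "closed D'"
      unfolding D'_def by (simp add: closed_Un conj_assoc)
    moreover have "D' \<subseteq> disc d"
      by (auto simp: D'_def)
    ultimately show ?thesis
      using compact_disc by (metis compact_Int_closed inf.absorb2)
  qed
  then have "compactin (top_of_set (disc d)) D'"
    by (auto simp: compactin_subtopology D'_def)
  then have "closedin X (\<Phi> ` D')"
    using image_compactin[OF _ \<Phi>] X compactin_imp_closedin by blast
  then have "openin X N"
    unfolding N_def using clA by (intro openin_diff openin_topspace closedin_Un)
  moreover have "x \<in> N"
  proof -
    have "x \<notin> \<Phi> ` D'"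
    proof
      assume "x \<in> \<Phi> ` D'"
      then obtain p where p: "p \<in> D'" "x = \<Phi> p"
        by auto
      then have "p \<in> S"
        using inA xA by (auto simp: D'_def)
      then show False
        using p N0(2) by (auto simp: D'_def S_def)
    qed
    then show ?thesis
      using xA N0(2) by (auto simp: N_def)
  qed
  moreover have "h (1, y) = x" if y: "y \<in> N" for y
  proof (cases "y \<in> A")
    case True
    then show ?thesis
      using that h(2) N0(3) by (auto simp: N_def HA_def)
  next
    case False
    then obtain p where p: "y = \<Phi> p" "p \<in> B"
      using y cov by (auto simp: N_def)
    then have pd: "p \<in> disc d" "p \<notin> D'"
      using that disc by (auto simp: N_def)
    then have r: "?r p > 3/4"
      by (auto simp: D'_def)
    then have "\<Phi> (\<lambda>i. p i / ?r p) \<in> N0"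
      using pd S normalize[OF pd(1)] by (auto simp: D'_def)
    moreover have "\<not> 2 * ?r p \<le> 1" "min 1 (2 * (2 * ?r p - 1)) = 1"
      using r by auto
    ultimately have "G (1, p) = x"
      using N0(3) by (simp add: G_def)
    then show ?thesis
      using h(3)[of 1 p] pd p by simp
  qed
  moreover have "h (0, y) = y" if y: "y \<in> topspace X" for y
  proof (cases "y \<in> A")
    case True
    then show ?thesis
      using h(2) h0(2) by (simp add: HA_def)
  next
    case False
    then obtain p where "y = \<Phi> p" "p \<in> disc d" "?r p < 1"
      using y cov by (auto simp: B_def)
    then show ?thesis
      using h(3)[of 0 p] by (simp add: G_def)
  qed
  moreover have "h (t, x) = x" if "t \<in> {0..1}" for t
    using h(2) xA that h0(3) by (simp add: HA_def)
  ultimately show ?thesis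
    unfolding well_pointed_def using h(1) by blast
qed


text \<open>The base point lies in the open cell here, so a small ball around it can be contracted
  linearly, with a cutoff that vanishes on the boundary sphere. Hence \<open>A\<close> never
  moves.\<close>

lemma well_pointed_cell:
  fixes X :: "'a topology" and d :: nat
  defines "S \<equiv> {p \<in> disc d. L2_set p {..<d} = 1}" and "B \<equiv> {p \<in> disc d. L2_set p {..<d} < 1}"
  assumes X: "Hausdorff_space X" and A: "closedin X A"
    and \<Phi>: "continuous_map (top_of_set (disc d)) X \<Phi>" and cov: "topspace X = A \<union> \<Phi> ` B"
    and S: "\<Phi> ` S \<subseteq> A" and B: "\<Phi> ` B \<inter> A = {}" and inj: "inj_on \<Phi> B"
    and x: "x \<in> \<Phi> ` B"
  shows "well_pointed X x"
proof -
  let ?I = "top_of_set {0..1::real}" and ?r = "\<lambda>p. L2_set p {..<d}"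
  have disc: "disc d = S \<union> B"
    by (auto simp: S_def B_def disc_def)
  have inA: "\<Phi> p \<in> A \<longleftrightarrow> p \<in> S" if "p \<in> disc d" for p
    using that S B disc by blast
  obtain p0 where p0: "x = \<Phi> p0" "p0 \<in> disc d" "?r p0 < 1"
    using x by (auto simp: B_def)
  \<comment> \<open>By the triangle inequality the boundary sphere has distance at least
    \<open>\<epsilon>\<close> from \<open>p0\<close>, that is, \<open>u\<close> is at least 1
    there.\<close>
  define \<epsilon> where "\<epsilon> = 1 - ?r p0"
  have \<epsilon>: "\<epsilon> > 0"
    using p0 by (simp add: \<epsilon>_def)
  define u where "u p = L2_set (\<lambda>i. p i - p0 i) {..<d} / \<epsilon>" for p
  \<comment> \<open>1 where \<open>u\<close> is at most 1/2, and 0 where \<open>u\<close> is at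
    least 1.\<close>
  define cut where "cut p = max 0 (min 1 (2 - 2 * u p))" for p
  define m where "m = (\<lambda>(t, p) i. (1 - t * cut p) * p i + t * cut p * p0 i)"
  have cut: "0 \<le> cut p" "cut p \<le> 1" for p
    by (auto simp: cut_def)
  have c: "0 \<le> t * cut p" "t * cut p \<le> 1" if "t \<in> {0..1}" for t p
    using cut[of p] that by (auto simp: mult_le_one)
  have m: "m (t, p) \<in> disc d" if "t \<in> {0..1}" "p \<in> disc d" for t p
  proof -
    have "?r (m (t, p)) \<le> ?r (\<lambda>i. (1 - t * cut p) * p i) + ?r (\<lambda>i. t * cut p * p0 i)"
      unfolding m_def case_prod_conv by (rule L2_set_triangle_ineq)
    also have "\<dots> = (1 - t * cut p) * ?r p + t * cut p * ?r p0"
      using c[OF that(1), of p] by (simp add: L2_set_scale)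
    also have "\<dots> \<le> (1 - t * cut p) * 1 + t * cut p * 1"
      using c[OF that(1), of p] p0 that by (intro add_mono mult_left_mono) (auto simp: disc_def)
    finally show ?thesis
      using that p0 by (auto simp: disc_def m_def)
  qed
  have u1: "u p \<ge> 1" if "p \<in> S" for p
  proof -
    have "?r p \<le> ?r (\<lambda>i. p i - p0 i) + ?r p0"
      using L2_set_triangle_ineq[of "\<lambda>i. p i - p0 i" p0 "{..<d}"] by simp
    then show ?thesis
      using that \<epsilon> by (simp add: u_def S_def \<epsilon>_def)
  qed
  have cu: "continuous_on T u" for T
    unfolding u_def using \<epsilon> by (intro continuous_intros) auto
  have cont_cut: "continuous_on T (\<lambda>z. cut (snd z))" for T :: "(real \<times> (nat \<Rightarrow> real)) set"
    unfolding cut_def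
    by (intro continuous_intros continuous_on_compose2[OF cu[of UNIV] continuous_on_snd[OF continuous_on_id]]) auto
  define HA :: "real \<times> 'a \<Rightarrow> 'a" where "HA = snd"
  define G where "G = (\<lambda>z. \<Phi> (m z))"
  have HA: "continuous_map (prod_topology ?I (subtopology X A)) X HA"
    using continuous_map_into_fulltopology[OF continuous_map_snd[of ?I "subtopology X A"]]
    by (simp add: HA_def)
  have G: "continuous_map (prod_topology ?I (top_of_set (disc d))) X G"
    unfolding G_def prod_topology_subtopology_eu
  proof (rule continuous_map_top_of_set_comp[OF \<Phi>])
    show "continuous_on ({0..1} \<times> disc d) m"
      unfolding m_def case_prod_unfold
      by (intro continuous_on_coordinatewise_then_product continuous_intros cont_cut)
  qed (use m in auto)
  obtain h where h: "continuous_map (prod_topology ?I X) X h"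
    "\<And>t y. y \<in> A \<Longrightarrow> h (t, y) = HA (t, y)"
    "\<And>t p. t \<in> {0..1} \<Longrightarrow> p \<in> disc d \<Longrightarrow> h (t, \<Phi> p) = G (t, p)"
  proof (rule attached_homotopy[OF X A compact_disc \<Phi> _ _ HA G])
    show "topspace X = A \<union> \<Phi> ` disc d"
      using cov S disc by auto
    show "p = q" if "p \<in> disc d" "q \<in> disc d" "\<Phi> p = \<Phi> q" "\<Phi> p \<notin> A" for p q
      using that inA inj disc by (metis UnE inj_onD)
    show "G (t, p) = HA (t, \<Phi> p)" if t: "t \<in> {0..1}" "p \<in> disc d" "\<Phi> p \<in> A" for t p
    proof -
      have "cut p = 0"
        using u1[of p] inA t by (simp add: cut_def)
      then show ?thesis
        by (simp add: G_def HA_def m_def)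
    qed
  qed (rule that)
  define D' where "D' = {p \<in> disc d. 1/2 \<le> u p}"
  define N where "N = topspace X - (A \<union> \<Phi> ` D')"
  have "closed {p. 1/2 \<le> u p}"
    by (intro closed_Collect_le continuous_intros cu)
  then have "compact D'"
    unfolding D'_def Collect_conj_eq Collect_mem_eq using compact_disc by (intro compact_Int_closed)
  then have "compactin (top_of_set (disc d)) D'"
    by (auto simp: compactin_subtopology D'_def)
  then have "closedin X (\<Phi> ` D')"
    using image_compactin[OF _ \<Phi>] X compactin_imp_closedin by blast
  then have "openin X N"
    unfolding N_def using A by (intro openin_diff openin_topspace closedin_Un)
  moreover have "x \<in> N"
  proof -
    have "u p0 = 0"
      by (simp add: u_def L2_set_def)
    moreover have "p0 = p" if "p \<in> disc d" "\<Phi> p = x" for p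
    proof -
      have "p \<in> B"
        using that inA[OF that(1)] B x disc by auto
      moreover have "p0 \<in> B"
        using p0 by (simp add: B_def)
      ultimately show ?thesis
        using inj that p0(1) by (auto dest: inj_onD)
    qed
    ultimately have "x \<notin> \<Phi> ` D'"
      by (auto simp: D'_def)
    then show ?thesis
      using x B cov by (auto simp: N_def)
  qed
  moreover have "h (1, y) = x" if y: "y \<in> N" for y
  proof -
    obtain p where p: "y = \<Phi> p" "p \<in> B"
      using y cov by (auto simp: N_def)
    then have "p \<in> disc d" "u p < 1/2"
      using that disc by (auto simp: N_def D'_def)
    then have "h (1, \<Phi> p) = G (1, p)" "cut p = 1"
      using h(3)[of 1 p] by (auto simp: cut_def)
    then show ?thesis
      using p p0 by (simp add: G_def m_def)
  qed
  moreover have "h (0, y) = y" if y: "y \<in> topspace X" for y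
  proof (cases "y \<in> A")
    case False
    then obtain p where "y = \<Phi> p" "p \<in> disc d"
      using y cov by (auto simp: B_def)
    then show ?thesis
      using h(3)[of 0 p] by (simp add: G_def m_def)
  qed (simp add: h(2) HA_def)
  moreover have "h (t, x) = x" if "t \<in> {0..1}" for t
  proof -
    have "m (t, p0) = p0"
      by (auto simp: m_def algebra_simps)
    then show ?thesis
      using h(3)[of t p0] that p0 by (simp add: G_def)
  qed
  ultimately show ?thesis
    unfolding well_pointed_def using h(1) by blast
qed

text \<open>\<open>K\<close> is compact Hausdorff, hence completely regular: a function that is 0 at
  \<open>x\<close> and 1 on \<open>K - U\<close> damps the homotopy of \<open>K\<close> so that
  points of \<open>K - U\<close> rest. It then extends to \<open>X\<close> by the identity.\<close>

lemma well_pointed_local: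
  assumes X: "Hausdorff_space X" and K: "compactin X K" and U: "openin X U" "x \<in> U" "U \<subseteq> K"
    and wp: "well_pointed (subtopology X K) x"
  shows "well_pointed X x"
proof -
  let ?I = "top_of_set {0..1::real}" and ?K = "subtopology X K"
  have clK: "closedin X K" and KX: "K \<subseteq> topspace X"
    using X K compactin_imp_closedin compactin_subset_topspace by blast+
  then have tK: "topspace ?K = K"
    using topspace_subtopology_subset by blast
  obtain h0 N0 where h0: "continuous_map (prod_topology ?I ?K) ?K h0"
    "\<And>y. y \<in> K \<Longrightarrow> h0 (0, y) = y" "\<And>t. t \<in> {0..1} \<Longrightarrow> h0 (t, x) = x"
    and N0: "openin ?K N0" "x \<in> N0" "\<And>y. y \<in> N0 \<Longrightarrow> h0 (1, y) = x"
    using wp unfolding well_pointed_def tK by blast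
  have "completely_regular_space ?K"
    using X K by (intro normal_imp_completely_regular_space compact_Hausdorff_or_regular_imp_normal_space)
       (simp_all add: compact_space_subtopology Hausdorff_space_subtopology)
  moreover have "closedin ?K (K - U)"
    unfolding closedin_subtopology using U KX by (intro exI[of _ "topspace X - U"]) auto
  moreover have "x \<in> topspace ?K - (K - U)"
    using U tK by auto
  ultimately obtain \<mu> where \<mu>: "continuous_map ?K ?I \<mu>" "\<mu> x = 0" "\<mu> ` (K - U) \<subseteq> {1}"
    unfolding completely_regular_space_def by (metis (no_types, lifting))
  have \<mu>01: "\<mu> y \<in> {0..1}" if "y \<in> K" for y
    using \<mu>(1) that tK by (auto simp: continuous_map_def Pi_iff)
  define cut where "cut y = min 1 (2 - 2 * \<mu> y)" for y
  define f where "f = (\<lambda>(t, y). h0 (t * cut y, y))"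
  define h where "h = (\<lambda>z. if snd z \<in> K then f z else snd z)"
  have \<mu>': "continuous_map ?K euclideanreal \<mu>"
    using \<mu>(1) continuous_map_in_subtopology by blast
  have cut: "continuous_map (prod_topology ?I ?K) euclideanreal (\<lambda>z. cut (snd z))"
    unfolding cut_def
    by (intro continuous_intros continuous_map_compose[OF continuous_map_snd \<mu>', unfolded o_def])
  have cut01: "cut y \<in> {0..1}" if "y \<in> K" for y
    using \<mu>01[OF that] by (auto simp: cut_def)
  have "continuous_map (prod_topology ?I ?K) (prod_topology ?I ?K) (\<lambda>z. (fst z * cut (snd z), snd z))"
  proof (intro continuous_map_pairedI continuous_map_snd)
    have "continuous_map (prod_topology ?I ?K) euclideanreal fst"
      using continuous_map_into_fulltopology[OF continuous_map_fst[of ?I ?K]] by simp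
    then have "continuous_map (prod_topology ?I ?K) euclideanreal (\<lambda>z. fst z * cut (snd z))"
      using cut by (intro continuous_intros)
    then show "continuous_map (prod_topology ?I ?K) ?I (\<lambda>z. fst z * cut (snd z))"
      using cut01 by (auto simp: continuous_map_in_subtopology mult_le_one)
  qed
  from continuous_map_compose[OF this h0(1)] have f: "continuous_map (prod_topology ?I ?K) X f"
    using continuous_map_into_fulltopology by (fastforce simp: f_def o_def case_prod_unfold)
  have fU: "f (t, y) = y" if "y \<in> K" "y \<notin> U" for t y
  proof -
    have "\<mu> y = 1"
      using \<mu>(3) that by auto
    then show ?thesis
      using that h0(2) by (simp add: f_def cut_def)
  qed
  have "continuous_map (prod_topology ?I X) X h"
  \<comment> \<open>The two closed sets overlap in \<open>K - U\<close>, where the damped homotopy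
    is the identity.\<close>
  proof (rule pasting_lemma_closed[of "UNIV::bool set" _ "\<lambda>b. {0..1} \<times> (if b then K else topspace X - U)" _
        "\<lambda>b. if b then f else snd"])
    show "closedin (prod_topology ?I X) ({0..1} \<times> (if b then K else topspace X - U))" for b
      using clK U closedin_topspace[of ?I] by (auto simp: closedin_prod_Times_iff)
    show "continuous_map (subtopology (prod_topology ?I X) ({0..1} \<times> (if b then K else topspace X - U))) X
       (if b then f else snd)" for b
    proof -
      have "subtopology (prod_topology ?I X) ({0..1} \<times> K) = prod_topology ?I ?K"
        by (simp only: subtopology_Times subtopology_subtopology Int_absorb)
      then show ?thesis
        using f continuous_map_from_subtopology[OF continuous_map_snd] by (cases b) (simp_all only: if_True if_False)
    qed
    show "(if i then f else snd) z = (if j then f else snd) z"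
      if "z \<in> topspace (prod_topology ?I X) \<inter> {0..1} \<times> (if i then K else topspace X - U) \<inter>
         {0..1} \<times> (if j then K else topspace X - U)" for i j z
      using that fU by (cases i; cases j) auto
    show "\<exists>j. j \<in> UNIV \<and> z \<in> {0..1} \<times> (if j then K else topspace X - U) \<and> h z = (if j then f else snd) z"
      if "z \<in> topspace (prod_topology ?I X)" for z
    proof (cases "snd z \<in> K")
      case True
      then show ?thesis
        using that by (intro exI[of _ True]) (auto simp: h_def)
    next
      case False
      then show ?thesis
        using that U by (intro exI[of _ False]) (auto simp: h_def)
    qed
  qed auto
  moreover have "h (0, y) = y" for y
    by (simp add: h_def f_def h0(2))
  moreover have "h (t, x) = x" if "t \<in> {0..1}" for t
    using that U \<mu>(2) h0(3) by (auto simp: h_def f_def cut_def)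
  \<comment> \<open>\<open>\<mu> y < 1/2\<close> makes \<open>cut y = 1\<close>, so the homotopy
    runs to its end here. The set is open in \<open>K\<close> and contained in the open set
    \<open>U\<close>, hence open in \<open>X\<close>.\<close>
  moreover define N where "N = N0 \<inter> U \<inter> {y \<in> topspace ?K. \<mu> y < 1/2}"
  have "openin ?K {y \<in> topspace ?K. \<mu> y \<in> {..<1/2}}"
    using \<mu>' by (rule openin_continuous_map_preimage) simp
  then have "openin ?K (N0 \<inter> {y \<in> topspace ?K. \<mu> y < 1/2})"
    using N0(1) by auto
  then obtain V where V: "openin X V" "N0 \<inter> {y \<in> topspace ?K. \<mu> y < 1/2} = V \<inter> K"
    by (auto simp: openin_subtopology)
  then have "N = V \<inter> U"
    using U by (auto simp: N_def)
  then have "openin X N"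
    using V U by auto
  moreover have "x \<in> N"
    using N0 U \<mu>(2) tK by (auto simp: N_def)
  moreover have "h (1, y) = x" if "y \<in> N" for y
    using that N0(3) tK by (auto simp: N_def h_def f_def cut_def)
  ultimately show ?thesis
    unfolding well_pointed_def by blast
qed


section \<open>Finite subcomplexes\<close>

context
  fixes X :: "'a topology" and E :: "'a set set" and d :: "'a set \<Rightarrow> nat"
    and \<Phi> :: "'a set \<Rightarrow> (nat \<Rightarrow> real) \<Rightarrow> 'a"
  assumes CW: "CW_structure X E d \<Phi>"
begin

text \<open>The boundary of a cell has to be covered by cells of \<open>F\<close> of smaller
  dimension, so that removing a cell of maximal dimension leaves a subcomplex.\<close>

definition finite_subcomplex :: "'a set set \<Rightarrow> bool" where
  "finite_subcomplex F \<longleftrightarrow> finite F \<and> F \<subseteq> E \<and>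
     (\<forall>e\<in>F. \<Phi> e ` {p \<in> disc (d e). L2_set p {..<d e} = 1} \<subseteq> \<Union>{c \<in> F. d c < d e})"

lemma finite_subcomplexD:
  assumes "finite_subcomplex F"
  shows "finite F" "F \<subseteq> E"
    and "e \<in> F \<Longrightarrow> \<Phi> e ` {p \<in> disc (d e). L2_set p {..<d e} = 1} \<subseteq> \<Union>{c \<in> F. d c < d e}"
  using assms by (simp_all only: finite_subcomplex_def)

lemma finite_subcomplexI:
  assumes "finite F" "F \<subseteq> E"
    and "\<And>e. e \<in> F \<Longrightarrow> \<Phi> e ` {p \<in> disc (d e). L2_set p {..<d e} = 1} \<subseteq> \<Union>{c \<in> F. d c < d e}"
  shows "finite_subcomplex F"
  using assms by (simp only: finite_subcomplex_def) blast

lemma CW_facts: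
  shows CW_Hausdorff: "Hausdorff_space X" and CW_cover: "\<Union>E = topspace X"
    and CW_disjoint: "c \<in> E \<Longrightarrow> e \<in> E \<Longrightarrow> c \<noteq> e \<Longrightarrow> c \<inter> e = {}"
  using CW unfolding CW_structure_def pairwise_def disjnt_def by auto

lemma CW_cell:
  assumes "e \<in> E"
  shows "continuous_map (top_of_set (disc (d e))) X (\<Phi> e)"
    and "\<Phi> e ` {p \<in> disc (d e). L2_set p {..<d e} < 1} = e"
    and "inj_on (\<Phi> e) {p \<in> disc (d e). L2_set p {..<d e} < 1}"
    and "\<exists>F\<subseteq>E. finite F \<and> (\<forall>c\<in>F. d c < d e) \<and> \<Phi> e ` {p \<in> disc (d e). L2_set p {..<d e} = 1} \<subseteq> \<Union>F"
proof -
  note cell = CW[unfolded CW_structure_def, THEN conjunct2, THEN conjunct2, THEN conjunct2, THEN conjunct1,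
      rule_format, OF assms]
  have 1: "subtopology (Euclidean_space (d e)) {x. (\<Sum>i<d e. (x i)\<^sup>2) \<le> 1} = top_of_set (disc (d e))"
    unfolding Euclidean_space_eq_top_of_set subtopology_subtopology
    by (intro arg_cong[of _ _ top_of_set]) (auto simp: disc_def L2_set_def)
  have 2: "{x. \<forall>i\<ge>d e. x i = 0} \<inter> {x. (\<Sum>i<d e. (x i)\<^sup>2) < 1} = {p \<in> disc (d e). L2_set p {..<d e} < 1}"
    by (auto simp: disc_def L2_set_def)
  have 3: "{x \<in> topspace (Euclidean_space (d e)). (\<Sum>i<d e. (x i)\<^sup>2) = 1} = {p \<in> disc (d e). L2_set p {..<d e} = 1}"
    by (auto simp: disc_def L2_set_def topspace_Euclidean_space)
  have e: "e \<subseteq> topspace X"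
    using assms CW_cover by auto
  show "continuous_map (top_of_set (disc (d e))) X (\<Phi> e)"
    and "\<exists>F\<subseteq>E. finite F \<and> (\<forall>c\<in>F. d c < d e) \<and> \<Phi> e ` {p \<in> disc (d e). L2_set p {..<d e} = 1} \<subseteq> \<Union>F"
    using cell unfolding 1 3 by simp_all
  have "homeomorphic_map (subtopology (Euclidean_space (d e)) {x. (\<Sum>i<d e. (x i)\<^sup>2) < 1})
                             (subtopology X e) (\<Phi> e)"
    using cell by simp
  then have "homeomorphic_map (top_of_set {p \<in> disc (d e). L2_set p {..<d e} < 1}) (subtopology X e) (\<Phi> e)"
    unfolding Euclidean_space_eq_top_of_set subtopology_subtopology 2 .
  then show "\<Phi> e ` {p \<in> disc (d e). L2_set p {..<d e} < 1} = e"
    and "inj_on (\<Phi> e) {p \<in> disc (d e). L2_set p {..<d e} < 1}"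
    using e by (auto simp: homeomorphic_eq_everything_map topspace_subtopology_subset)
qed

lemma disc_image_subset:
  assumes "finite_subcomplex F" "e \<in> F"
  shows "\<Phi> e ` disc (d e) \<subseteq> \<Union>F"
proof -
  have "disc (d e) = {p \<in> disc (d e). L2_set p {..<d e} = 1} \<union> {p \<in> disc (d e). L2_set p {..<d e} < 1}"
    by (auto simp: disc_def)
  moreover have "\<Phi> e ` {p \<in> disc (d e). L2_set p {..<d e} = 1} \<subseteq> \<Union>F"
    using finite_subcomplexD(3)[OF assms] by (rule order_trans) blast
  moreover have "\<Phi> e ` {p \<in> disc (d e). L2_set p {..<d e} < 1} \<subseteq> \<Union>F"
    using CW_cell(2)[of e] finite_subcomplexD(2)[OF assms(1)] assms(2) by blast
  ultimately show ?thesis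
    by (metis (lifting) Un_least image_Un)
qed

lemma compactin_finite_subcomplex:
  assumes "finite_subcomplex F"
  shows "compactin X (\<Union>F)"
proof -
  have F: "F \<subseteq> E" "finite F"
    using assms finite_subcomplexD by blast+
  have "\<Union>F = (\<Union>e\<in>F. \<Phi> e ` disc (d e))"
  proof
    show "\<Union>F \<subseteq> (\<Union>e\<in>F. \<Phi> e ` disc (d e))"
      using CW_cell(2) F(1) by fastforce
  qed (use disc_image_subset[OF assms] in blast)
  moreover have "compactin X (\<Phi> e ` disc (d e))" if "e \<in> F" for e
    using CW_cell(1) F that compact_disc
    by (intro image_compactin[of "top_of_set (disc (d e))"]) (auto simp: compactin_subtopology)
  ultimately show ?thesis
    using F(2) by (auto intro: compactin_Union)
qed

text \<open>Remove a cell of maximal dimension. If \<open>x\<close> lies in the rest, the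
  deformation given by induction extends over the cell; otherwise \<open>x\<close> lies in the open
  cell, where a local contraction is enough.\<close>

lemma well_pointed_finite_subcomplex:
  assumes "finite_subcomplex F" "x \<in> \<Union>F"
  shows "well_pointed (subtopology X (\<Union>F)) x"
  using assms
proof (induction "card F" arbitrary: F rule: less_induct)
  case less
  have F: "finite F" "F \<subseteq> E" "F \<noteq> {}"
    using less.prems finite_subcomplexD by blast+
  have "Max (d ` F) \<in> d ` F"
    using F by (intro Max_in) auto
  then obtain e where "e \<in> F" "d e = Max (d ` F)"
    by auto
  then have e: "e \<in> F" "\<And>c. c \<in> F \<Longrightarrow> d c \<le> d e"
    using F(1) by auto
  let ?A = "\<Union>(F - {e})" and ?X = "subtopology X (\<Union>F)"
  let ?S = "{p \<in> disc (d e). L2_set p {..<d e} = 1}" and ?B = "{p \<in> disc (d e). L2_set p {..<d e} < 1}"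
  have sub: "\<Phi> c ` {p \<in> disc (d c). L2_set p {..<d c} = 1} \<subseteq> \<Union>{b \<in> F - {e}. d b < d c}" if "c \<in> F" for c
  proof -
    have "\<Phi> c ` {p \<in> disc (d c). L2_set p {..<d c} = 1} \<subseteq> \<Union>{b \<in> F. d b < d c}"
      using finite_subcomplexD(3)[OF less.prems(1) that] .
    also have "{b \<in> F. d b < d c} = {b \<in> F - {e}. d b < d c}"
      using e(2)[OF that] by auto
    finally show ?thesis .
  qed
  have sc: "finite_subcomplex (F - {e})"
    by (rule finite_subcomplexI) (use F sub in blast)+
  have AF: "\<Union>F = ?A \<union> e"
    using e by auto
  have FX: "\<Union>F \<subseteq> topspace X"
    using F CW_cover by auto
  then have tX: "topspace ?X = \<Union>F"
    by (rule topspace_subtopology_subset)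
  have "closedin X ?A"
    using compactin_finite_subcomplex[OF sc] CW_Hausdorff compactin_imp_closedin by blast
  then have clA: "closedin ?X ?A"
    by (meson Diff_subset Union_mono closedin_subset_topspace)
  have H: "Hausdorff_space ?X"
    by (simp add: CW_Hausdorff Hausdorff_space_subtopology)
  have eE: "e \<in> E"
    using e F by auto
  have \<Phi>: "continuous_map (top_of_set (disc (d e))) ?X (\<Phi> e)"
    using CW_cell(1)[OF eE] disc_image_subset[OF less.prems(1) e(1)] by (auto simp: continuous_map_in_subtopology)
  have cov: "topspace ?X = ?A \<union> \<Phi> e ` ?B"
    unfolding tX CW_cell(2)[OF eE] using AF .
  have S: "\<Phi> e ` ?S \<subseteq> ?A"
    using sub[OF e(1)] by blast
  have B: "\<Phi> e ` ?B \<inter> ?A = {}"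
    unfolding CW_cell(2)[OF eE] using CW_disjoint eE F(2) by blast
  show ?case
  proof (cases "x \<in> ?A")
    case True
    then have "well_pointed (subtopology X ?A) x"
      using less.hyps[OF _ sc] e F by (metis card_Diff1_less)
    moreover have "subtopology ?X ?A = subtopology X ?A"
      unfolding subtopology_subtopology by (intro arg_cong[of _ _ "subtopology X"]) auto
    ultimately show ?thesis
      using well_pointed_attach[OF H clA \<Phi> cov S B CW_cell(3)[OF eE]] by simp
  next
    case False
    then have "x \<in> \<Phi> e ` ?B"
      using less.prems AF CW_cell(2)[OF eE] by auto
    then show ?thesis
      using well_pointed_cell[OF H clA \<Phi> cov S B CW_cell(3)[OF eE]] by simp
  qed
qed

lemma finite_subcomplex_Union:
  assumes "finite \<F>" "\<And>F. F \<in> \<F> \<Longrightarrow> finite_subcomplex F"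
  shows "finite_subcomplex (\<Union>\<F>)"
proof (rule finite_subcomplexI)
  show "finite (\<Union>\<F>)"
    using assms finite_subcomplexD(1) by blast
  show "\<Union>\<F> \<subseteq> E"
    using assms(2) finite_subcomplexD(2) by blast
  fix e assume "e \<in> \<Union>\<F>"
  then obtain F where F: "F \<in> \<F>" "e \<in> F"
    by blast
  have "\<Phi> e ` {p \<in> disc (d e). L2_set p {..<d e} = 1} \<subseteq> \<Union>{c \<in> F. d c < d e}"
    using finite_subcomplexD(3)[OF assms(2)[OF F(1)] F(2)] .
  also have "\<dots> \<subseteq> \<Union>{c \<in> \<Union>\<F>. d c < d e}"
    using F(1) by (intro Union_mono) blast
  finally show "\<Phi> e ` {p \<in> disc (d e). L2_set p {..<d e} = 1} \<subseteq> \<Union>{c \<in> \<Union>\<F>. d c < d e}" .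
qed

text \<open>Closure finiteness covers the boundary of \<open>e\<close> by finitely many cells of
  smaller dimension, and by induction on the dimension each of these has a finite
  subcomplex.\<close>

lemma cell_in_finite_subcomplex: "e \<in> E \<Longrightarrow> \<exists>F. finite_subcomplex F \<and> e \<in> F"
proof (induction "d e" arbitrary: e rule: less_induct)
  case less
  obtain B where B: "B \<subseteq> E" "finite B" "\<forall>c\<in>B. d c < d e"
    "\<Phi> e ` {p \<in> disc (d e). L2_set p {..<d e} = 1} \<subseteq> \<Union>B"
    using CW_cell(4)[OF less.prems] by blast
  then obtain f where f: "\<And>c. c \<in> B \<Longrightarrow> finite_subcomplex (f c) \<and> c \<in> f c"
    using less.hyps by (metis subsetD)
  have sc: "finite_subcomplex (\<Union>(f ` B))"
    using f B(2) by (intro finite_subcomplex_Union) auto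
  have "B \<subseteq> {c \<in> insert e (\<Union>(f ` B)). d c < d e}"
    using f B(3) by auto
  then have "\<Phi> e ` {p \<in> disc (d e). L2_set p {..<d e} = 1} \<subseteq> \<Union>{c \<in> insert e (\<Union>(f ` B)). d c < d e}"
    using B(4) by (meson Union_mono subset_trans)
  moreover have "\<Phi> c ` {p \<in> disc (d c). L2_set p {..<d c} = 1} \<subseteq> \<Union>{b \<in> insert e (\<Union>(f ` B)). d b < d c}"
    if "c \<in> \<Union>(f ` B)" for c
  proof -
    have "\<Phi> c ` {p \<in> disc (d c). L2_set p {..<d c} = 1} \<subseteq> \<Union>{b \<in> \<Union>(f ` B). d b < d c}"
      using finite_subcomplexD(3)[OF sc that] .
    then show ?thesis
      by (rule order_trans) auto
  qed
  ultimately have "finite_subcomplex (insert e (\<Union>(f ` B)))"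
    using finite_subcomplexD(1,2)[OF sc] less.prems by (intro finite_subcomplexI) blast+
  then show ?case
    by blast
qed

end

text \<open>This is where local finiteness enters: a neighbourhood of \<open>x\<close> that meets
  finitely many cells lies in a finite subcomplex, which is compact.\<close>

lemma locally_finite_CW_complex_well_pointed:
  assumes "locally_finite_CW_complex X" "x \<in> topspace X"
  shows "well_pointed X x"
proof -
  obtain E d \<Phi> U where CW: "CW_structure X E d \<Phi>" and U: "openin X U" "x \<in> U"
    and fin: "finite {e \<in> E. e \<inter> U \<noteq> {}}"
    using assms unfolding locally_finite_CW_complex_def by blast
  let ?C = "{e \<in> E. e \<inter> U \<noteq> {}}"
  obtain f where f: "\<And>e. e \<in> ?C \<Longrightarrow> finite_subcomplex E d \<Phi> (f e) \<and> e \<in> f e"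
    using cell_in_finite_subcomplex[OF CW] by (metis (no_types, lifting) mem_Collect_eq)
  let ?F = "\<Union>(f ` ?C)"
  have sc: "finite_subcomplex E d \<Phi> ?F"
    using f fin by (intro finite_subcomplex_Union[OF CW]) auto
  have "U \<subseteq> \<Union>?C"
    using openin_subset[OF U(1)] CW_cover[OF CW] by blast
  also have "\<dots> \<subseteq> \<Union>?F"
    using f by blast
  finally have "U \<subseteq> \<Union>?F" .
  then show ?thesis
    using well_pointed_local[OF CW_Hausdorff[OF CW] compactin_finite_subcomplex[OF CW sc] U]
      well_pointed_finite_subcomplex[OF CW sc] U(2) by blast
qed

section \<open>Cubical grids\<close>

text \<open>The side is \<open>N\<close> rather than 1 so that the grid is the integer one.\<close>

definition grid_box :: "nat \<Rightarrow> nat \<Rightarrow> (nat \<Rightarrow> real) set" where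
  "grid_box n N = {s. (\<forall>i<n. 0 \<le> s i \<and> s i \<le> real N) \<and> (\<forall>i\<ge>n. s i = 0)}"

definition grid_box_boundary :: "nat \<Rightarrow> nat \<Rightarrow> (nat \<Rightarrow> real) set" where
  "grid_box_boundary n N = {s \<in> grid_box n N. \<exists>i<n. s i = 0 \<or> s i = real N}"

lemma cube_eq_grid_box: "cube n = top_of_set (grid_box n 1)"
  unfolding cube_def Euclidean_space_eq_top_of_set subtopology_subtopology
  by (intro arg_cong[of _ _ top_of_set]) (auto simp: grid_box_def)

lemma cube_boundary_eq_grid_box: "cube_boundary n = grid_box_boundary n 1"
  by (simp add: cube_boundary_def grid_box_boundary_def cube_eq_grid_box)

lemma compact_grid_box: "compact (grid_box n N)"
proof -
  have "compact {s::nat\<Rightarrow>real. \<forall>i. s i \<in> (if i < n then {0..real N} else {0})}"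
    by (rule compact_PiE_UNIV) auto
  moreover have "{s::nat\<Rightarrow>real. \<forall>i. s i \<in> (if i < n then {0..real N} else {0})} = grid_box n N"
    unfolding grid_box_def by (intro Collect_cong) (metis atLeastAtMost_iff not_le singleton_iff)
  ultimately show ?thesis
    by simp
qed

text \<open>A face of the integer grid: \<open>S\<close> is the set of its free directions,
  \<open>a\<close> its lowest vertex, \<open>card S\<close> its dimension.\<close>

definition face :: "nat \<Rightarrow> nat \<Rightarrow> (nat \<Rightarrow> nat) \<Rightarrow> nat set \<Rightarrow> (nat \<Rightarrow> real) set" where
  "face n N a S = {s \<in> grid_box n N. \<forall>i<n. if i \<in> S then real (a i) \<le> s i \<and> s i \<le> real (a i) + 1 else s i = real (a i)}"

text \<open>The functions are extensional so that there are finitely many indices. A fixed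
  coordinate may equal \<open>N\<close>, whereas a free one needs room for a unit interval.\<close>

definition face_index :: "nat \<Rightarrow> nat \<Rightarrow> ((nat \<Rightarrow> nat) \<times> nat set) set" where
  "face_index n N = {(a, S). a \<in> {..<n} \<rightarrow>\<^sub>E {..N} \<and> S \<subseteq> {..<n} \<and> (\<forall>i\<in>S. a i < N)}"

text \<open>Homotopies that are constant on the trivial faces of both components of a map into a wedge
  stay in the wedge if on each cell one component is trivial.\<close>

definition trivial_faces :: "nat \<Rightarrow> nat \<Rightarrow> 'a \<Rightarrow> ((nat \<Rightarrow> real) \<Rightarrow> 'a) \<Rightarrow> (nat \<Rightarrow> real) set" where
  "trivial_faces n N y g = \<Union>{face n N a S |a S. (a, S) \<in> face_index n N \<and> g ` face n N a S \<subseteq> {y}}"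

lemma finite_face_index: "finite (face_index n N)"
proof -
  have "face_index n N \<subseteq> ({..<n} \<rightarrow>\<^sub>E {..N}) \<times> Pow {..<n}"
    by (auto simp: face_index_def)
  then show ?thesis
    by (rule finite_subset) (auto intro: finite_PiE)
qed

lemma trivial_faces_subset: "trivial_faces n N y g \<subseteq> grid_box n N"
  by (auto simp: trivial_faces_def face_def)

lemma trivial_faces_image: "g ` trivial_faces n N y g \<subseteq> {y}"
  by (auto simp: trivial_faces_def)

lemma trivial_facesI:
  "(a, S) \<in> face_index n N \<Longrightarrow> g ` face n N a S \<subseteq> {y} \<Longrightarrow> face n N a S \<subseteq> trivial_faces n N y g"
  by (auto simp: trivial_faces_def)

lemma trivial_faces_mono: "h ` trivial_faces n N y g \<subseteq> {y} \<Longrightarrow> trivial_faces n N y g \<subseteq> trivial_faces n N y h"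
  by (fastforce simp: trivial_faces_def)

text \<open>On each grid interval \<open>[j, j + 1]\<close> this is constant apart from the third that starts at \<open>j + b / 3\<close>,
  which it stretches to the whole interval (for \<open>0 \<le> b \<le> 2\<close>).\<close>

definition grid_stretch :: "nat \<Rightarrow> real \<Rightarrow> real \<Rightarrow> real" where
  "grid_stretch N b x = (\<Sum>j<N. max 0 (min 1 (3 * (x - real j) - b)))"

lemma continuous_on_grid_stretch: "continuous_on A (grid_stretch N b)"
  unfolding grid_stretch_def by (intro continuous_intros)

text \<open>Of the \<open>N\<close> summands, those of earlier intervals have reached 1 and those of
  later intervals are still 0.\<close>

lemma grid_stretch_cell:
  assumes b: "0 \<le> b" "b \<le> 2" and j: "j < N" and x: "real j \<le> x" "x \<le> real j + 1"
  shows "grid_stretch N b x = real j + max 0 (min 1 (3 * (x - real j) - b))"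
proof -
  let ?v = "max 0 (min 1 (3 * (x - real j) - b))"
  have "grid_stretch N b x = (\<Sum>i<N. (if i < j then 1 else 0) + (if i = j then ?v else 0))"
    unfolding grid_stretch_def
  proof (rule sum.cong)
    fix i
    consider "i + 1 \<le> j" | "i = j" | "j + 1 \<le> i"
      by linarith
    then show "max 0 (min 1 (3 * (x - real i) - b)) = (if i < j then 1 else 0) + (if i = j then ?v else 0)"
    proof cases
      case 1
      then have "real i + 1 \<le> real j"
        by linarith
      then have "x - real i \<ge> 1"
        using x by linarith
      then have "3 * (x - real i) - b \<ge> 1"
        using b by argo
      then show ?thesis
        using 1 by simp
    next
      case 3
      then have "real j + 1 \<le> real i"
        by linarith
      then have "x - real i \<le> 0"
        using x by linarith
      then have "3 * (x - real i) - b \<le> 0"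
        using b by argo
      then show ?thesis
        using 3 by simp
    qed simp
  qed simp
  also have "\<dots> = (\<Sum>i<N. if i < j then 1 else 0) + (\<Sum>i<N. if i = j then ?v else 0)"
    by (rule sum.distrib)
  also have "(\<Sum>i<N. if i < j then 1 else 0) = real (card ({..<N} \<inter> {i. i < j}))"
    by (simp add: sum.If_cases)
  also have "{..<N} \<inter> {i. i < j} = {..<j}"
    using j by auto
  also have "(\<Sum>i<N. if i = j then ?v else 0) = ?v"
    using j by (simp add: sum.delta)
  finally show ?thesis
    by simp
qed

lemma grid_cell_ex:
  assumes "0 \<le> x" "x \<le> real N" "N \<ge> 1"
  obtains j where "j < N" "real j \<le> x" "x \<le> real j + 1"
proof (cases "x = real N")
  case True
  then show ?thesis
    using assms by (intro that[of "N - 1"]) (auto simp: of_nat_diff)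
next
  case False
  then have "nat \<lfloor>x\<rfloor> < N"
    using assms by linarith
  then show ?thesis
    using assms by (intro that[of "nat \<lfloor>x\<rfloor>"]) linarith+
qed

lemma grid_stretch_nat:
  assumes "0 \<le> b" "b \<le> 2" "j \<le> N"
  shows "grid_stretch N b (real j) = real j"
proof (cases "j < N")
  case True
  then show ?thesis
    using grid_stretch_cell[OF assms(1,2) True, of "real j"] assms by simp
next
  case False
  then have j: "j = N"
    using assms by simp
  show ?thesis
  proof (cases N)
    \<comment> \<open>No interval starts at \<open>N\<close>, so the value is read off at the right
      end of the last one.\<close>
    case (Suc M)
    then show ?thesis
      using grid_stretch_cell[OF assms(1,2), of M N "real N"] assms j by simp
  qed (simp add: grid_stretch_def j)
qed

text \<open>With \<open>b = 1\<close> the outer thirds of the intervals meeting at a grid point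
  collapse to it. This collapses a neighbourhood of a face onto the face in
  \<open>trivialize_face\<close>.\<close>

lemma grid_stretch_middle:
  assumes "j \<le> N" "0 \<le> x" "x \<le> real N" "\<bar>x - real j\<bar> \<le> 1/3"
  shows "grid_stretch N 1 x = real j"
proof (cases "real j \<le> x \<and> j < N")
  case True
  then show ?thesis
    using grid_stretch_cell[of 1 j N x] assms by simp
next
  case False
  show ?thesis
  proof (cases "x = real j")
    case True
    then show ?thesis
      using grid_stretch_nat assms by simp
  next
    case False
    then have "x < real j"
      using \<open>\<not> (real j \<le> x \<and> j < N)\<close> assms by auto
    then obtain i where i: "j = Suc i"
      using assms by (cases j) auto
    then show ?thesis
      using grid_stretch_cell[of 1 i N x] assms \<open>x < real j\<close> by simp
  qed
qed

text \<open>For \<open>b = 0\<close> the stretch moves only in the first third of each interval, for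
  \<open>b = 2\<close> only in the last, so the two never move at the same place; the proof cuts
  halfway between. Applied to coordinate 1, this makes the supports disjoint.\<close>

lemma grid_stretch_0_or_2:
  assumes "0 \<le> x" "x \<le> real N" "N \<ge> 1"
  shows "\<exists>j\<le>N. grid_stretch N 0 x = real j \<or> grid_stretch N 2 x = real j"
proof -
  obtain j where j: "j < N" "real j \<le> x" "x \<le> real j + 1"
    using grid_cell_ex assms by blast
  show ?thesis
  proof (cases "x \<le> real j + 1/2")
    case True
    then have "grid_stretch N 2 x = real j"
      using grid_stretch_cell[of 2 j N x] j by simp
    then show ?thesis
      using j by (intro exI[of _ j]) auto
  next
    case False
    then have "grid_stretch N 0 x = real (Suc j)"
      using grid_stretch_cell[of 0 j N x] j by simp
    then show ?thesis
      using j by (intro exI[of _ "Suc j"]) auto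
  qed
qed

text \<open>The straight-line homotopy between two coordinatewise reparametrizations. Coordinates
  move independently, so whatever follows from a coordinate with equal \<open>\<alpha> i\<close> and
  \<open>\<beta> i\<close> holds throughout.\<close>

definition slide :: "nat \<Rightarrow> (nat \<Rightarrow> real \<Rightarrow> real) \<Rightarrow> (nat \<Rightarrow> real \<Rightarrow> real) \<Rightarrow> real \<times> (nat \<Rightarrow> real) \<Rightarrow> nat \<Rightarrow> real" where
  "slide n \<alpha> \<beta> z = (\<lambda>i. if i < n then (1 - fst z) * \<alpha> i (snd z i) + fst z * \<beta> i (snd z i) else 0)"

lemma convex_comb_bounds:
  fixes a b :: real
  assumes "t \<in> {0..1}" "l \<le> a" "a \<le> u" "l \<le> b" "b \<le> u"
  shows "l \<le> (1 - t) * a + t * b" "(1 - t) * a + t * b \<le> u"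
proof -
  have "(1 - t) *\<^sub>R a + t *\<^sub>R b \<in> {l..u}"
    by (rule convexD) (use assms in auto)
  then show "l \<le> (1 - t) * a + t * b" "(1 - t) * a + t * b \<le> u"
    by auto
qed

lemma slide_in_grid_box:
  assumes "t \<in> {0..1}" "s \<in> grid_box n N"
    and "\<And>i x. i < n \<Longrightarrow> x \<in> {0..real N} \<Longrightarrow> \<alpha> i x \<in> {0..real N} \<and> \<beta> i x \<in> {0..real N}"
  shows "slide n \<alpha> \<beta> (t, s) \<in> grid_box n N"
  using assms convex_comb_bounds[OF assms(1), of 0 _ "real N"] by (auto simp: grid_box_def slide_def)

lemma continuous_on_slide:
  assumes "\<And>i. i < n \<Longrightarrow> continuous_on {0..real N} (\<alpha> i) \<and> continuous_on {0..real N} (\<beta> i)"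
  shows "continuous_on ({0..1} \<times> grid_box n N) (slide n \<alpha> \<beta>)"
proof (rule continuous_on_coordinatewise_then_product)
  fix i
  show "continuous_on ({0..1} \<times> grid_box n N) (\<lambda>z. slide n \<alpha> \<beta> z i)"
  proof (cases "i < n")
    case True
    have *: "continuous_on ({0..1} \<times> grid_box n N) (\<lambda>z. \<gamma> (snd z i))" if "continuous_on {0..real N} \<gamma>" for \<gamma> :: "real \<Rightarrow> real"
      by (rule continuous_on_compose2[OF that]) (use True in \<open>auto simp: grid_box_def intro!: continuous_intros\<close>)
    have "continuous_on ({0..1} \<times> grid_box n N) (\<lambda>z. (1 - fst z) * \<alpha> i (snd z i) + fst z * \<beta> i (snd z i))"
      by (intro continuous_on_add continuous_on_mult continuous_on_diff continuous_on_const continuous_on_fst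
          continuous_on_id * conjunct1[OF assms[OF True]] conjunct2[OF assms[OF True]])
    then show ?thesis
      using True by (simp add: slide_def)
  qed (simp add: slide_def)
qed

lemma continuous_map_slide:
  assumes g: "continuous_map (top_of_set (grid_box n N)) Y g"
    and "\<And>i. i < n \<Longrightarrow> continuous_on {0..real N} (\<alpha> i) \<and> continuous_on {0..real N} (\<beta> i)"
    and "\<And>i x. i < n \<Longrightarrow> x \<in> {0..real N} \<Longrightarrow> \<alpha> i x \<in> {0..real N} \<and> \<beta> i x \<in> {0..real N}"
  shows "continuous_map (prod_topology (top_of_set {0..1}) (top_of_set (grid_box n N))) Y (\<lambda>z. g (slide n \<alpha> \<beta> z))"
  unfolding prod_topology_subtopology_eu
  using continuous_map_top_of_set_comp[OF g continuous_on_slide[OF assms(2)]] slide_in_grid_box[OF _ _ assms(3)] by auto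

text \<open>A stretch fixes the integers and maps each unit interval to itself, hence so does every
  stage of the straight-line homotopy from the identity to it. Composing with such a stage therefore
  keeps trivial faces trivial.\<close>

lemma slide_in_face:
  assumes b: "0 \<le> b" "b \<le> 2" and t: "t \<in> {0..1}" and s: "s \<in> face n N a S" and aS: "(a, S) \<in> face_index n N"
  shows "slide n (\<lambda>_ x. x) (\<lambda>_. grid_stretch N b) (t, s) \<in> face n N a S"
proof -
  have *: "if i \<in> S then real (a i) \<le> slide n (\<lambda>_ x. x) (\<lambda>_. grid_stretch N b) (t, s) i \<and>
         slide n (\<lambda>_ x. x) (\<lambda>_. grid_stretch N b) (t, s) i \<le> real (a i) + 1
       else slide n (\<lambda>_ x. x) (\<lambda>_. grid_stretch N b) (t, s) i = real (a i)" if i: "i < n" for i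
  proof (cases "i \<in> S")
    case True
    then have si: "real (a i) \<le> s i" "s i \<le> real (a i) + 1" and ai: "a i < N"
      using s i aS by (auto simp: face_def face_index_def split: if_splits)
    have "grid_stretch N b (s i) = real (a i) + max 0 (min 1 (3 * (s i - real (a i)) - b))"
      by (rule grid_stretch_cell[OF b ai si])
    then show ?thesis
      using True i convex_comb_bounds[OF t si, of "grid_stretch N b (s i)"] by (simp add: slide_def)
  next
    case False
    then have si: "s i = real (a i)" and ai: "a i \<le> N"
      using s i aS by (auto simp: face_def face_index_def split: if_splits)
    then show ?thesis
      using False i grid_stretch_nat[OF b ai] by (simp add: slide_def algebra_simps)
  qed
  have "slide n (\<lambda>_ x. x) (\<lambda>_. grid_stretch N b) (t, s) \<in> grid_box n N"
    unfolding grid_box_def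
  proof (intro CollectI conjI allI impI)
    fix i assume i: "i < n"
    have ai: "a i \<le> N" "i \<in> S \<Longrightarrow> a i + 1 \<le> N"
      using aS i by (auto simp: face_index_def)
    show "0 \<le> slide n (\<lambda>_ x. x) (\<lambda>_. grid_stretch N b) (t, s) i"
      using *[OF i] by (auto split: if_splits)
    show "slide n (\<lambda>_ x. x) (\<lambda>_. grid_stretch N b) (t, s) i \<le> real N"
      using *[OF i] ai by (auto split: if_splits)
  qed (simp add: slide_def)
  with * show ?thesis
    unfolding face_def by blast
qed

lemma grid_stretch_bounds:
  assumes b: "0 \<le> b" "b \<le> 2" and x: "x \<in> {0..real N}"
  shows "grid_stretch N b x \<in> {0..real N}"
proof (cases "N = 0")
  case False
  then obtain j where j: "j < N" "real j \<le> x" "x \<le> real j + 1"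
    using grid_cell_ex[of x N] x by auto
  then have "real j + 1 \<le> real N"
    by linarith
  then show ?thesis
    using grid_stretch_cell[OF b j] j by auto
qed (simp add: grid_stretch_def)

section \<open>Making maps trivial on the skeleton of the grid\<close>

lemma m_connected_at_null:
  assumes "m_connected_at m Y y" "1 \<le> j" "j \<le> m"
    and u: "continuous_map (cube j) Y u" "u ` cube_boundary j \<subseteq> {y}"
  shows "cube_homotopic j Y y u (\<lambda>_. y)"
proof -
  have "trivial_group (homotopy_group j Y y)"
    using assms(1-3) by (simp add: m_connected_at_def)
  then have "carrier (homotopy_group j Y y) = {one (homotopy_group j Y y)}"
    by (simp add: trivial_group_def)
  moreover have "Collect (cube_homotopic j Y y u) \<in> carrier (homotopy_group j Y y)"
    using u by (auto simp: homotopy_group_def)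
  ultimately have "Collect (cube_homotopic j Y y u) = Collect (cube_homotopic j Y y (\<lambda>_. y))"
    by (simp add: homotopy_group_def)
  moreover have "cube_homotopic j Y y u u"
    using u by (simp add: cube_homotopic_def)
  ultimately have "cube_homotopic j Y y (\<lambda>_. y) u"
    by blast
  then show ?thesis
    unfolding cube_homotopic_def by (rule homotopic_with_symD)
qed

definition face_boundary :: "nat \<Rightarrow> nat \<Rightarrow> (nat \<Rightarrow> nat) \<Rightarrow> nat set \<Rightarrow> (nat \<Rightarrow> real) set" where
  "face_boundary n N a S = {s \<in> face n N a S. \<exists>i\<in>S. s i = real (a i) \<or> s i = real (a i) + 1}"

lemma face_subset_grid_box: "face n N a S \<subseteq> grid_box n N"
  by (auto simp: face_def)

text \<open>The face is a copy of the cube of dimension \<open>card S\<close>, with its boundary, so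
  the vanishing of one homotopy group applies. \<open>emb\<close> and \<open>pr\<close> are the two
  directions of the identification.\<close>

lemma face_null:
  assumes conn: "m_connected_at m Y y" and S: "1 \<le> card S" "card S \<le> m" and aS: "(a, S) \<in> face_index n N"
    and g: "continuous_map (top_of_set (face n N a S)) Y g" "g ` face_boundary n N a S \<subseteq> {y}"
  shows "homotopic_with (\<lambda>h. h ` face_boundary n N a S \<subseteq> {y}) (top_of_set (face n N a S)) Y g (\<lambda>_. y)"
proof -
  have Sn: "S \<subseteq> {..<n}" and aN: "\<And>i. i \<in> S \<Longrightarrow> a i < N" "\<And>i. i < n \<Longrightarrow> a i \<le> N"
    using aS by (auto simp: face_index_def)
  have "finite S"
    using Sn finite_subset by blast
  \<comment> \<open>\<open>cube\<close> uses the first \<open>card S\<close> coordinates, so the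
    free directions have to be numbered.\<close>
  then obtain \<beta> where \<beta>: "bij_betw \<beta> {..<card S} S"
    using ex_bij_betw_nat_finite[of S] by (auto simp: atLeast0LessThan)
  define \<gamma> where "\<gamma> = inv_into {..<card S} \<beta>"
  have \<beta>S: "\<beta> j \<in> S" if "j < card S" for j
    using \<beta> that bij_betwE by blast
  have \<gamma>: "\<gamma> i < card S" "\<beta> (\<gamma> i) = i" if "i \<in> S" for i
    using \<beta> that bij_betw_inv_into_right[OF \<beta> that] bij_betwE[OF bij_betw_inv_into[OF \<beta>]] by (auto simp: \<gamma>_def)
  define emb where "emb u = (\<lambda>i. if i \<in> S then real (a i) + u (\<gamma> i) else if i < n then real (a i) else 0)" for u :: "nat \<Rightarrow> real"
  define pr where "pr s = (\<lambda>j. if j < card S then s (\<beta> j) - real (a (\<beta> j)) else 0)" for s :: "nat \<Rightarrow> real"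
  have emb: "emb u \<in> face n N a S" if "u \<in> grid_box (card S) 1" for u
  proof -
    have *: "0 \<le> u (\<gamma> i) \<and> u (\<gamma> i) \<le> 1" if "i \<in> S" for i
      using \<gamma>(1)[OF that] \<open>u \<in> grid_box (card S) 1\<close> by (simp add: grid_box_def)
    have "real (a i) + 1 \<le> real N" if "i \<in> S" for i
      using aN(1)[OF that] by linarith
    then have "emb u i \<le> real N" if "i < n" for i
      using * aN(2)[OF that] by (cases "i \<in> S") (force simp: emb_def that)+
    moreover have "0 \<le> emb u i" for i
      using * by (simp add: emb_def)
    moreover have "emb u i = 0" if "i \<ge> n" for i
      using that Sn by (auto simp: emb_def)
    ultimately have "emb u \<in> grid_box n N"
      by (simp add: grid_box_def)
    then show ?thesis
      using * by (simp add: face_def emb_def)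
  qed
  have emb_bd: "emb u \<in> face_boundary n N a S" if u: "u \<in> grid_box_boundary (card S) 1" for u
  proof -
    obtain j where "j < card S" "u j = 0 \<or> u j = 1" "u \<in> grid_box (card S) 1"
      using u by (auto simp: grid_box_boundary_def)
    moreover have "\<gamma> (\<beta> j) = j"
      using bij_betw_inv_into_left[OF \<beta>] \<open>j < card S\<close> by (simp add: \<gamma>_def)
    ultimately show ?thesis
      using \<beta>S[of j] emb[of u] by (auto simp: face_boundary_def emb_def intro!: bexI[of _ "\<beta> j"])
  qed
  have pr: "pr s \<in> grid_box (card S) 1" if "s \<in> face n N a S" for s
  proof -
    have "real (a (\<beta> j)) \<le> s (\<beta> j) \<and> s (\<beta> j) \<le> real (a (\<beta> j)) + 1" if "j < card S" for j
      using \<open>s \<in> face n N a S\<close> \<beta>S[OF that] Sn unfolding face_def by auto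
    then show ?thesis
      by (auto simp: grid_box_def pr_def diff_le_eq add.commute)
  qed
  have pr_bd: "pr s \<in> grid_box_boundary (card S) 1" if s: "s \<in> face_boundary n N a S" for s
  proof -
    obtain i where i: "i \<in> S" "s i = real (a i) \<or> s i = real (a i) + 1" "s \<in> face n N a S"
      using s by (auto simp: face_boundary_def)
    then have "pr s (\<gamma> i) = 0 \<or> pr s (\<gamma> i) = 1"
      using \<gamma>[of i] by (auto simp: pr_def)
    then show ?thesis
      using pr i \<gamma>(1) by (auto simp: grid_box_boundary_def)
  qed
  have emb_pr: "emb (pr s) = s" if s: "s \<in> face n N a S" for s
  proof
    fix i
    show "emb (pr s) i = s i"
      using s \<gamma>[of i] Sn by (cases "i < n") (auto simp: emb_def pr_def face_def grid_box_def)
  qed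
  have "continuous_on (grid_box (card S) 1) emb"
    unfolding emb_def
  proof (rule continuous_on_coordinatewise_then_product)
    show "continuous_on (grid_box (card S) 1) (\<lambda>u. if i \<in> S then real (a i) + u (\<gamma> i) else if i < n then real (a i) else 0)" for i
      by (cases "i \<in> S"; cases "i < n") (auto intro!: continuous_intros)
  qed
  then have "continuous_map (cube (card S)) Y (\<lambda>u. g (emb u))"
    unfolding cube_eq_grid_box using emb by (intro continuous_map_top_of_set_comp[OF g(1)])
  moreover have "(\<lambda>u. g (emb u)) ` cube_boundary (card S) \<subseteq> {y}"
    unfolding cube_boundary_eq_grid_box using g(2) emb_bd by blast
  ultimately have "cube_homotopic (card S) Y y (\<lambda>u. g (emb u)) (\<lambda>_. y)"
    using m_connected_at_null[OF conn S] by blast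
  then obtain H where H: "continuous_map (prod_topology (top_of_set {0..1::real}) (cube (card S))) Y H"
    "\<And>s. H (0, s) = g (emb s)" "\<And>s. H (1, s) = y" "\<And>t s. t \<in> {0..1} \<Longrightarrow> s \<in> cube_boundary (card S) \<Longrightarrow> H (t, s) = y"
    unfolding cube_homotopic_def by (rule homotopic_with_imageE) blast
  show ?thesis
  proof (rule homotopic_with_imageI)
    show "continuous_map (prod_topology (top_of_set {0..1::real}) (top_of_set (face n N a S))) Y (\<lambda>z. H (fst z, pr (snd z)))"
      unfolding prod_topology_subtopology_eu
    proof (rule continuous_map_top_of_set_comp[where D = "{0..1} \<times> grid_box (card S) 1"])
      show "continuous_map (top_of_set ({0..1} \<times> grid_box (card S) 1)) Y H"
        using H(1) by (simp add: cube_eq_grid_box)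
      have "continuous_on ({0..1} \<times> face n N a S) (\<lambda>z. pr (snd z))"
        unfolding pr_def
      proof (rule continuous_on_coordinatewise_then_product)
        show "continuous_on ({0..1} \<times> face n N a S) (\<lambda>z. if j < card S then snd z (\<beta> j) - real (a (\<beta> j)) else 0)" for j
          by (cases "j < card S") (auto intro!: continuous_intros)
      qed
      then show "continuous_on ({0..1} \<times> face n N a S) (\<lambda>z. (fst z, pr (snd z)))"
        by (intro continuous_on_Pair continuous_on_fst continuous_on_id)
      show "(fst z, pr (snd z)) \<in> {0..1} \<times> grid_box (card S) 1" if "z \<in> {0..1} \<times> face n N a S" for z
        using that pr by auto
    qed
    show "face_boundary n N a S \<subseteq> topspace (top_of_set (face n N a S))"
      by (auto simp: face_boundary_def)
  qed (use H emb_pr pr_bd in \<open>auto simp: cube_boundary_eq_grid_box\<close>)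
qed

text \<open>Dimension 0 is not covered by the vanishing of homotopy groups. The segment from the
  vertex to the origin stays in the box, and \<open>g\<close> turns it into a path to
  \<open>y\<close>.\<close>

lemma vertex_null:
  assumes g: "continuous_map (top_of_set (grid_box n N)) Y g" "g (\<lambda>_. 0) = y"
  shows "homotopic_with (\<lambda>h. h ` face_boundary n N a {} \<subseteq> {y}) (top_of_set (face n N a {})) Y g (\<lambda>_. y)"
proof (rule homotopic_with_imageI)
  show "continuous_map (prod_topology (top_of_set {0..1::real}) (top_of_set (face n N a {}))) Y
      (\<lambda>z. g (\<lambda>i. (1 - fst z) * snd z i))"
    unfolding prod_topology_subtopology_eu
  proof (rule continuous_map_top_of_set_comp[OF g(1)])
    show "continuous_on ({0..1} \<times> face n N a {}) (\<lambda>z i. (1 - fst z) * snd z i)"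
      by (intro continuous_on_coordinatewise_then_product continuous_intros)
    show "(\<lambda>i. (1 - fst z) * snd z i) \<in> grid_box n N" if "z \<in> {0..1} \<times> face n N a {}" for z
    proof -
      have "(1 - fst z) * snd z i \<le> real N" if "i < n" for i
        using convex_comb_bounds(2)[of "fst z" 0 "snd z i" "real N" 0] \<open>z \<in> _\<close> that
        by (auto simp: face_def grid_box_def)
      then show ?thesis
        using that by (auto simp: face_def grid_box_def)
    qed
  qed
qed (use g(2) in \<open>auto simp: face_boundary_def\<close>)

text \<open>Collapse a neighbourhood of the face onto the face, then run the contraction of the face there,
  slowed down with increasing distance from the face.\<close>

lemma trivialize_face:
  assumes g: "continuous_map (top_of_set (grid_box n N)) Y g" and aS: "(a, S) \<in> face_index n N"
    and null: "homotopic_with (\<lambda>h. h ` face_boundary n N a S \<subseteq> {y}) (top_of_set (face n N a S)) Y g (\<lambda>_. y)"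
  shows "\<exists>g'. homotopic_with (\<lambda>h. h ` trivial_faces n N y g \<subseteq> {y}) (top_of_set (grid_box n N)) Y g g' \<and>
          g' ` face n N a S \<subseteq> {y}"
proof (cases "g ` face n N a S \<subseteq> {y}")
  case True
  then show ?thesis
    using g trivial_faces_image[of g n N y] by (intro exI[of _ g]) simp
next
  \<comment> \<open>A face that is already trivial is left alone. From here on, no trivial face of
    \<open>g\<close> can contain this one.\<close>
  case False
  let ?sl = "slide n (\<lambda>_ x. x) (\<lambda>_. grid_stretch N 1)"
  define \<rho> where "\<rho> s = ?sl (1, s)" for s
  have \<rho>_eq: "\<rho> s i = (if i < n then grid_stretch N 1 (s i) else 0)" for s i
    by (simp add: \<rho>_def slide_def)
  have Sn: "S \<subseteq> {..<n}" and aN: "\<And>i. i \<in> S \<Longrightarrow> a i < N" "\<And>i. i < n \<Longrightarrow> a i \<le> N"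
    using aS by (auto simp: face_index_def)
  then have finS: "finite S"
    using finite_subset by blast
  have sl: "?sl (t, s) \<in> grid_box n N" if "t \<in> {0..1}" "s \<in> grid_box n N" for t s
    by (rule slide_in_grid_box[OF that]) (use grid_stretch_bounds[of 1] in auto)
  have csl: "continuous_on ({0..1} \<times> grid_box n N) ?sl"
    by (rule continuous_on_slide) (auto intro: continuous_on_grid_stretch)
  have \<rho>grid_box: "\<rho> s \<in> grid_box n N" if "s \<in> grid_box n N" for s
    using sl[of 1] that by (simp add: \<rho>_def)
  have c\<rho>: "continuous_on (grid_box n N) \<rho>"
    unfolding \<rho>_def by (rule continuous_on_compose2[OF csl]) (auto intro!: continuous_intros)
  have \<rho>face: "\<rho> s \<in> face n N a' S'" if "s \<in> face n N a' S'" "(a', S') \<in> face_index n N" for s a' S'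
    unfolding \<rho>_def using slide_in_face[OF _ _ _ that] by simp
  have 1: "homotopic_with (\<lambda>h. h ` trivial_faces n N y g \<subseteq> {y}) (top_of_set (grid_box n N)) Y g (\<lambda>s. g (\<rho> s))"
  proof (rule homotopic_with_imageI)
    show "continuous_map (prod_topology (top_of_set {0..1::real}) (top_of_set (grid_box n N))) Y (\<lambda>z. g (?sl z))"
      unfolding prod_topology_subtopology_eu
      using sl by (intro continuous_map_top_of_set_comp[OF g csl]) auto
    show "trivial_faces n N y g \<subseteq> topspace (top_of_set (grid_box n N))"
      using trivial_faces_subset by simp
    show "g (?sl (0, s)) = g s" if "s \<in> topspace (top_of_set (grid_box n N))" for s
    proof -
      have "?sl (0, s) = s"
        using that by (auto simp: slide_def grid_box_def)
      then show ?thesis by simp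
    qed
    show "g (?sl (t, s)) = y" if t: "t \<in> {0..1}" and s: "s \<in> trivial_faces n N y g" for t s
    proof -
      obtain a' S' where *: "(a', S') \<in> face_index n N" "g ` face n N a' S' \<subseteq> {y}" "s \<in> face n N a' S'"
        using s unfolding trivial_faces_def by blast
      then show ?thesis
        using slide_in_face[OF _ _ t *(3,1), of 1] by auto
    qed
  qed (simp add: \<rho>_def)
  obtain H where H: "continuous_map (prod_topology (top_of_set {0..1::real}) (top_of_set (face n N a S))) Y H"
    "\<And>s. H (0, s) = g s" "\<And>s. H (1, s) = y" "\<And>t s. t \<in> {0..1} \<Longrightarrow> s \<in> face_boundary n N a S \<Longrightarrow> H (t, s) = y"
    using null by (rule homotopic_with_imageE) blast
  \<comment> \<open>\<open>M\<close> consists of the points over the face in the free directions and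
    within 1/3 of it in the fixed ones; \<open>\<rho>\<close> sends it into the face.
    \<open>M'\<close> is a closed set covering the rest of the box.\<close>
  define M where "M = grid_box n N \<inter> ((\<Inter>i\<in>S. {s. real (a i) \<le> s i} \<inter> {s. s i \<le> real (a i) + 1}) \<inter>
     (\<Inter>i\<in>{..<n} - S. {s. \<bar>s i - real (a i)\<bar> \<le> 1/3}))"
  define M' where "M' = grid_box n N \<inter> ((\<Union>i\<in>S. {s. s i \<le> real (a i)} \<union> {s. real (a i) + 1 \<le> s i}) \<union>
     (\<Union>i\<in>{..<n} - S. {s. 1/3 \<le> \<bar>s i - real (a i)\<bar>}))"
  define l where "l s = (\<Prod>i\<in>{..<n} - S. max 0 (1 - 3 * \<bar>s i - real (a i)\<bar>))" for s
  have clb: "closed (grid_box n N)"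
    using compact_grid_box compact_imp_closed by blast
  have clM: "closed M"
    unfolding M_def by (intro closed_Int clb closed_INT ballI closed_Collect_le continuous_intros)
  have clM': "closed M'"
    unfolding M'_def using finS
    by (intro closed_Int clb closed_Un closed_UN ballI closed_Collect_le continuous_intros) auto
  have cov: "s \<in> M \<or> s \<in> M'" if "s \<in> grid_box n N" for s
    using that unfolding M_def M'_def by force
  have l01: "0 \<le> l s" "l s \<le> 1" for s
    unfolding l_def by (auto intro!: prod_nonneg prod_le_1)
  have \<rho>M: "\<rho> s \<in> face n N a S" if "s \<in> M" for s
  proof -
    have s: "s \<in> grid_box n N"
      using that by (simp add: M_def)
    have "if i \<in> S then real (a i) \<le> \<rho> s i \<and> \<rho> s i \<le> real (a i) + 1 else \<rho> s i = real (a i)" if "i < n" for i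
    proof (cases "i \<in> S")
      case True
      then have "real (a i) \<le> s i" "s i \<le> real (a i) + 1"
        using \<open>s \<in> M\<close> by (auto simp: M_def)
      then show ?thesis
        using True that grid_stretch_cell[of 1 "a i" N "s i"] aN(1) by (simp add: \<rho>_eq)
    next
      case False
      then have "\<bar>s i - real (a i)\<bar> \<le> 1/3"
        using \<open>s \<in> M\<close> that by (auto simp: M_def)
      then show ?thesis
        using False that grid_stretch_middle[of "a i" N "s i"] aN(2) s by (simp add: \<rho>_eq grid_box_def)
    qed
    then show ?thesis
      using \<rho>grid_box[OF s] by (simp add: face_def)
  qed
  define F where "F b z = (if b then H (fst z * l (snd z), \<rho> (snd z)) else g (\<rho> (snd z)))" for b z
  define K where "K z = F (snd z \<in> M) z" for z
  \<comment> \<open>At a side of the free directions \<open>\<rho> s\<close> is on the boundary of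
    the face, where the contraction rests at \<open>y\<close>; at distance 1/3 in a fixed direction
    the factor \<open>l\<close> vanishes.\<close>
  have agree: "F True (t, s) = F False (t, s)" if t: "t \<in> {0..1}" and s: "s \<in> M" "s \<in> M'" for t s
  proof -
    have tl: "t * l s \<in> {0..1}"
      using t l01[of s] by (auto intro: mult_le_one)
    consider i where "i \<in> S" "s i \<le> real (a i) \<or> real (a i) + 1 \<le> s i"
      | i where "i \<in> {..<n} - S" "1/3 \<le> \<bar>s i - real (a i)\<bar>"
      using s(2) by (auto simp: M'_def)
    then show ?thesis
    proof cases
      case 1
      then have "s i = real (a i) \<or> s i = real (a i + 1)"
        using s(1) by (force simp: M_def)
      then have "\<rho> s i = s i"
        using 1 aN(1)[of i] Sn grid_stretch_nat[of 1 "a i" N] grid_stretch_nat[of 1 "a i + 1" N]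
        by (auto simp: \<rho>_eq)
      then have "\<rho> s \<in> face_boundary n N a S"
        using \<rho>M[OF s(1)] 1(1) \<open>s i = real (a i) \<or> s i = real (a i + 1)\<close>
        by (auto simp: face_boundary_def intro!: bexI[of _ i])
      then show ?thesis
        using H(4)[OF tl] H(4)[of 0] H(2) by (simp add: F_def)
    next
      case 2
      then have "max 0 (1 - 3 * \<bar>s i - real (a i)\<bar>) = 0"
        by simp
      then have "l s = 0"
        unfolding l_def using 2(1) by (intro prod_zero) auto
      then show ?thesis
        using H(2) by (simp add: F_def)
    qed
  qed
  let ?T = "top_of_set ({0..1::real} \<times> grid_box n N)"
  let ?P = "\<lambda>b. {0..1::real} \<times> (if b then M else M')"
  have MM: "M \<subseteq> grid_box n N" "M' \<subseteq> grid_box n N"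
    by (auto simp: M_def M'_def)
  have c\<rho>2: "continuous_on ({0..1::real} \<times> A) (\<lambda>z. \<rho> (snd z))" if "A \<subseteq> grid_box n N" for A
    by (rule continuous_on_compose2[OF c\<rho>]) (use that in \<open>auto intro!: continuous_intros\<close>)
  have contF: "continuous_map (top_of_set (?P b)) Y (F b)" for b
  proof (cases b)
    case True
    have "continuous_map (top_of_set ({0..1} \<times> M)) Y (\<lambda>z. H (fst z * l (snd z), \<rho> (snd z)))"
    proof (rule continuous_map_top_of_set_comp[where D = "{0..1} \<times> face n N a S"])
      show "continuous_map (top_of_set ({0..1} \<times> face n N a S)) Y H"
        using H(1) by simp
      have "continuous_on ({0..1::real} \<times> M) (\<lambda>z. l (snd z))"
        unfolding l_def by (intro continuous_intros)
      then show "continuous_on ({0..1} \<times> M) (\<lambda>z. (fst z * l (snd z), \<rho> (snd z)))"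
        by (intro continuous_on_Pair continuous_on_mult continuous_on_fst continuous_on_id c\<rho>2 MM)
      show "(fst z * l (snd z), \<rho> (snd z)) \<in> {0..1} \<times> face n N a S" if "z \<in> {0..1} \<times> M" for z
        using that \<rho>M l01[of "snd z"] by (auto intro: mult_le_one)
    qed
    then show ?thesis
      using True by (simp add: F_def[abs_def])
  next
    case False
    have "continuous_map (top_of_set ({0..1::real} \<times> M')) Y (\<lambda>z. g (\<rho> (snd z)))"
      by (rule continuous_map_top_of_set_comp[OF g c\<rho>2[OF MM(2)]]) (use \<rho>grid_box MM in auto)
    then show ?thesis
      using False by (simp add: F_def[abs_def])
  qed
  have contK: "continuous_map ?T Y K"
  proof (rule pasting_lemma_closed[of "UNIV :: bool set" _ ?P _ F])
    show "closedin ?T (?P b)" for b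
      using clM clM' MM by (cases b) (auto intro!: closed_subset closed_Times)
    show "continuous_map (subtopology ?T (?P b)) Y (F b)" for b
    proof -
      have "subtopology ?T (?P b) = top_of_set (?P b)"
        unfolding subtopology_subtopology using MM by (intro arg_cong[of _ _ top_of_set]) (cases b; auto)
      then show ?thesis
        using contF by simp
    qed
    show "F i z = F j z" if "z \<in> topspace ?T \<inter> ?P i \<inter> ?P j" for i j z
    proof (cases "i = j")
      case False
      then have "fst z \<in> {0..1}" "snd z \<in> M" "snd z \<in> M'"
        using that by (cases i; cases j; auto)+
      from agree[OF this] have "F True z = F False z"
        by simp
      then show ?thesis
        by (cases i; cases j) simp_all
    qed simp
    show "\<exists>j. j \<in> UNIV \<and> z \<in> ?P j \<and> K z = F j z" if "z \<in> topspace ?T" for z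
      using that cov[of "snd z"] by (intro exI[of _ "snd z \<in> M"]) (auto simp: K_def mem_Times_iff)
  qed simp
  have 2: "homotopic_with (\<lambda>h. h ` trivial_faces n N y g \<subseteq> {y}) (top_of_set (grid_box n N)) Y (\<lambda>s. g (\<rho> s)) (\<lambda>s. K (1, s))"
  proof (rule homotopic_with_imageI)
    show "continuous_map (prod_topology (top_of_set {0..1::real}) (top_of_set (grid_box n N))) Y K"
      unfolding prod_topology_subtopology_eu by (rule contK)
    show "trivial_faces n N y g \<subseteq> topspace (top_of_set (grid_box n N))"
      using trivial_faces_subset by simp
    show "K (0, s) = g (\<rho> s)" for s
      by (simp add: K_def F_def H(2))
    show "K (t, s) = y" if t: "t \<in> {0..1}" and s: "s \<in> trivial_faces n N y g" for t s
    proof -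
      obtain a' S' where *: "(a', S') \<in> face_index n N" "g ` face n N a' S' \<subseteq> {y}" "s \<in> face n N a' S'"
        using s unfolding trivial_faces_def by blast
      have \<rho>s: "\<rho> s \<in> face n N a' S'"
        by (rule \<rho>face[OF *(3,1)])
      show ?thesis
      proof (cases "s \<in> M")
        case False
        then show ?thesis
          using \<rho>s *(2) by (auto simp: K_def F_def)
      next
        case True
        \<comment> \<open>Otherwise \<open>\<rho> s\<close> is interior to the face, and a grid face
          containing an interior point of another one contains all of it. The trivial face through
          \<open>s\<close> would then make this face trivial as well.\<close>
        have "\<rho> s \<in> face_boundary n N a S"
        proof (rule ccontr)
          assume "\<rho> s \<notin> face_boundary n N a S"
          then have int: "real (a i) < \<rho> s i" "\<rho> s i < real (a i) + 1" if "i \<in> S" for i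
            using \<rho>M[OF True] that Sn by (force simp: face_boundary_def face_def)+
          have "face n N a S \<subseteq> face n N a' S'"
          proof
            fix p assume p: "p \<in> face n N a S"
            have "if i \<in> S' then real (a' i) \<le> p i \<and> p i \<le> real (a' i) + 1 else p i = real (a' i)" if i: "i < n" for i
            proof (cases "i \<in> S")
              case True
              have r: "if i \<in> S' then real (a' i) \<le> \<rho> s i \<and> \<rho> s i \<le> real (a' i) + 1 else \<rho> s i = real (a' i)"
                using \<rho>s i unfolding face_def by blast
              have "i \<in> S'"
              proof (rule ccontr)
                assume "i \<notin> S'"
                then have "real (a i) < real (a' i)" "real (a' i) < real (a i + 1)"
                  using r int[OF True] by auto
                then show False
                  unfolding of_nat_less_iff by linarith
              qed
              then have "real (a i) < real (a' i + 1)" "real (a' i) < real (a i + 1)"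
                using r int[OF True] by auto
              then have "a i = a' i"
                unfolding of_nat_less_iff by linarith
              then show ?thesis
                using \<open>i \<in> S'\<close> p i True by (auto simp: face_def)
            next
              case False
              then have "p i = \<rho> s i"
                using p \<rho>M[OF \<open>s \<in> M\<close>] i by (auto simp: face_def)
              then show ?thesis
                using \<rho>s i unfolding face_def by auto
            qed
            then show "p \<in> face n N a' S'"
              using p by (auto simp: face_def)
          qed
          then show False
            using *(2) False by blast
        qed
        moreover have "t * l s \<in> {0..1}"
          using t l01[of s] by (auto intro: mult_le_one)
        ultimately show ?thesis
          using True H(4) by (simp add: K_def F_def)
      qed
    qed
  qed simp
  have "K (1, s) = y" if s: "s \<in> face n N a S" for s
  proof -
    have "s \<in> M"
      using s Sn by (auto simp: M_def face_def)
    moreover have "l s = 1"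
      unfolding l_def using s by (intro prod.neutral) (auto simp: face_def)
    ultimately show ?thesis
      using H(3) by (simp add: K_def F_def)
  qed
  then show ?thesis
    using homotopic_with_trans[OF 1 2] by blast
qed

text \<open>The free direction in which the point is at an end of its interval is frozen there, at
  \<open>a i\<close> or \<open>a i + 1\<close>.\<close>

lemma face_index_boundary:
  assumes aS: "(a, S) \<in> face_index n N" and s: "s \<in> face_boundary n N a S"
  obtains a' S' where "(a', S') \<in> face_index n N" "s \<in> face n N a' S'" "card S = Suc (card S')"
proof -
  obtain i where i: "i \<in> S" "s i = real (a i) \<or> s i = real (a i + 1)" and sf: "s \<in> face n N a S"
    using s by (auto simp: face_boundary_def)
  have aS': "a \<in> {..<n} \<rightarrow>\<^sub>E {..N}" "S \<subseteq> {..<n}" "\<And>i. i \<in> S \<Longrightarrow> a i < N"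
    using aS by (auto simp: face_index_def)
  have iS: "i < n" "a i + 1 \<le> N"
    using i(1) aS'(2,3) by force+
  define c where "c = (if s i = real (a i) then a i else a i + 1)"
  have c: "s i = real c" "c \<le> N"
    using i(2) iS by (auto simp: c_def)
  show thesis
  proof (rule that)
    show "(a(i := c), S - {i}) \<in> face_index n N"
      using aS' iS c by (auto simp: face_index_def PiE_iff extensional_def)
    show "s \<in> face n N (a(i := c)) (S - {i})"
      using sf c by (auto simp: face_def)
    show "card S = Suc (card (S - {i}))"
      by (rule card_Suc_Diff1[symmetric]) (use i(1) finite_subset[OF aS'(2)] in auto)
  qed
qed

text \<open>Induction on the dimension, and within a dimension over the faces, one at a time. Each
  homotopy rests on the faces that are already trivial, so earlier work survives and the boundary of
  the next face is at \<open>y\<close> when its turn comes. \<open>D\<close> is a strict bound, so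
  the dimensions reached are at most \<open>m\<close>.\<close>

lemma trivialize_skeleton:
  assumes conn: "m_connected_at m Y y"
    and g: "continuous_map (top_of_set (grid_box n N)) Y g" "g (\<lambda>_. 0) = y"
  shows "D \<le> Suc m \<Longrightarrow> \<exists>g'. homotopic_with (\<lambda>h. h ` trivial_faces n N y g \<subseteq> {y}) (top_of_set (grid_box n N)) Y g g' \<and>
      (\<forall>(a, S)\<in>face_index n N. card S < D \<longrightarrow> g' ` face n N a S \<subseteq> {y})"
proof (induction D)
  case 0
  then show ?case
    using g trivial_faces_image[of g n N y] by (intro exI[of _ g]) simp
next
  case (Suc D)
  let ?hom = "homotopic_with (\<lambda>h. h ` trivial_faces n N y g \<subseteq> {y}) (top_of_set (grid_box n N)) Y g"
  \<comment> \<open>\<open>Q\<close> collects the faces of dimension \<open>D\<close> treated so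
    far.\<close>
  have extend: "\<exists>g'. ?hom g' \<and>
      (\<forall>(a, S)\<in>face_index n N. card S < D \<longrightarrow> g' ` face n N a S \<subseteq> {y}) \<and>
      (\<forall>(a, S)\<in>Q. g' ` face n N a S \<subseteq> {y})"
    if "finite Q" "Q \<subseteq> {(a, S) \<in> face_index n N. card S = D}" for Q
    using that
  proof (induction Q rule: finite_induct)
    case empty
    then show ?case
      using Suc by simp
  next
    case (insert p Q)
    obtain a S where p: "p = (a, S)"
      by (cases p)
    have aS: "(a, S) \<in> face_index n N" and card: "card S = D"
      using insert.prems p by auto
    have "Q \<subseteq> {(a, S) \<in> face_index n N. card S = D}"
      using insert.prems by blast
    then obtain g1 where g1': "?hom g1"
      "\<forall>(a, S)\<in>face_index n N. card S < D \<longrightarrow> g1 ` face n N a S \<subseteq> {y}"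
      "\<forall>(a, S)\<in>Q. g1 ` face n N a S \<subseteq> {y}"
      using insert.IH by blast
    then have g1: "?hom g1"
      "\<And>a S. (a, S) \<in> face_index n N \<Longrightarrow> card S < D \<Longrightarrow> g1 ` face n N a S \<subseteq> {y}"
      "\<And>a S. (a, S) \<in> Q \<Longrightarrow> g1 ` face n N a S \<subseteq> {y}"
      by blast+
    have cg1: "continuous_map (top_of_set (grid_box n N)) Y g1"
      using g1(1) homotopic_with_imp_continuous_maps by blast
    have bd: "g1 ` face_boundary n N a S \<subseteq> {y}"
    proof
      fix z assume "z \<in> g1 ` face_boundary n N a S"
      then obtain s where s: "s \<in> face_boundary n N a S" "z = g1 s"
        by auto
      obtain a' S' where "(a', S') \<in> face_index n N" "s \<in> face n N a' S'" "card S = Suc (card S')"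
        using face_index_boundary[OF aS s(1)] .
      then show "z \<in> {y}"
        using g1(2)[of a' S'] card s(2) by auto
    qed
    \<comment> \<open>A homotopy relative to the trivial faces of \<open>g1\<close> is therefore
      also relative to those of \<open>g\<close>, and the two can be composed.\<close>
    have g1triv: "trivial_faces n N y g \<subseteq> trivial_faces n N y g1"
      by (rule trivial_faces_mono[OF conjunct2[OF homotopic_with_imp_property[OF g1(1)]]])
    have "homotopic_with (\<lambda>h. h ` face_boundary n N a S \<subseteq> {y}) (top_of_set (face n N a S)) Y g1 (\<lambda>_. y)"
    proof (cases "S = {}")
      case True
      \<comment> \<open>The origin is itself a trivial face of \<open>g\<close>, so its value is
        preserved and vertices can still be joined to it.\<close>
      have "(\<lambda>_. 0) \<in> face n N (\<lambda>i\<in>{..<n}. 0) {}" "((\<lambda>i\<in>{..<n}. 0), {}) \<in> face_index n N"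
        by (auto simp: face_def grid_box_def face_index_def)
      moreover have "face n N (\<lambda>i\<in>{..<n}. 0) {} \<subseteq> {\<lambda>_. 0}"
        unfolding face_def grid_box_def by (auto simp: fun_eq_iff) (metis not_le)
      moreover from this have "g ` face n N (\<lambda>i\<in>{..<n}. 0) {} \<subseteq> {y}"
        using g(2) by (metis (no_types, lifting) image_empty image_insert image_mono)
      ultimately have "(\<lambda>_. 0) \<in> trivial_faces n N y g"
        using trivial_facesI subsetD by metis
      then have "g1 (\<lambda>_. 0) = y"
        using conjunct2[OF homotopic_with_imp_property[OF g1(1)]] by (simp add: image_subset_iff)
      then show ?thesis
        using vertex_null[OF cg1] True by simp
    next
      case False
      have "finite S"
        using aS finite_subset[of S "{..<n}"] by (auto simp: face_index_def)
      then have "1 \<le> card S" "card S \<le> m"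
        using False card Suc.prems by (auto simp: Suc_le_eq card_gt_0_iff)
      moreover have "continuous_map (top_of_set (face n N a S)) Y g1"
        using continuous_map_from_subtopology_mono[OF cg1 face_subset_grid_box] .
      ultimately show ?thesis
        using face_null[OF conn _ _ aS] bd by blast
    qed
    then obtain g2 where g2: "homotopic_with (\<lambda>h. h ` trivial_faces n N y g1 \<subseteq> {y}) (top_of_set (grid_box n N)) Y g1 g2"
      "g2 ` face n N a S \<subseteq> {y}"
      using trivialize_face[OF cg1 aS] by blast
    have g2triv: "g2 ` face n N a' S' \<subseteq> {y}" if "(a', S') \<in> face_index n N" "g1 ` face n N a' S' \<subseteq> {y}" for a' S'
    proof -
      have "g2 ` trivial_faces n N y g1 \<subseteq> {y}"
        by (rule conjunct2[OF homotopic_with_imp_property[OF g2(1)]])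
      then show ?thesis
        using image_mono[OF trivial_facesI[OF that], of g2] by (rule order_trans[rotated])
    qed
    have "homotopic_with (\<lambda>h. h ` trivial_faces n N y g \<subseteq> {y}) (top_of_set (grid_box n N)) Y g1 g2"
      by (rule homotopic_with_mono[OF g2(1)]) (rule order_trans[OF image_mono[OF g1triv]])
    then have "?hom g2"
      by (rule homotopic_with_trans[OF g1(1)])
    moreover have "\<forall>(a, S)\<in>face_index n N. card S < D \<longrightarrow> g2 ` face n N a S \<subseteq> {y}"
      using g1(2) g2triv by blast
    moreover have "\<forall>(a, S)\<in>insert p Q. g2 ` face n N a S \<subseteq> {y}"
    proof
      fix q assume q: "q \<in> insert p Q"
      obtain b R where b: "q = (b, R)"
        by (cases q)
      have "g2 ` face n N b R \<subseteq> {y}"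
      proof (cases "q = p")
        case True
        then show ?thesis
          using g2(2) p b by simp
      next
        case False
        then have "(b, R) \<in> Q" "(b, R) \<in> face_index n N"
          using q b insert.prems by auto
        then show ?thesis
          using g2triv g1(3) by blast
      qed
      then show "case q of (a, S) \<Rightarrow> g2 ` face n N a S \<subseteq> {y}"
        by (simp add: b)
    qed
    ultimately show ?case
      by blast
  qed
  have fin: "finite {(a, S) \<in> face_index n N. card S = D}"
    by (rule finite_subset[OF _ finite_face_index[of n N]]) auto
  obtain g' where g': "?hom g'"
      "\<forall>(a, S)\<in>face_index n N. card S < D \<longrightarrow> g' ` face n N a S \<subseteq> {y}"
      "\<forall>(a, S)\<in>{(a, S) \<in> face_index n N. card S = D}. g' ` face n N a S \<subseteq> {y}"
    using extend[OF fin order_refl] by blast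
  have "g' ` face n N a S \<subseteq> {y}" if "(a, S) \<in> face_index n N" "card S < Suc D" for a S
  proof (cases "card S = D")
    case True
    then show ?thesis
      using g'(3) that(1) by blast
  next
    case False
    then have "card S < D"
      using that(2) by simp
    then show ?thesis
      using g'(2) that(1) by blast
  qed
  then show ?case
    using g'(1) by blast
qed

text \<open>Freeze direction \<open>i\<close> at \<open>j\<close> and leave the others free.
  Triviality on faces of dimension \<open>n - 1\<close> thus gives triviality wherever some
  coordinate is an integer.\<close>

lemma grid_hyperplane_face:
  assumes p: "p \<in> grid_box n N" and i: "i < n" "p i = real j" and N: "N \<ge> 1"
  obtains a S where "(a, S) \<in> face_index n N" "p \<in> face n N a S" "card S = n - 1"
    "\<And>q. q \<in> face n N a S \<Longrightarrow> q i = real j"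
proof -
  have "\<exists>l<N. real l \<le> p k \<and> p k \<le> real l + 1" if "k < n" for k
  proof -
    have "0 \<le> p k" "p k \<le> real N"
      using p that by (auto simp: grid_box_def)
    then show ?thesis
      using grid_cell_ex[OF _ _ N] by blast
  qed
  then obtain c where c: "\<And>k. k < n \<Longrightarrow> c k < N \<and> real (c k) \<le> p k \<and> p k \<le> real (c k) + 1"
    by metis
  define a where "a = (\<lambda>k\<in>{..<n}. if k = i then j else c k)"
  let ?S = "{..<n} - {i}"
  have "j \<le> N"
    using p i by (auto simp: grid_box_def)
  then have "(a, ?S) \<in> face_index n N"
    using c by (auto simp: face_index_def a_def PiE_iff extensional_def less_imp_le)
  moreover have "p \<in> face n N a ?S"
    using c p i by (auto simp: face_def a_def)
  moreover have "card ?S = n - 1"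
    using i by simp
  moreover have "q i = real j" if "q \<in> face n N a ?S" for q
    using that i by (auto simp: face_def a_def)
  ultimately show thesis
    using that by blast
qed

lemma grid_cell_face:
  assumes p: "p \<in> grid_box n N" and N: "N \<ge> 1"
  obtains a where "(a, {..<n}) \<in> face_index n N" "p \<in> face n N a {..<n}"
proof -
  have "\<exists>l<N. real l \<le> p k \<and> p k \<le> real l + 1" if "k < n" for k
  proof -
    have "0 \<le> p k" "p k \<le> real N"
      using p that by (auto simp: grid_box_def)
    then show ?thesis
      using grid_cell_ex[OF _ _ N] by blast
  qed
  then obtain c where c: "\<And>k. k < n \<Longrightarrow> c k < N \<and> real (c k) \<le> p k \<and> p k \<le> real (c k) + 1"
    by metis
  show thesis
  proof (rule that[of "\<lambda>k\<in>{..<n}. c k"])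
    show "((\<lambda>k\<in>{..<n}. c k), {..<n}) \<in> face_index n N"
      using c by (auto simp: face_index_def PiE_iff extensional_def less_imp_le)
    show "p \<in> face n N (\<lambda>k\<in>{..<n}. c k) {..<n}"
      using c p by (auto simp: face_def)
  qed
qed

section \<open>Separating the two components of a map into a wedge\<close>

text \<open>The boundary of the box is a union of grid faces, so homotopies relative to trivial
  faces are relative to the boundary.\<close>

lemma grid_box_boundary_trivial:
  assumes g: "g ` grid_box_boundary n N \<subseteq> {y}" and N: "N \<ge> 1"
  shows "grid_box_boundary n N \<subseteq> trivial_faces n N y g"
proof
  fix s assume "s \<in> grid_box_boundary n N"
  then obtain i where i: "i < n" "s i = real 0 \<or> s i = real N" and s: "s \<in> grid_box n N"
    by (auto simp: grid_box_boundary_def)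
  then obtain j where j: "s i = real j" "j = 0 \<or> j = N"
    by blast
  obtain a S where aS: "(a, S) \<in> face_index n N" "s \<in> face n N a S"
    and q: "\<And>q. q \<in> face n N a S \<Longrightarrow> q i = real j"
    using grid_hyperplane_face[OF s i(1) j(1) N] by metis
  have "face n N a S \<subseteq> grid_box_boundary n N"
  proof
    fix p assume "p \<in> face n N a S"
    then show "p \<in> grid_box_boundary n N"
      using q[of p] j(2) i(1) face_subset_grid_box[of n N a S] unfolding grid_box_boundary_def by auto
  qed
  then have "g ` face n N a S \<subseteq> {y}"
    by (rule order_trans[OF image_mono g])
  then show "s \<in> trivial_faces n N y g"
    by (rule subsetD[OF trivial_facesI[OF aS(1)] aS(2)])
qed

text \<open>Once the components lie side by side in coordinate 0, two further homotopies undo the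
  stretching and the trivialisation of the skeleton, so that the product of the original components
  results. Each of the five homotopies has its own reason for staying in the wedge.\<close>

lemma wedge_pair_split_grid:
  fixes X1 :: "'a topology" and X2 :: "'b topology"
  assumes n: "n \<ge> 2" and N: "N \<ge> 1"
    and x: "x1 \<in> topspace X1" "x2 \<in> topspace X2"
    and conn: "m_connected_at (n - 1) X1 x1" "m_connected_at (n - 1) X2 x2"
    and g1: "continuous_map (top_of_set (grid_box n N)) X1 g1" "g1 ` grid_box_boundary n N \<subseteq> {x1}"
    and g2: "continuous_map (top_of_set (grid_box n N)) X2 g2" "g2 ` grid_box_boundary n N \<subseteq> {x2}"
    and cells: "\<And>a. (a, {..<n}) \<in> face_index n N \<Longrightarrow>
        g1 ` face n N a {..<n} \<subseteq> {x1} \<or> g2 ` face n N a {..<n} \<subseteq> {x2}"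
  shows "homotopic_with (\<lambda>h. h ` grid_box_boundary n N \<subseteq> {Inl x1}) (top_of_set (grid_box n N))
     (wedge X1 x1 X2 x2) (\<lambda>s. wedge_pair x2 (g1 s) (g2 s))
     (\<lambda>s. wedge_pair x2 (g1 (s(0 := min (real N) (2 * s 0)))) (g2 (s(0 := max 0 (2 * s 0 - real N)))))"
proof -
  let ?B = "grid_box n N" and ?dB = "grid_box_boundary n N"
  let ?T = "top_of_set ?B" and ?I = "top_of_set {0..1::real}"
  let ?W = "wedge X1 x1 X2 x2"
  let ?hom = "homotopic_with (\<lambda>h. h ` ?dB \<subseteq> {Inl x1}) ?T ?W"
  let ?id = "\<lambda>(_::nat) (x::real). x"
  have 0: "(\<lambda>_. 0) \<in> ?dB"
    using n by (auto simp: grid_box_boundary_def grid_box_def intro!: exI[of _ 0])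
  have dBB: "?dB \<subseteq> topspace ?T"
    by (auto simp: grid_box_boundary_def)
  have g10: "g1 (\<lambda>_. 0) = x1" and g20: "g2 (\<lambda>_. 0) = x2"
    using g1(2) g2(2) 0 by (simp_all add: image_subset_iff)
  have n1: "n \<le> Suc (n - 1)"
    by simp
  obtain f1 where "homotopic_with (\<lambda>h. h ` trivial_faces n N x1 g1 \<subseteq> {x1}) ?T X1 g1 f1"
    "\<forall>(a, S)\<in>face_index n N. card S < n \<longrightarrow> f1 ` face n N a S \<subseteq> {x1}"
    using trivialize_skeleton[OF conn(1) g1(1) g10 n1] by blast
  then have f1: "homotopic_with (\<lambda>h. h ` trivial_faces n N x1 g1 \<subseteq> {x1}) ?T X1 g1 f1"
    "\<And>a S. (a, S) \<in> face_index n N \<Longrightarrow> card S < n \<Longrightarrow> f1 ` face n N a S \<subseteq> {x1}"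
    by blast+
  obtain f2 where "homotopic_with (\<lambda>h. h ` trivial_faces n N x2 g2 \<subseteq> {x2}) ?T X2 g2 f2"
    "\<forall>(a, S)\<in>face_index n N. card S < n \<longrightarrow> f2 ` face n N a S \<subseteq> {x2}"
    using trivialize_skeleton[OF conn(2) g2(1) g20 n1] by blast
  then have f2: "homotopic_with (\<lambda>h. h ` trivial_faces n N x2 g2 \<subseteq> {x2}) ?T X2 g2 f2"
    "\<And>a S. (a, S) \<in> face_index n N \<Longrightarrow> card S < n \<Longrightarrow> f2 ` face n N a S \<subseteq> {x2}"
    by blast+
  have cf: "continuous_map ?T X1 f1" "continuous_map ?T X2 f2"
    using homotopic_with_imp_continuous_maps[OF f1(1)] homotopic_with_imp_continuous_maps[OF f2(1)] by auto
  \<comment> \<open>A point with an integer coordinate lies on a face of dimension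
    \<open>n - 1\<close>, and both components are trivial there.\<close>
  have grid: "f1 p = x1" "f2 p = x2" if p: "p \<in> ?B" "i < n" "p i = real j" for p i j
  proof -
    obtain a S where aS: "(a, S) \<in> face_index n N" "p \<in> face n N a S" "card S = n - 1"
      using grid_hyperplane_face[OF p N] by metis
    then have "card S < n"
      using n by simp
    then show "f1 p = x1" "f2 p = x2"
      using f1(2)[OF aS(1)] f2(2)[OF aS(1)] aS(2) by (auto simp: image_subset_iff)
  qed
  have f_bd: "f1 p = x1" "f2 p = x2" if "p \<in> ?B" "i < n" "p i = 0 \<or> p i = real N" for p i
    using grid[OF that(1,2), of 0] grid[OF that(1,2), of N] that(3) by auto
  obtain G1 where G1: "continuous_map (prod_topology ?I ?T) X1 G1" "\<And>s. G1 (0, s) = g1 s" "\<And>s. G1 (1, s) = f1 s"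
    "\<And>t s. t \<in> {0..1} \<Longrightarrow> s \<in> trivial_faces n N x1 g1 \<Longrightarrow> G1 (t, s) = x1"
    using f1(1) by (rule homotopic_with_imageE) blast
  obtain G2 where G2: "continuous_map (prod_topology ?I ?T) X2 G2" "\<And>s. G2 (0, s) = g2 s" "\<And>s. G2 (1, s) = f2 s"
    "\<And>t s. t \<in> {0..1} \<Longrightarrow> s \<in> trivial_faces n N x2 g2 \<Longrightarrow> G2 (t, s) = x2"
    using f2(1) by (rule homotopic_with_imageE) blast
  have tr: "?dB \<subseteq> trivial_faces n N x1 g1" "?dB \<subseteq> trivial_faces n N x2 g2"
    using grid_box_boundary_trivial[OF g1(2) N] grid_box_boundary_trivial[OF g2(2) N] by auto
  have G_bd: "G1 (t, s) = x1" "G2 (t, s) = x2" if "t \<in> {0..1}" "s \<in> ?dB" for t s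
    using G1(4) G2(4) tr that by blast+
  have cell: "trivial_faces n N x1 g1 \<union> trivial_faces n N x2 g2 \<supseteq> face n N a {..<n}" if "(a, {..<n}) \<in> face_index n N" for a
    using cells[OF that]
  proof
    assume "g1 ` face n N a {..<n} \<subseteq> {x1}"
    from trivial_facesI[OF that this] show ?thesis by blast
  next
    assume "g2 ` face n N a {..<n} \<subseteq> {x2}"
    from trivial_facesI[OF that this] show ?thesis by blast
  qed
  \<comment> \<open>Each cell is a trivial face of one component, whose homotopy rests
    there.\<close>
  have i: "?hom (\<lambda>s. wedge_pair x2 (g1 s) (g2 s)) (\<lambda>s. wedge_pair x2 (f1 s) (f2 s))"
  proof (rule homotopic_with_wedge_pair[OF G1(1) G2(1) x _ dBB])
    show "G1 (t, s) = x1 \<or> G2 (t, s) = x2" if t: "t \<in> {0..1}" and s: "s \<in> topspace ?T" for t s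
    proof -
      obtain a where "(a, {..<n}) \<in> face_index n N" "s \<in> face n N a {..<n}"
        using grid_cell_face[of s n N] s N by auto
      then show ?thesis
        using cell G1(4)[OF t] G2(4)[OF t] by blast
    qed
  qed (simp_all add: G_bd G1 G2)
  have gs: "continuous_on {0..real N} (grid_stretch N b)" for b
    by (rule continuous_on_grid_stretch)
  have gsb: "grid_stretch N b x \<in> {0..real N}" if "b = 0 \<or> b = 2" "x \<in> {0..real N}" for b x
    using grid_stretch_bounds[of b x N] that by auto
  have gs0N: "grid_stretch N b 0 = 0" "grid_stretch N b (real N) = real N" if "b = 0 \<or> b = 2" for b
    using grid_stretch_nat[of b 0 N] grid_stretch_nat[of b N N] that by auto
  \<comment> \<open>Reparametrizations that fix 0 and \<open>N\<close> keep a boundary point on the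
    boundary, by the same coordinate.\<close>
  have bd: "\<exists>i<n. slide n \<alpha> \<beta> (t, s) i = 0 \<or> slide n \<alpha> \<beta> (t, s) i = real N"
    if s: "s \<in> ?dB" and e: "\<And>i. i < n \<Longrightarrow> \<alpha> i 0 = 0 \<and> \<beta> i 0 = 0 \<and> \<alpha> i (real N) = real N \<and> \<beta> i (real N) = real N"
    for \<alpha> \<beta> t s
  proof -
    obtain i where "i < n" "s i = 0 \<or> s i = real N"
      using s by (auto simp: grid_box_boundary_def)
    then show ?thesis
      using e[of i] by (intro exI[of _ i]) (auto simp: slide_def algebra_simps)
  qed
  have slide_hom: "?hom (\<lambda>s. wedge_pair x2 (f1 (slide n \<alpha>1 \<beta>1 (0, s))) (f2 (slide n \<alpha>2 \<beta>2 (0, s))))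
        (\<lambda>s. wedge_pair x2 (f1 (slide n \<alpha>1 \<beta>1 (1, s))) (f2 (slide n \<alpha>2 \<beta>2 (1, s))))"
    if c: "\<And>i. i < n \<Longrightarrow> continuous_on {0..real N} (\<alpha>1 i) \<and> continuous_on {0..real N} (\<beta>1 i)"
        "\<And>i. i < n \<Longrightarrow> continuous_on {0..real N} (\<alpha>2 i) \<and> continuous_on {0..real N} (\<beta>2 i)"
      and b: "\<And>i x. i < n \<Longrightarrow> x \<in> {0..real N} \<Longrightarrow> \<alpha>1 i x \<in> {0..real N} \<and> \<beta>1 i x \<in> {0..real N}"
        "\<And>i x. i < n \<Longrightarrow> x \<in> {0..real N} \<Longrightarrow> \<alpha>2 i x \<in> {0..real N} \<and> \<beta>2 i x \<in> {0..real N}"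
      and e: "\<And>i. i < n \<Longrightarrow> \<alpha>1 i 0 = 0 \<and> \<beta>1 i 0 = 0 \<and> \<alpha>1 i (real N) = real N \<and> \<beta>1 i (real N) = real N"
        "\<And>i. i < n \<Longrightarrow> \<alpha>2 i 0 = 0 \<and> \<beta>2 i 0 = 0 \<and> \<alpha>2 i (real N) = real N \<and> \<beta>2 i (real N) = real N"
      and sep: "\<And>t s. t \<in> {0..1} \<Longrightarrow> s \<in> ?B \<Longrightarrow> f1 (slide n \<alpha>1 \<beta>1 (t, s)) = x1 \<or> f2 (slide n \<alpha>2 \<beta>2 (t, s)) = x2"
    for \<alpha>1 \<beta>1 \<alpha>2 \<beta>2
  proof (rule homotopic_with_wedge_pair[OF continuous_map_slide[OF cf(1) c(1) b(1)]
        continuous_map_slide[OF cf(2) c(2) b(2)] x _ dBB])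
    show "f1 (slide n \<alpha>1 \<beta>1 (t, s)) = x1 \<and> f2 (slide n \<alpha>2 \<beta>2 (t, s)) = x2" if "t \<in> {0..1}" "s \<in> ?dB" for t s
    proof -
      have "s \<in> ?B"
        using that(2) by (simp add: grid_box_boundary_def)
      then have "slide n \<alpha>1 \<beta>1 (t, s) \<in> ?B" "slide n \<alpha>2 \<beta>2 (t, s) \<in> ?B"
        using slide_in_grid_box[OF that(1)] b by simp_all
      moreover have "\<exists>i<n. slide n \<alpha>1 \<beta>1 (t, s) i = 0 \<or> slide n \<alpha>1 \<beta>1 (t, s) i = real N"
        by (rule bd[OF that(2)]) (rule e(1))
      moreover have "\<exists>i<n. slide n \<alpha>2 \<beta>2 (t, s) i = 0 \<or> slide n \<alpha>2 \<beta>2 (t, s) i = real N"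
        by (rule bd[OF that(2)]) (rule e(2))
      ultimately show ?thesis
        using f_bd by blast
    qed
  qed (use sep in auto)
  \<comment> \<open>Both slides preserve every cell, and on each cell one component is still
    trivial.\<close>
  have ii: "?hom (\<lambda>s. wedge_pair x2 (f1 (slide n ?id (\<lambda>_. grid_stretch N 0) (0, s))) (f2 (slide n ?id (\<lambda>_. grid_stretch N 2) (0, s))))
        (\<lambda>s. wedge_pair x2 (f1 (slide n ?id (\<lambda>_. grid_stretch N 0) (1, s))) (f2 (slide n ?id (\<lambda>_. grid_stretch N 2) (1, s))))"
  proof (rule slide_hom)
    show "f1 (slide n ?id (\<lambda>_. grid_stretch N 0) (t, s)) = x1 \<or> f2 (slide n ?id (\<lambda>_. grid_stretch N 2) (t, s)) = x2"
      if t: "t \<in> {0..1}" and s: "s \<in> ?B" for t s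
    proof -
      obtain a where a: "(a, {..<n}) \<in> face_index n N" "s \<in> face n N a {..<n}"
        using grid_cell_face[of s n N] s N by auto
      have *: "slide n ?id (\<lambda>_. grid_stretch N b) (t, s) \<in> face n N a {..<n}" if "b = 0 \<or> b = 2" for b
        using slide_in_face[OF _ _ t a(2,1), of b] that by auto
      have "f1 ` face n N a {..<n} \<subseteq> {x1} \<or> f2 ` face n N a {..<n} \<subseteq> {x2}"
      proof -
        have "f1 ` trivial_faces n N x1 g1 \<subseteq> {x1}" "f2 ` trivial_faces n N x2 g2 \<subseteq> {x2}"
          using conjunct2[OF homotopic_with_imp_property[OF f1(1)]] conjunct2[OF homotopic_with_imp_property[OF f2(1)]] .
        then show ?thesis
          using cells[OF a(1)] image_mono[OF trivial_facesI[OF a(1), of g1 x1], of f1]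
            image_mono[OF trivial_facesI[OF a(1), of g2 x2], of f2] by (meson order_trans)
      qed
      then show ?thesis
        using *[of 0] *[of 2] by (auto simp: image_subset_iff)
    qed
  qed (use gs gsb gs0N in auto)
  \<comment> \<open>\<open>L\<close> traverses the side in the first half and then rests at
    \<open>N\<close>; \<open>R\<close> rests at 0 and traverses the side in the second half.\<close>
  define L where "L x = min (real N) (2 * x)" for x
  define R where "R x = max 0 (2 * x - real N)" for x
  have cLR: "continuous_on {0..real N} L" "continuous_on {0..real N} R"
    unfolding L_def R_def by (intro continuous_intros)+
  have LR: "L x \<in> {0..real N}" "R x \<in> {0..real N}" if "x \<in> {0..real N}" for x
    using that by (auto simp: L_def R_def)
  have LR0N: "L 0 = 0" "R 0 = 0" "L (real N) = real N" "R (real N) = real N"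
    by (auto simp: L_def R_def)
  have LR_or: "L x = real N \<or> R x = 0" for x
    by (auto simp: L_def R_def)
  let ?gL = "\<lambda>i::nat. if i = 0 then L else grid_stretch N 0"
  let ?gR = "\<lambda>i::nat. if i = 0 then R else grid_stretch N 2"
  \<comment> \<open>Only coordinate 0 moves. Coordinate 1 keeps its stretched value, which is an
    integer for one of the two components.\<close>
  have iii: "?hom (\<lambda>s. wedge_pair x2 (f1 (slide n (\<lambda>_. grid_stretch N 0) ?gL (0, s))) (f2 (slide n (\<lambda>_. grid_stretch N 2) ?gR (0, s))))
        (\<lambda>s. wedge_pair x2 (f1 (slide n (\<lambda>_. grid_stretch N 0) ?gL (1, s))) (f2 (slide n (\<lambda>_. grid_stretch N 2) ?gR (1, s))))"
  proof (rule slide_hom)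
    show "f1 (slide n (\<lambda>_. grid_stretch N 0) ?gL (t, s)) = x1 \<or> f2 (slide n (\<lambda>_. grid_stretch N 2) ?gR (t, s)) = x2"
      if t: "t \<in> {0..1}" and s: "s \<in> ?B" for t s
    proof -
      have s1: "0 \<le> s 1" "s 1 \<le> real N"
        using s n by (auto simp: grid_box_def)
      obtain j where "j \<le> N" "grid_stretch N 0 (s 1) = real j \<or> grid_stretch N 2 (s 1) = real j"
        using grid_stretch_0_or_2[OF s1 N] by blast
      then have "slide n (\<lambda>_. grid_stretch N 0) ?gL (t, s) 1 = real j \<or> slide n (\<lambda>_. grid_stretch N 2) ?gR (t, s) 1 = real j"
        using n by (auto simp: slide_def algebra_simps)
      moreover have "slide n (\<lambda>_. grid_stretch N 0) ?gL (t, s) \<in> ?B" "slide n (\<lambda>_. grid_stretch N 2) ?gR (t, s) \<in> ?B"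
        using gsb LR by (intro slide_in_grid_box t s; auto)+
      ultimately show ?thesis
        using grid[of _ 1 j] n by auto
    qed
  qed (use gs gsb gs0N cLR LR LR0N in auto)
  let ?iL = "\<lambda>i::nat. if i = 0 then L else (\<lambda>x. x)"
  let ?iR = "\<lambda>i::nat. if i = 0 then R else (\<lambda>x. x)"
  \<comment> \<open>Now coordinate 0 separates: it is \<open>N\<close> for the first component or 0
    for the second, so the remaining coordinates may return to the identity.\<close>
  have iv: "?hom (\<lambda>s. wedge_pair x2 (f1 (slide n ?gL ?iL (0, s))) (f2 (slide n ?gR ?iR (0, s))))
        (\<lambda>s. wedge_pair x2 (f1 (slide n ?gL ?iL (1, s))) (f2 (slide n ?gR ?iR (1, s))))"
  proof (rule slide_hom)
    show "f1 (slide n ?gL ?iL (t, s)) = x1 \<or> f2 (slide n ?gR ?iR (t, s)) = x2"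
      if t: "t \<in> {0..1}" and s: "s \<in> ?B" for t s
    proof -
      have "slide n ?gL ?iL (t, s) 0 = L (s 0)" "slide n ?gR ?iR (t, s) 0 = R (s 0)"
        using n by (auto simp: slide_def algebra_simps)
      moreover have "slide n ?gL ?iL (t, s) \<in> ?B" "slide n ?gR ?iR (t, s) \<in> ?B"
        using gsb LR by (intro slide_in_grid_box t s; auto)+
      ultimately show ?thesis
        using f_bd[of _ 0] LR_or[of "s 0"] n by auto
    qed
  qed (use gs gsb gs0N cLR LR LR0N in auto)
  have updB: "s(0 := L (s 0)) \<in> ?B" "s(0 := R (s 0)) \<in> ?B" if "s \<in> ?B" for s
    using that LR[of "s 0"] n by (auto simp: grid_box_def)
  have upd_bd: "s(0 := L (s 0)) \<in> ?dB" "s(0 := R (s 0)) \<in> ?dB" if s: "s \<in> ?dB" for s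
  proof -
    obtain i where "i < n" "s i = 0 \<or> s i = real N" "s \<in> ?B"
      using s by (auto simp: grid_box_boundary_def)
    then show "s(0 := L (s 0)) \<in> ?dB" "s(0 := R (s 0)) \<in> ?dB"
      using updB[of s] LR0N unfolding grid_box_boundary_def by (auto intro!: exI[of _ i])
  qed
  have cont_upd: "continuous_on ({0..1::real} \<times> ?B) (\<lambda>z. (fst z, (snd z)(0 := \<gamma> (snd z 0))))"
    if "continuous_on {0..real N} \<gamma>" for \<gamma> :: "real \<Rightarrow> real"
  proof (intro continuous_on_Pair continuous_on_fst continuous_on_id continuous_on_coordinatewise_then_product)
    fix i
    have "continuous_on ({0..1::real} \<times> ?B) (\<lambda>z. \<gamma> (snd z 0))"
      by (rule continuous_on_compose2[OF that continuous_on_snd_coord]) (use n in \<open>auto simp: grid_box_def\<close>)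
    then show "continuous_on ({0..1::real} \<times> ?B) (\<lambda>z. ((snd z)(0 := \<gamma> (snd z 0))) i)"
      by (cases "i = 0") (auto intro: continuous_on_snd_coord)
  qed
  \<comment> \<open>Used in reverse: the trivialisation of the skeleton is undone in the two halves
    separately, while the other component is on the boundary of the box.\<close>
  have v: "?hom (\<lambda>s. wedge_pair x2 (g1 (s(0 := L (s 0)))) (g2 (s(0 := R (s 0)))))
        (\<lambda>s. wedge_pair x2 (f1 (s(0 := L (s 0)))) (f2 (s(0 := R (s 0)))))"
  proof (rule homotopic_with_wedge_pair[where F = "\<lambda>z. G1 (fst z, (snd z)(0 := L (snd z 0)))"
        and G = "\<lambda>z. G2 (fst z, (snd z)(0 := R (snd z 0)))", OF _ _ x _ dBB])
    show "continuous_map (prod_topology ?I ?T) X1 (\<lambda>z. G1 (fst z, (snd z)(0 := L (snd z 0))))"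
      unfolding prod_topology_subtopology_eu
      by (rule continuous_map_top_of_set_comp[OF G1(1)[unfolded prod_topology_subtopology_eu] cont_upd[OF cLR(1)]])
        (use updB in auto)
    show "continuous_map (prod_topology ?I ?T) X2 (\<lambda>z. G2 (fst z, (snd z)(0 := R (snd z 0))))"
      unfolding prod_topology_subtopology_eu
      by (rule continuous_map_top_of_set_comp[OF G2(1)[unfolded prod_topology_subtopology_eu] cont_upd[OF cLR(2)]])
        (use updB in auto)
    show "G1 (fst (t, s), (snd (t, s))(0 := L (snd (t, s) 0))) = x1 \<or> G2 (fst (t, s), (snd (t, s))(0 := R (snd (t, s) 0))) = x2"
      if t: "t \<in> {0..1}" and s: "s \<in> topspace ?T" for t s
    proof -
      have "s(0 := L (s 0)) \<in> ?dB \<or> s(0 := R (s 0)) \<in> ?dB"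
        using LR_or[of "s 0"] updB[of s] s n unfolding grid_box_boundary_def by (auto intro!: exI[of _ 0])
      then show ?thesis
        using G_bd[OF t] by auto
    qed
  qed (use G_bd upd_bd G1 G2 in auto)
  have eqs: "slide n ?id (\<lambda>_. grid_stretch N b) (0, s) = s"
    "slide n (\<lambda>_. grid_stretch N b) \<beta> (0, s) = slide n ?id (\<lambda>_. grid_stretch N b) (1, s)"
    "slide n (\<lambda>_. grid_stretch N 0) ?gL (1, s) = slide n ?gL ?iL (0, s)"
    "slide n (\<lambda>_. grid_stretch N 2) ?gR (1, s) = slide n ?gR ?iR (0, s)"
    "slide n ?gL ?iL (1, s) = s(0 := L (s 0))"
    "slide n ?gR ?iR (1, s) = s(0 := R (s 0))"
    if "s \<in> ?B" for b \<beta> s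
    using that n by (auto simp: slide_def grid_box_def fun_eq_iff)
  have ii': "?hom (\<lambda>s. wedge_pair x2 (f1 s) (f2 s))
      (\<lambda>s. wedge_pair x2 (f1 (slide n ?id (\<lambda>_. grid_stretch N 0) (1, s))) (f2 (slide n ?id (\<lambda>_. grid_stretch N 2) (1, s))))"
    by (rule homotopic_with_image_cong[OF ii dBB]) (simp_all add: eqs(1))
  have iii': "?hom (\<lambda>s. wedge_pair x2 (f1 (slide n ?id (\<lambda>_. grid_stretch N 0) (1, s))) (f2 (slide n ?id (\<lambda>_. grid_stretch N 2) (1, s))))
      (\<lambda>s. wedge_pair x2 (f1 (slide n ?gL ?iL (0, s))) (f2 (slide n ?gR ?iR (0, s))))"
    by (rule homotopic_with_image_cong[OF iii dBB]) (simp_all only: topspace_euclidean_subtopology eqs(2-4))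
  have iv': "?hom (\<lambda>s. wedge_pair x2 (f1 (slide n ?gL ?iL (0, s))) (f2 (slide n ?gR ?iR (0, s))))
      (\<lambda>s. wedge_pair x2 (f1 (s(0 := L (s 0)))) (f2 (s(0 := R (s 0)))))"
    by (rule homotopic_with_image_cong[OF iv dBB]) (simp_all only: topspace_euclidean_subtopology eqs(5,6))
  from homotopic_with_trans[OF i homotopic_with_trans[OF ii' homotopic_with_trans[OF iii'
      homotopic_with_trans[OF iv' homotopic_with_symD[OF v]]]]]
  show ?thesis
    by (simp add: L_def R_def)
qed

text \<open>The metric on functions is a series of truncated distances with weights
  \<open>(1/2) ^ m\<close>, and these sum to 2.\<close>

lemma fun_dist_le:
  fixes x y :: "nat \<Rightarrow> real"
  assumes "\<And>i. \<bar>x i - y i\<bar> \<le> e"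
  shows "dist x y \<le> 2 * e"
proof -
  have e: "e \<ge> 0"
    using assms[of 0] by linarith
  have s: "summable (\<lambda>n. (1/2::real) ^ n * e)"
    by (intro summable_mult2 summable_geometric) simp
  have le: "(1/2) ^ n * min (dist (x (from_nat n)) (y (from_nat n))) 1 \<le> (1/2) ^ n * e" for n
    using assms[of "from_nat n"] by (intro mult_left_mono) (auto simp: dist_real_def min_def)
  have "dist x y = (\<Sum>n. (1/2) ^ n * min (dist (x (from_nat n)) (y (from_nat n))) 1)"
    by (simp add: dist_fun_def)
  also have "\<dots> \<le> (\<Sum>n. (1/2) ^ n * e)"
    by (rule suminf_le[OF le summable_comparison_test_ev[OF _ s] s]) (use le e in \<open>auto intro!: always_eventually\<close>)
  also have "\<dots> = 2 * e"
    using suminf_mult2[OF summable_geometric[of "1/2::real"], of e] suminf_geometric[of "1/2::real"] by simp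
  finally show ?thesis .
qed

text \<open>By \<open>sep\<close> the cube is covered by open sets on each of which one component is
  constant; every cell of a grid that is fine compared with the Lebesgue number lies in one of
  them.\<close>

lemma wedge_pair_split_cube:
  fixes X1 :: "'a topology" and X2 :: "'b topology"
  assumes n: "n \<ge> 2" and x: "x1 \<in> topspace X1" "x2 \<in> topspace X2"
    and conn: "m_connected_at (n - 1) X1 x1" "m_connected_at (n - 1) X2 x2"
    and g1: "continuous_map (cube n) X1 g1" "g1 ` cube_boundary n \<subseteq> {x1}"
    and g2: "continuous_map (cube n) X2 g2" "g2 ` cube_boundary n \<subseteq> {x2}"
    and sep: "\<And>s. s \<in> topspace (cube n) \<Longrightarrow> \<exists>U. openin (cube n) U \<and> s \<in> U \<and>
        ((\<forall>u\<in>U. g1 u = x1) \<or> (\<forall>u\<in>U. g2 u = x2))"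
  shows "cube_homotopic n (wedge X1 x1 X2 x2) (Inl x1) (\<lambda>s. wedge_pair x2 (g1 s) (g2 s))
     (cube_concat (\<lambda>s. wedge_pair x2 (g1 s) x2) (\<lambda>s. wedge_pair x2 x1 (g2 s)))"
proof -
  let ?C = "grid_box n 1" and ?W = "wedge X1 x1 X2 x2"
  have "\<forall>s\<in>?C. \<exists>U. open U \<and> s \<in> U \<and> ((\<forall>u\<in>U \<inter> ?C. g1 u = x1) \<or> (\<forall>u\<in>U \<inter> ?C. g2 u = x2))"
  proof
    fix s assume s: "s \<in> ?C"
    then obtain U where U: "openin (cube n) U" "s \<in> U" "(\<forall>u\<in>U. g1 u = x1) \<or> (\<forall>u\<in>U. g2 u = x2)"
      using sep[of s] by (auto simp: cube_eq_grid_box)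
    obtain V where "open V" "U = ?C \<inter> V"
      using U(1) by (auto simp: cube_eq_grid_box openin_open)
    then show "\<exists>U. open U \<and> s \<in> U \<and> ((\<forall>u\<in>U \<inter> ?C. g1 u = x1) \<or> (\<forall>u\<in>U \<inter> ?C. g2 u = x2))"
      using U by (intro exI[of _ V]) auto
  qed
  then obtain U where U: "\<And>s. s \<in> ?C \<Longrightarrow> open (U s) \<and> s \<in> U s \<and>
      ((\<forall>u\<in>U s \<inter> ?C. g1 u = x1) \<or> (\<forall>u\<in>U s \<inter> ?C. g2 u = x2))"
    by metis
  have C0: "(\<lambda>_. 0) \<in> ?C"
    by (simp add: grid_box_def)
  obtain \<delta> where \<delta>: "\<delta> > 0" "\<And>T. T \<subseteq> ?C \<Longrightarrow> diameter T < \<delta> \<Longrightarrow> \<exists>B \<in> U ` ?C. T \<subseteq> B"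
    by (rule Lebesgue_number_lemma[of ?C "U ` ?C"]) (use compact_grid_box U C0 in \<open>auto 0 4\<close>)
  \<comment> \<open>In the metric on functions a cell of side \<open>1 / N\<close> has diameter at
    most \<open>2 / N\<close>.\<close>
  obtain N where N: "N \<ge> 1" "2 / real N < \<delta>"
  proof -
    obtain m where m: "2 / \<delta> < real m"
      using reals_Archimedean2 by blast
    have "m \<ge> 1"
      using m \<delta>(1) by (cases m) (auto simp: field_simps)
    then show thesis
      using m \<delta>(1) by (intro that[of m]) (auto simp: field_simps)
  qed
  define sc where "sc s = (\<lambda>i. s i / real N)" for s :: "nat \<Rightarrow> real"
  define us where "us s = (\<lambda>i. real N * s i)" for s :: "nat \<Rightarrow> real"
  have sc: "sc s \<in> ?C" if "s \<in> grid_box n N" for s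
    using that N by (auto simp: sc_def grid_box_def)
  have us: "us s \<in> grid_box n N" if "s \<in> ?C" for s
    using that N mult_left_mono[of "s _" 1 "real N"] by (auto simp: us_def grid_box_def)
  have sc_us: "sc (us s) = s" for s
    using N by (simp add: sc_def us_def)
  have sc_bd: "sc s \<in> grid_box_boundary n 1" if "s \<in> grid_box_boundary n N" for s
    using that sc[of s] N by (auto simp: grid_box_boundary_def sc_def)
  have us_bd: "us s \<in> grid_box_boundary n N" if "s \<in> grid_box_boundary n 1" for s
    using that us[of s] N by (auto simp: grid_box_boundary_def us_def)
  have csc: "continuous_on A sc" for A
    unfolding sc_def using N by (intro continuous_on_coordinatewise_then_product continuous_intros) auto
  have cus: "continuous_on A us" for A
    unfolding us_def by (intro continuous_on_coordinatewise_then_product continuous_intros)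
  have "homotopic_with (\<lambda>h. h ` grid_box_boundary n N \<subseteq> {Inl x1}) (top_of_set (grid_box n N)) ?W
      (\<lambda>s. wedge_pair x2 (g1 (sc s)) (g2 (sc s)))
      (\<lambda>s. wedge_pair x2 (g1 (sc (s(0 := min (real N) (2 * s 0))))) (g2 (sc (s(0 := max 0 (2 * s 0 - real N))))))"
  proof (rule wedge_pair_split_grid[OF n N(1) x conn])
    show "continuous_map (top_of_set (grid_box n N)) X1 (\<lambda>s. g1 (sc s))"
      using g1(1) unfolding cube_eq_grid_box by (rule continuous_map_top_of_set_comp) (use csc sc in auto)
    show "continuous_map (top_of_set (grid_box n N)) X2 (\<lambda>s. g2 (sc s))"
      using g2(1) unfolding cube_eq_grid_box by (rule continuous_map_top_of_set_comp) (use csc sc in auto)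
    show "(\<lambda>s. g1 (sc s)) ` grid_box_boundary n N \<subseteq> {x1}" "(\<lambda>s. g2 (sc s)) ` grid_box_boundary n N \<subseteq> {x2}"
      using g1(2) g2(2) sc_bd by (simp_all add: cube_boundary_eq_grid_box image_subset_iff)
    fix a
    let ?F = "face n N a {..<n}"
    have dist: "dist p q \<le> 2 / real N" if pq': "p \<in> sc ` ?F" "q \<in> sc ` ?F" for p q
    proof -
      obtain p' q' where pq: "p = sc p'" "q = sc q'" "p' \<in> ?F" "q' \<in> ?F"
        using pq' by blast
      have "\<bar>p' i - q' i\<bar> \<le> 1" for i
      proof (cases "i < n")
        case True
        then have "real (a i) \<le> p' i" "p' i \<le> real (a i) + 1" "real (a i) \<le> q' i" "q' i \<le> real (a i) + 1"
          using pq(3,4) by (auto simp: face_def)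
        then show ?thesis
          by linarith
      qed (use pq(3,4) in \<open>auto simp: face_def grid_box_def\<close>)
      then have "\<bar>p' i - q' i\<bar> / real N \<le> 1 / real N" for i
        by (intro divide_right_mono) auto
      then have "\<bar>p i - q i\<bar> \<le> 1 / real N" for i
        using N by (simp add: pq sc_def abs_divide flip: diff_divide_distrib)
      from fun_dist_le[OF this] show ?thesis
        by simp
    qed
    have "diameter (sc ` ?F) \<le> 2 / real N"
      unfolding diameter_def using dist by (auto intro!: cSUP_least)
    then have "diameter (sc ` ?F) < \<delta>"
      using N by linarith
    moreover have "sc ` ?F \<subseteq> ?C"
      using sc face_subset_grid_box by blast
    ultimately obtain s where s: "s \<in> ?C" "sc ` ?F \<subseteq> U s"
      using \<delta>(2) by blast
    then show "(\<lambda>s. g1 (sc s)) ` ?F \<subseteq> {x1} \<or> (\<lambda>s. g2 (sc s)) ` ?F \<subseteq> {x2}"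
      using U[OF s(1)] \<open>sc ` ?F \<subseteq> ?C\<close> by (auto simp: image_subset_iff)
  qed
  then obtain H where H: "continuous_map (prod_topology (top_of_set {0..1::real}) (top_of_set (grid_box n N))) ?W H"
    "\<And>s. H (0, s) = wedge_pair x2 (g1 (sc s)) (g2 (sc s))"
    "\<And>s. H (1, s) = wedge_pair x2 (g1 (sc (s(0 := min (real N) (2 * s 0))))) (g2 (sc (s(0 := max 0 (2 * s 0 - real N)))))"
    "\<And>t s. t \<in> {0..1} \<Longrightarrow> s \<in> grid_box_boundary n N \<Longrightarrow> H (t, s) = Inl x1"
    by (rule homotopic_with_imageE) blast
  show ?thesis
    unfolding cube_homotopic_def cube_boundary_eq_grid_box cube_eq_grid_box
  proof (rule homotopic_with_imageI)
    show "continuous_map (prod_topology (top_of_set {0..1::real}) (top_of_set ?C)) ?W (\<lambda>z. H (fst z, us (snd z)))"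
      unfolding prod_topology_subtopology_eu
    proof (rule continuous_map_top_of_set_comp[OF H(1)[unfolded prod_topology_subtopology_eu]])
      show "continuous_on ({0..1} \<times> ?C) (\<lambda>z. (fst z, us (snd z)))"
        by (intro continuous_on_Pair continuous_on_fst continuous_on_id continuous_on_compose2[OF cus[of UNIV] continuous_on_snd]) auto
    qed (use us in auto)
    show "grid_box_boundary n 1 \<subseteq> topspace (top_of_set ?C)"
      by (auto simp: grid_box_boundary_def)
    show "H (fst (0, s), us (snd (0, s))) = wedge_pair x2 (g1 s) (g2 s)" for s
      by (simp add: H sc_us)
    show "H (fst (t, s), us (snd (t, s))) = Inl x1" if "t \<in> {0..1}" "s \<in> grid_box_boundary n 1" for t s
      using H(4) us_bd that by simp
    show "H (fst (1, s), us (snd (1, s))) =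
        cube_concat (\<lambda>s. wedge_pair x2 (g1 s) x2) (\<lambda>s. wedge_pair x2 x1 (g2 s)) s"
      if s: "s \<in> topspace (top_of_set ?C)" for s
    proof -
      have *: "sc ((us s)(0 := real N * c)) = s(0 := c)" for c
        using N by (auto simp: sc_def us_def)
      have "min (real N) (2 * us s 0) = real N * min 1 (2 * s 0)"
        by (simp add: us_def min_mult_distrib_left)
      moreover have "max 0 (2 * us s 0 - real N) = real N * max 0 (2 * s 0 - 1)"
        by (simp add: us_def max_mult_distrib_left algebra_simps)
      ultimately have eq: "H (1, us s) = wedge_pair x2 (g1 (s(0 := min 1 (2 * s 0)))) (g2 (s(0 := max 0 (2 * s 0 - 1))))"
        by (simp add: H(3) *)
      show ?thesis
      \<comment> \<open>In each half the other component is evaluated where coordinate 0 is 0 or 1,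
        hence is at its base point. This turns the pair into a concatenation.\<close>
      proof (cases "s 0 \<le> 1/2")
        case True
        have "s(0 := 0) \<in> grid_box_boundary n 1"
          using s n by (auto simp: grid_box_boundary_def grid_box_def intro!: exI[of _ 0])
        then have "g2 (s(0 := 0)) = x2"
          using g2(2) by (simp add: cube_boundary_eq_grid_box image_subset_iff)
        then show ?thesis
          using True eq by (simp add: cube_concat_def)
      next
        case False
        have "s(0 := 1) \<in> grid_box_boundary n 1"
          using s n by (auto simp: grid_box_boundary_def grid_box_def intro!: exI[of _ 0])
        then have "g1 (s(0 := 1)) = x1"
          using g1(2) by (simp add: cube_boundary_eq_grid_box image_subset_iff)
        then show ?thesis
          using False eq by (simp add: cube_concat_def)
      qed
    qed
  qed
qed

section \<open>Homotopies on the Hawaiian earring\<close>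

definition earring :: "nat \<Rightarrow> (nat \<Rightarrow> real) set" where
  "earring n = (\<Union>k\<in>{1..}. earring_sphere n k)"

lemma hawaiian_earring_eq: "hawaiian_earring n = top_of_set (earring n)"
proof -
  have "earring n \<subseteq> {x. \<forall>i\<ge>Suc n. x i = 0}"
    by (auto simp: earring_def earring_sphere_def topspace_Euclidean_space)
  then show ?thesis
    unfolding hawaiian_earring_def Euclidean_space_eq_top_of_set subtopology_subtopology earring_def
    by (simp add: Int_absorb1)
qed

text \<open>With the square multiplied out, \<open>k\<close> occurs only in the coefficient of
  \<open>r 0\<close>, which makes the spheres comparable.\<close>

lemma earring_sphere_iff:
  assumes "k \<ge> 1"
  shows "r \<in> earring_sphere n k \<longleftrightarrow> (\<forall>i>n. r i = 0) \<and> (\<Sum>i\<le>n. (r i)\<^sup>2) = 2 / real k * r 0"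
proof -
  have "(\<Sum>i\<le>n. (r i)\<^sup>2) = (r 0)\<^sup>2 + (\<Sum>i=1..n. (r i)\<^sup>2)"
    by (simp add: sum.atMost_shift sum.atLeast1_atMost_eq)
  moreover have "(r 0 - 1 / real k)\<^sup>2 = (r 0)\<^sup>2 - 2 / real k * r 0 + (1 / real k)\<^sup>2"
    by (simp add: power2_diff)
  ultimately have "(r 0 - 1 / real k)\<^sup>2 + (\<Sum>i=1..n. (r i)\<^sup>2) = (1 / real k)\<^sup>2 \<longleftrightarrow>
      (\<Sum>i\<le>n. (r i)\<^sup>2) = 2 / real k * r 0"
    by linarith
  then show ?thesis
    unfolding earring_sphere_def topspace_Euclidean_space by (simp only: mem_Collect_eq Suc_le_eq)
qed

lemma earring_base_in_sphere: "k \<ge> 1 \<Longrightarrow> earring_base \<in> earring_sphere n k"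
  by (simp add: earring_sphere_iff)

lemma earring_sphere_nonneg:
  assumes "k \<ge> 1" "r \<in> earring_sphere n k"
  shows "r 0 \<ge> 0" "r 0 = 0 \<Longrightarrow> r = earring_base"
proof -
  have r: "\<forall>i>n. r i = 0" "(\<Sum>i\<le>n. (r i)\<^sup>2) = 2 / real k * r 0"
    using assms earring_sphere_iff by auto
  have "(\<Sum>i\<le>n. (r i)\<^sup>2) \<ge> 0"
    by (intro sum_nonneg) auto
  then show "r 0 \<ge> 0"
    using r(2) assms(1) by (auto simp: zero_le_mult_iff zero_le_divide_iff)
  assume "r 0 = 0"
  then have "(\<Sum>i\<le>n. (r i)\<^sup>2) = 0"
    using r(2) by simp
  then have "\<forall>i\<in>{..n}. (r i)\<^sup>2 = 0"
    by (subst (asm) sum_nonneg_eq_0_iff) auto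
  then have "r i = 0" for i
    using r(1) by (cases "i \<le> n") auto
  then show "r = earring_base"
    by (rule ext)
qed

section \<open>The parametrization of the spheres\<close>

lemma sphere_param_scale: "sphere_param n k s = (\<lambda>i. (1 / real k) * sphere_param n 1 s i)"
  by (simp add: sphere_param_def Let_def fun_eq_iff)

lemma sphere_param_in_sphere: "k \<ge> 1 \<Longrightarrow> n \<ge> 1 \<Longrightarrow> s \<in> topspace (cube n) \<Longrightarrow> sphere_param n k s \<in> earring_sphere n k"
  using imageI[of s "topspace (cube n)" "sphere_param n k"] sphere_param_image[of k n] by simp

lemma earring_point_param:
  assumes "n \<ge> 1" "r \<in> earring n"
  obtains k s where "k \<ge> 1" "s \<in> topspace (cube n)" "sphere_param n k s = r"
proof -
  obtain k where "k \<ge> 1" "r \<in> earring_sphere n k"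
    using assms(2) by (auto simp: earring_def)
  then have "r \<in> sphere_param n k ` topspace (cube n)"
    using sphere_param_image[OF _ assms(1)] by simp
  then show thesis
    using that \<open>k \<ge> 1\<close> by blast
qed

context
  fixes n :: nat and x :: "(nat \<Rightarrow> real) \<Rightarrow> nat \<Rightarrow> real" and d D :: "(nat \<Rightarrow> real) \<Rightarrow> real"
  defines "x \<equiv> \<lambda>s i. 2 * s i - 1" and "d \<equiv> \<lambda>s. \<Prod>i<n. 1 - (x s i)\<^sup>2"
    and "D \<equiv> \<lambda>s. (d s)\<^sup>2 + (\<Sum>i<n. (x s i)\<^sup>2)"
begin

private lemma sphere_param_eq: "sphere_param n k s =
  (\<lambda>j. (2 / real k) * (if j = 0 then (d s)\<^sup>2 else if j \<le> n then d s * x s (j - 1) else 0) / D s)"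
  unfolding sphere_param_def d_def D_def x_def Let_def by (rule refl)

text \<open>Where all \<open>x i\<close> vanish, \<open>d\<close> is 1; so the two terms of the
  denominator have no common zero.\<close>

private lemma D_nonzero: "D s \<noteq> 0"
proof
  assume "D s = 0"
  then have *: "d s = 0" "(\<Sum>i<n. (x s i)\<^sup>2) = 0"
    using sum_nonneg[of "{..<n}" "\<lambda>i. (x s i)\<^sup>2"] by (auto simp: D_def add_nonneg_eq_0_iff)
  then have "\<forall>i\<in>{..<n}. (x s i)\<^sup>2 = 0"
    by (subst (asm) sum_nonneg_eq_0_iff) auto
  then have "d s = 1"
    by (simp add: d_def)
  with * show False
    by simp
qed

lemma continuous_on_sphere_param: "continuous_on A (sphere_param n k)"
proof -
  have d: "continuous_on A d"
    unfolding d_def x_def by (intro continuous_intros)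
  have D: "continuous_on A D"
    unfolding D_def x_def by (intro continuous_intros d)
  have x: "continuous_on A (\<lambda>s. x s i)" for i
    unfolding x_def by (intro continuous_intros)
  have "continuous_on A (\<lambda>s j. (2 / real k) * (if j = 0 then (d s)\<^sup>2 else if j \<le> n then d s * x s (j - 1) else 0) / D s)"
  proof (rule continuous_on_coordinatewise_then_product)
    fix j
    have "continuous_on A (\<lambda>s. if j = 0 then (d s)\<^sup>2 else if j \<le> n then d s * x s (j - 1) else 0)"
      by (cases "j = 0"; cases "j \<le> n") (auto intro!: continuous_on_mult continuous_on_power d x)
    then show "continuous_on A (\<lambda>s. (2 / real k) * (if j = 0 then (d s)\<^sup>2 else if j \<le> n then d s * x s (j - 1) else 0) / D s)"
      using D_nonzero by (intro continuous_on_divide continuous_on_mult continuous_on_const D) auto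
  qed
  then show ?thesis
    by (simp add: sphere_param_eq[abs_def])
qed

private lemma d_facts:
  assumes "s \<in> topspace (cube n)"
  shows "d s \<ge> 0" "d s = 0 \<longleftrightarrow> s \<in> cube_boundary n" "i < n \<Longrightarrow> (x s i)\<^sup>2 \<le> 1"
proof -
  show *: "i < n \<Longrightarrow> (x s i)\<^sup>2 \<le> 1" for i
    using assms by (auto simp: topspace_cube x_def abs_square_le_1)
  then show "d s \<ge> 0"
    unfolding d_def by (intro prod_nonneg) auto
  have "1 - (x s i)\<^sup>2 = 0 \<longleftrightarrow> s i = 0 \<or> s i = 1" for i
    unfolding x_def power2_eq_square by algebra
  then show "d s = 0 \<longleftrightarrow> s \<in> cube_boundary n"
    using assms by (auto simp: d_def cube_boundary_def)
qed

lemma sphere_param_boundary: "s \<in> cube_boundary n \<Longrightarrow> sphere_param n k s = earring_base"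
  using d_facts(2)[of s] by (auto simp: sphere_param_eq cube_boundary_def)

lemma sphere_param_base_iff:
  assumes "k \<ge> 1" "s \<in> topspace (cube n)"
  shows "sphere_param n k s = earring_base \<longleftrightarrow> s \<in> cube_boundary n"
proof
  assume "sphere_param n k s = earring_base"
  then have "sphere_param n k s 0 = 0"
    by simp
  then show "s \<in> cube_boundary n"
    using assms D_nonzero d_facts(2) by (simp add: sphere_param_eq)
qed (rule sphere_param_boundary)

text \<open>The coordinates of the image determine \<open>x / d\<close>, and shrinking \<open>x\<close> enlarges \<open>d\<close>.\<close>

lemma sphere_param_inj:
  assumes k: "k \<ge> 1" and s: "s \<in> topspace (cube n)" "s \<notin> cube_boundary n" and s': "s' \<in> topspace (cube n)"
    and eq: "sphere_param n k s = sphere_param n k s'"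
  shows "s = s'"
proof -
  have "s' \<notin> cube_boundary n"
    using sphere_param_base_iff[OF k] s s' eq by metis
  then have d: "d s > 0" "d s' > 0"
    using d_facts(1,2)[OF s(1)] d_facts(1,2)[OF s'] s(2) by auto
  have quot: "x s i / d s = x s' i / d s'" if "i < n" for i
  proof -
    have *: "sphere_param n k t (Suc i) / sphere_param n k t 0 = x t i / d t" if "d t > 0" for t
      using \<open>i < n\<close> that k D_nonzero[of t] by (simp add: sphere_param_eq field_simps power2_eq_square)
    show ?thesis
      using *[OF d(1)] *[OF d(2)] eq by simp
  qed
  have mono: "d t' \<le> d t" if t: "d t \<le> d t'" "0 < d t" "t' \<in> topspace (cube n)"
    and quot: "\<forall>i<n. x t i / d t = x t' i / d t'" for t t'
    unfolding d_def
  proof (rule prod_mono)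
    fix i assume "i \<in> {..<n}"
    then have i: "i < n" by simp
    have "x t i = x t' i * (d t / d t')"
      using t quot i by (auto simp: field_simps)
    moreover have "(d t / d t')\<^sup>2 \<le> 1"
      using t by (simp add: power_le_one)
    ultimately have "(x t i)\<^sup>2 \<le> (x t' i)\<^sup>2"
      by (metis mult_left_le power_mult_distrib zero_le_power2)
    then show "0 \<le> 1 - (x t' i)\<^sup>2 \<and> 1 - (x t' i)\<^sup>2 \<le> 1 - (x t i)\<^sup>2"
      using d_facts(3)[OF t(3) i] by simp
  qed
  have "d s = d s'"
    using mono[of s s'] mono[of s' s] d s(1) s' quot by (cases "d s \<le> d s'") (auto intro: antisym)
  then have "s i = s' i" if "i < n" for i
    using quot[OF that] d by (simp add: x_def)
  moreover have "s i = s' i" if "i \<ge> n" for i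
    using that s(1) s' by (simp add: topspace_cube)
  ultimately show ?thesis
    by (metis ext not_le)
qed

end

lemma earring_sphere_disjoint:
  assumes "k \<ge> 1" "k' \<ge> 1" "r \<in> earring_sphere n k" "r \<in> earring_sphere n k'" "r \<noteq> earring_base"
  shows "k = k'"
proof -
  have "r 0 \<noteq> 0"
    using earring_sphere_nonneg(2) assms by blast
  moreover have "2 / real k * r 0 = 2 / real k' * r 0"
    using assms by (metis earring_sphere_iff)
  ultimately show ?thesis
    using assms(1,2) by (simp add: frac_eq_eq)
qed

text \<open>As a set, the earring is countably many cubes with all boundaries collapsed to one
  point. The topology at that point is a separate matter, settled by the tail conditions
  below.\<close>

lemma earring_param_cases:
  assumes n: "n \<ge> 1" and k: "k \<ge> 1" "k' \<ge> 1" and s: "s \<in> topspace (cube n)" "s' \<in> topspace (cube n)"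
    and eq: "sphere_param n k s = sphere_param n k' s'"
  shows "(k = k' \<and> s = s') \<or> (s \<in> cube_boundary n \<and> s' \<in> cube_boundary n)"
proof (cases "s \<in> cube_boundary n")
  case True
  then show ?thesis
    using sphere_param_base_iff[OF k(2) s(2)] sphere_param_boundary[OF True, of k] eq by simp
next
  case False
  then have "sphere_param n k s \<noteq> earring_base"
    using sphere_param_base_iff[OF k(1) s(1)] by simp
  then have "k = k'"
    using earring_sphere_disjoint[OF k, of "sphere_param n k s" n] sphere_param_in_sphere[OF k(1) n s(1)]
      sphere_param_in_sphere[OF k(2) n s(2)] eq by simp
  then show ?thesis
    using sphere_param_inj[OF k(1) s(1) False s(2)] eq by simp
qed

text \<open>The quotient \<open>|r|\<^sup>2 / r\<^sub>0\<close> has the value \<open>2 / k\<close> on the \<open>k\<close>th sphere.\<close>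

lemma earring_sphere_punctured_open:
  assumes "k \<ge> 1"
  obtains V where "open V" "V \<inter> earring n = earring_sphere n k - {earring_base}"
proof -
  define q where "q r = (\<Sum>i\<le>n. (r i)\<^sup>2)" for r :: "nat \<Rightarrow> real"
  \<comment> \<open>On the \<open>j\<close>th sphere the quotient \<open>2 * r 0 / q r\<close> is
    \<open>j\<close>. The two inequalities, cleared of the denominator, place it within 1/2 of
    \<open>k\<close>; at the base point they fail, both sides being 0.\<close>
  define V where "V = {r. q r * (real k - 1/2) < 2 * r 0} \<inter> {r. 2 * r 0 < q r * (real k + 1/2)}"
  have "open V"
    unfolding V_def q_def by (intro open_Int open_Collect_less continuous_intros)
  moreover have "r \<in> V \<longleftrightarrow> j = k \<and> r \<noteq> earring_base" if j: "j \<ge> 1" and r: "r \<in> earring_sphere n j" for r j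
  proof (cases "r = earring_base")
    case False
    then have r0: "r 0 > 0"
      using earring_sphere_nonneg[OF j r] by force
    have q: "q r = 2 * r 0 / real j"
      using r j by (simp add: earring_sphere_iff q_def)
    have "r \<in> V \<longleftrightarrow> 2 * r 0 * (real k - 1/2) < 2 * r 0 * real j \<and> 2 * r 0 * real j < 2 * r 0 * (real k + 1/2)"
      using j by (simp add: V_def q field_simps)
    also have "\<dots> \<longleftrightarrow> real k - 1/2 < real j \<and> real j < real k + 1/2"
      using r0 by simp
    also have "\<dots> \<longleftrightarrow> j = k"
      by linarith
    finally show ?thesis
      using False by simp
  qed (simp add: V_def q_def)
  then have "V \<inter> earring n = earring_sphere n k - {earring_base}"
    using assms by (auto simp: earring_def)
  ultimately show thesis
    using that by blast
qed

section \<open>Gluing homotopies sphere by sphere\<close>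

lemma compact_earring_sphere:
  assumes "k \<ge> 1" "n \<ge> 1"
  shows "compact (earring_sphere n k)"
proof -
  have "compact (sphere_param n k ` grid_box n 1)"
    by (rule compact_continuous_image[OF continuous_on_sphere_param compact_grid_box])
  then show ?thesis
    using sphere_param_image[OF assms] by (simp add: cube_eq_grid_box)
qed

lemma earring_sphere_subset: "k \<ge> 1 \<Longrightarrow> earring_sphere n k \<subseteq> earring n"
  by (auto simp: earring_def)

text \<open>Away from the base point continuity can be checked on single spheres, as punctured
  spheres are open; at the base point it is what \<open>tail\<close> provides.\<close>

lemma earring_lift:
  fixes Y :: "'a topology"
  assumes n: "n \<ge> 1" and y: "y \<in> topspace Y"
    and G: "\<And>k. k \<ge> 1 \<Longrightarrow> continuous_map (prod_topology (top_of_set {0..1::real}) (cube n)) Y (G k)"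
    and bd: "\<And>k t s. k \<ge> 1 \<Longrightarrow> t \<in> {0..1} \<Longrightarrow> s \<in> cube_boundary n \<Longrightarrow> G k (t, s) = y"
    and tail: "\<And>U. openin Y U \<Longrightarrow> y \<in> U \<Longrightarrow>
        \<exists>K. \<forall>k\<ge>K. k \<ge> 1 \<longrightarrow> (\<forall>t\<in>{0..1}. \<forall>s\<in>topspace (cube n). G k (t, s) \<in> U)"
  obtains F where "continuous_map (prod_topology (top_of_set {0..1::real}) (hawaiian_earring n)) Y F"
    "\<And>k t s. k \<ge> 1 \<Longrightarrow> t \<in> {0..1} \<Longrightarrow> s \<in> topspace (cube n) \<Longrightarrow> F (t, sphere_param n k s) = G k (t, s)"
proof -
  let ?I = "{0..1::real}"
  \<comment> \<open>The choice is harmless: distinct preimages of a point lie on the boundary of the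
    cube, where every \<open>G k\<close> has the value \<open>y\<close>.\<close>
  define F where "F = (\<lambda>(t, r). let (k, s) = (SOME (k, s). 1 \<le> k \<and> s \<in> topspace (cube n) \<and> sphere_param n k s = r) in G k (t, s))"
  have F: "F (t, sphere_param n k s) = G k (t, s)" if k: "k \<ge> 1" and t: "t \<in> ?I" and s: "s \<in> topspace (cube n)" for k t s
  proof -
    let ?P = "\<lambda>(k', s'). 1 \<le> k' \<and> s' \<in> topspace (cube n) \<and> sphere_param n k' s' = sphere_param n k s"
    obtain k' s' where ks': "(SOME p. ?P p) = (k', s')"
      by (cases "SOME p. ?P p") simp
    have "?P (k, s)"
      using k s by simp
    then have "?P (k', s')"
      using someI[of ?P "(k, s)"] ks' by simp
    then have P: "1 \<le> k'" "s' \<in> topspace (cube n)" "sphere_param n k' s' = sphere_param n k s"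
      by simp_all
    have "F (t, sphere_param n k s) = G k' (t, s')"
      using ks' by (simp add: F_def)
    then show ?thesis
      using earring_param_cases[OF n P(1) k P(2) s P(3)] bd P(1) k t by auto
  qed
  have base: "F (t, earring_base) = y" if "t \<in> ?I" for t
  proof -
    have b: "earring_base \<in> cube_boundary n"
      using n by (auto simp: cube_boundary_def topspace_cube intro!: exI[of _ 0])
    then have "F (t, sphere_param n 1 earring_base) = y"
      using F[of 1 t earring_base] bd[of 1 t earring_base] that by (simp add: cube_boundary_def)
    then show ?thesis
      by (simp add: sphere_param_boundary[OF b])
  qed
  \<comment> \<open>The parametrization is a quotient map, its domain being compact, so
    \<open>G k\<close> descends to the sphere.\<close>
  have cF: "continuous_map (top_of_set (?I \<times> earring_sphere n k)) Y F" if k: "k \<ge> 1" for k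
  proof (rule continuous_compose_quotient_map)
    let ?f = "\<lambda>z. (fst z, sphere_param n k (snd z))"
    show "quotient_map (top_of_set (?I \<times> grid_box n 1)) (top_of_set (?I \<times> earring_sphere n k)) ?f"
    proof (rule continuous_imp_quotient_map)
      have im: "sphere_param n k ` grid_box n 1 = earring_sphere n k"
        using sphere_param_image[OF k n] by (simp add: cube_eq_grid_box)
      have "continuous_on (?I \<times> grid_box n 1) ?f"
        by (intro continuous_on_Pair continuous_on_fst continuous_on_id
            continuous_on_compose2[OF continuous_on_sphere_param[of UNIV] continuous_on_snd]) auto
      then show "continuous_map (top_of_set (?I \<times> grid_box n 1)) (top_of_set (?I \<times> earring_sphere n k)) ?f"
        using im by auto
      show "compact_space (top_of_set (?I \<times> grid_box n 1))"
        by (simp add: compact_space_subtopology compact_Times compact_grid_box)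
      show "Hausdorff_space (top_of_set (?I \<times> earring_sphere n k))"
        by (simp add: Hausdorff_space_subtopology)
      show "?f ` topspace (top_of_set (?I \<times> grid_box n 1)) = topspace (top_of_set (?I \<times> earring_sphere n k))"
        unfolding im[symmetric] by force
    qed
    have "continuous_map (top_of_set (?I \<times> grid_box n 1)) Y (G k)"
      using G[OF k] by (simp add: cube_eq_grid_box)
    then show "continuous_map (top_of_set (?I \<times> grid_box n 1)) Y (F \<circ> ?f)"
      by (rule continuous_map_eq) (use F[OF k] in \<open>auto simp: cube_eq_grid_box\<close>)
  qed
  have Fin: "F z \<in> topspace Y" if z: "z \<in> ?I \<times> earring n" for z
  proof -
    obtain k where "k \<ge> 1" "z \<in> ?I \<times> earring_sphere n k"
      using z by (auto simp: earring_def)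
    then show ?thesis
      using cF[of k] by (auto simp: continuous_map_def Pi_iff)
  qed
  have open_preimage: "openin (top_of_set (?I \<times> earring n)) {z \<in> ?I \<times> earring n. F z \<in> U}" if U: "openin Y U" for U
  proof (cases "y \<in> U")
    \<comment> \<open>By \<open>tail\<close> only finitely many spheres have points outside the
      preimage, so its complement is a finite union of closed sets.\<close>
    case True
    obtain K where K: "\<And>k t s. k \<ge> K \<Longrightarrow> k \<ge> 1 \<Longrightarrow> t \<in> ?I \<Longrightarrow> s \<in> topspace (cube n) \<Longrightarrow> G k (t, s) \<in> U"
      using tail[OF U True] by blast
    let ?Q = "\<lambda>k. {z \<in> ?I \<times> earring_sphere n k. F z \<in> topspace Y - U}"
    have "closed (?Q k)" if "k \<ge> 1" for k
    proof -
      have "closedin (top_of_set (?I \<times> earring_sphere n k)) (?Q k)"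
        using closedin_continuous_map_preimage[OF cF[OF that] closedin_diff[OF closedin_topspace U]] by simp
      moreover have "closed (?I \<times> earring_sphere n k)"
        using compact_earring_sphere[OF that n] by (intro closed_Times) (auto intro: compact_imp_closed)
      ultimately show ?thesis
        using closedin_closed_trans by blast
    qed
    then have cl: "closed (\<Union>k\<in>{1..<K}. ?Q k)"
      by (intro closed_UN) auto
    have "{z \<in> ?I \<times> earring n. F z \<in> U} = (?I \<times> earring n) - (\<Union>k\<in>{1..<K}. ?Q k)"
    proof
      show "{z \<in> ?I \<times> earring n. F z \<in> U} \<subseteq> (?I \<times> earring n) - (\<Union>k\<in>{1..<K}. ?Q k)"
        by blast
      show "(?I \<times> earring n) - (\<Union>k\<in>{1..<K}. ?Q k) \<subseteq> {z \<in> ?I \<times> earring n. F z \<in> U}"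
      proof
        fix z assume z: "z \<in> (?I \<times> earring n) - (\<Union>k\<in>{1..<K}. ?Q k)"
        have "snd z \<in> earring n"
          using z by (simp add: mem_Times_iff)
        then obtain k s where ks: "k \<ge> 1" "s \<in> topspace (cube n)" "sphere_param n k s = snd z"
          by (rule earring_point_param[OF n])
        have t: "fst z \<in> ?I"
          using z by auto
        have "F z \<in> U"
        proof (cases "k < K")
          case True
          moreover have "z \<in> ?I \<times> earring_sphere n k"
            using t sphere_param_in_sphere[OF ks(1) n ks(2)] ks(3) by (auto simp: mem_Times_iff)
          moreover have "F z \<in> topspace Y"
            using Fin z by blast
          ultimately show ?thesis
            using z ks(1) by auto
        next
          case False
          then show ?thesis
            using K[OF _ ks(1) t ks(2)] F[OF ks(1) t ks(2)] ks(3) by simp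
        qed
        then show "z \<in> {z \<in> ?I \<times> earring n. F z \<in> U}"
          using z by auto
      qed
    qed
    then show ?thesis
      using cl by (simp only: Diff_eq openin_open_Int open_Compl)
  next
    \<comment> \<open>The preimage misses the base point. It is the union of its parts on the
      punctured spheres, each of which is open in the earring.\<close>
    case False
    have "openin (top_of_set (?I \<times> earring n)) {z \<in> ?I \<times> earring_sphere n k. F z \<in> U}" if k: "k \<ge> 1" for k
    proof -
      have "openin (top_of_set (?I \<times> earring_sphere n k)) {z \<in> ?I \<times> earring_sphere n k. F z \<in> U}"
        using openin_continuous_map_preimage[OF cF[OF k] U] by simp
      then obtain W where W: "open W" "{z \<in> ?I \<times> earring_sphere n k. F z \<in> U} = (?I \<times> earring_sphere n k) \<inter> W"
        by (auto simp: openin_open)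
      obtain V where V: "open V" "V \<inter> earring n = earring_sphere n k - {earring_base}"
        using earring_sphere_punctured_open[OF k] .
      have "{z \<in> ?I \<times> earring_sphere n k. F z \<in> U} = (?I \<times> earring n) \<inter> (W \<inter> (UNIV \<times> V))"
      proof
        show "{z \<in> ?I \<times> earring_sphere n k. F z \<in> U} \<subseteq> (?I \<times> earring n) \<inter> (W \<inter> (UNIV \<times> V))"
        proof
          fix z assume z: "z \<in> {z \<in> ?I \<times> earring_sphere n k. F z \<in> U}"
          then have "snd z \<noteq> earring_base"
            using base[of "fst z"] False by (cases z) auto
          then have "snd z \<in> V \<inter> earring n"
            unfolding V(2) using z by (simp add: mem_Times_iff)
          moreover have "z \<in> W"
            using z unfolding W(2) by simp
          ultimately show "z \<in> (?I \<times> earring n) \<inter> (W \<inter> (UNIV \<times> V))"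
            using z by (auto simp: mem_Times_iff)
        qed
        show "(?I \<times> earring n) \<inter> (W \<inter> (UNIV \<times> V)) \<subseteq> {z \<in> ?I \<times> earring_sphere n k. F z \<in> U}"
        proof
          fix z assume z: "z \<in> (?I \<times> earring n) \<inter> (W \<inter> (UNIV \<times> V))"
          then have "snd z \<in> V \<inter> earring n"
            by (simp add: mem_Times_iff)
          then have "snd z \<in> earring_sphere n k"
            unfolding V(2) by simp
          then show "z \<in> {z \<in> ?I \<times> earring_sphere n k. F z \<in> U}"
            unfolding W(2) using z by (simp add: mem_Times_iff)
        qed
      qed
      moreover have "open (W \<inter> (UNIV \<times> V))"
        using W V by (intro open_Int open_Times) auto
      ultimately show ?thesis
        by (metis openin_open_Int)
    qed
    then have "openin (top_of_set (?I \<times> earring n)) (\<Union>k\<in>{1..}. {z \<in> ?I \<times> earring_sphere n k. F z \<in> U})"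
      by (intro openin_Union) auto
    moreover have "(\<Union>k\<in>{1..}. {z \<in> ?I \<times> earring_sphere n k. F z \<in> U}) = {z \<in> ?I \<times> earring n. F z \<in> U}"
      by (auto simp: earring_def)
    ultimately show ?thesis
      by simp
  qed
  have "continuous_map (top_of_set (?I \<times> earring n)) Y F"
    unfolding continuous_map_def using Fin open_preimage by simp
  then show thesis
    using F by (intro that[of F]) (simp_all add: hawaiian_earring_eq)
qed

text \<open>The converse of the tail condition in \<open>earring_lift\<close>. The
  \<open>k\<close>th sphere is the first one scaled by \<open>1 / k\<close>, and at scale 0
  everything is at the base point; the tube lemma makes this uniform in time and position.\<close>

lemma earring_tail:
  fixes Y :: "'a topology"
  assumes n: "n \<ge> 1"
    and F: "continuous_map (prod_topology (top_of_set {0..1::real}) (hawaiian_earring n)) Y F"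
    and base: "\<And>t. t \<in> {0..1} \<Longrightarrow> F (t, earring_base) = y" and U: "openin Y U" "y \<in> U"
  shows "\<exists>K. \<forall>k\<ge>K. k \<ge> 1 \<longrightarrow> (\<forall>t\<in>{0..1}. \<forall>s\<in>topspace (cube n). F (t, sphere_param n k s) \<in> U)"
proof -
  let ?I = "{0..1::real}" and ?C = "grid_box n 1"
  have "openin (top_of_set (?I \<times> earring n)) {z \<in> ?I \<times> earring n. F z \<in> U}"
    using openin_continuous_map_preimage[OF F U(1)] by (simp add: hawaiian_earring_eq)
  then obtain W where W: "open W" "{z \<in> ?I \<times> earring n. F z \<in> U} = (?I \<times> earring n) \<inter> W"
    by (auto simp: openin_open)
  \<comment> \<open>Scales the first sphere by \<open>fst z\<close>. For a factor not of the form
    \<open>1 / k\<close> the result need not lie in the earring; hence the open set \<open>W\<close>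
    of the ambient space.\<close>
  define c where "c z = (fst (snd z), \<lambda>i. fst z * sphere_param n 1 (snd (snd z)) i)" for z :: "real \<times> real \<times> (nat \<Rightarrow> real)"
  have sp: "continuous_on A (\<lambda>z. sphere_param n 1 (snd (snd z)) i)" for A :: "(real \<times> real \<times> (nat \<Rightarrow> real)) set" and i
    by (rule continuous_on_product_then_coordinatewise)
      (intro continuous_on_compose2[OF continuous_on_sphere_param[of UNIV]] continuous_on_snd continuous_on_id subset_UNIV)
  have "continuous_on (?I \<times> (?I \<times> ?C)) c"
    unfolding c_def
    by (intro continuous_on_Pair continuous_on_fst continuous_on_snd continuous_on_id
        continuous_on_coordinatewise_then_product continuous_on_mult sp)
  then have "openin (top_of_set (?I \<times> (?I \<times> ?C))) ((?I \<times> (?I \<times> ?C)) \<inter> c -` W)"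
    using W(1) continuous_openin_preimage_gen by blast
  then have op: "openin (prod_topology (top_of_set ?I) (top_of_set (?I \<times> ?C))) ((?I \<times> (?I \<times> ?C)) \<inter> c -` W)"
    by simp
  have "c (0, t, s) \<in> W" if "t \<in> ?I" for t s
  proof -
    have "(t, earring_base) \<in> {z \<in> ?I \<times> earring n. F z \<in> U}"
      using that base U(2) earring_base_in_sphere[of 1 n] earring_sphere_subset[of 1 n] by auto
    then show ?thesis
      using W(2) by (auto simp: c_def)
  qed
  then have sub: "{0} \<times> (?I \<times> ?C) \<subseteq> (?I \<times> (?I \<times> ?C)) \<inter> c -` W"
    by auto
  have "\<exists>A B. openin (top_of_set ?I) A \<and> openin (top_of_set (?I \<times> ?C)) B \<and> 0 \<in> A \<and> ?I \<times> ?C \<subseteq> B \<and>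
      A \<times> B \<subseteq> (?I \<times> (?I \<times> ?C)) \<inter> c -` W"
    by (rule tube_lemma_right[OF op _ _ sub])
      (simp_all add: compactin_subtopology compact_Times compact_grid_box)
  then obtain A where A: "openin (top_of_set ?I) A" "0 \<in> A" "A \<times> (?I \<times> ?C) \<subseteq> c -` W"
    by blast
  obtain A' where A': "open A'" "A = ?I \<inter> A'"
    using A(1) by (auto simp: openin_open)
  then obtain e where e: "e > 0" "ball 0 e \<subseteq> A'"
    using A(2) open_contains_ball by blast
  obtain K where K: "inverse (real (Suc K)) < e"
    using reals_Archimedean[OF e(1)] by blast
  have "F (t, sphere_param n k s) \<in> U" if k: "k \<ge> Suc K" "k \<ge> 1" and t: "t \<in> ?I" and s: "s \<in> topspace (cube n)" for k t s
  proof -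
    have "1 / real k \<le> inverse (real (Suc K))"
      using k by (simp add: inverse_eq_divide frac_le)
    then have "1 / real k < e"
      using K by linarith
    then have "1 / real k \<in> A"
      using e(2) A'(2) k by (auto simp: dist_real_def subset_iff)
    then have "(1 / real k, t, s) \<in> A \<times> (?I \<times> ?C)"
      using t s by (simp add: cube_eq_grid_box)
    then have "c (1 / real k, t, s) \<in> W"
      using subsetD[OF A(3)] by blast
    then have "(t, sphere_param n k s) \<in> W"
      by (simp only: c_def fst_conv snd_conv sphere_param_scale[of n k s, symmetric])
    moreover have "sphere_param n k s \<in> earring n"
      using sphere_param_in_sphere[OF k(2) n s] earring_sphere_subset[OF k(2)] by blast
    ultimately show ?thesis
      using W(2) t by blast
  qed
  then show ?thesis
    by blast
qed

section \<open>Concatenation on the earring\<close>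

lemma cube_upd: "s \<in> topspace (cube n) \<Longrightarrow> n \<ge> 1 \<Longrightarrow> c \<in> {0..1} \<Longrightarrow> s(0 := c) \<in> topspace (cube n)"
  by (auto simp: topspace_cube)

lemma cube_upd_boundary:
  assumes s: "s \<in> cube_boundary n" and n: "n \<ge> 1" and c: "c \<in> {0..1}" "s 0 = 0 \<or> s 0 = 1 \<Longrightarrow> c = 0 \<or> c = 1"
  shows "s(0 := c) \<in> cube_boundary n"
proof -
  obtain i where i: "i < n" "s i = 0 \<or> s i = 1" and st: "s \<in> topspace (cube n)"
    using s by (auto simp: cube_boundary_def)
  have "(s(0 := c)) i = 0 \<or> (s(0 := c)) i = 1"
    using i c by (cases "i = 0") auto
  then show ?thesis
    using i(1) cube_upd[OF st n c(1)] unfolding cube_boundary_def by blast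
qed

lemma cube_upd_end: "s \<in> topspace (cube n) \<Longrightarrow> n \<ge> 1 \<Longrightarrow> c = 0 \<or> c = 1 \<Longrightarrow> s(0 := c) \<in> cube_boundary n"
  using cube_upd[of s n c] by (auto simp: cube_boundary_def intro!: exI[of _ 0])

lemma continuous_on_upd:
  assumes "continuous_on T \<gamma>"
  shows "continuous_on T (\<lambda>z::real \<times> (nat \<Rightarrow> real). (fst z, (snd z)(0 := \<gamma> z)))"
proof (intro continuous_on_Pair continuous_on_fst continuous_on_id continuous_on_coordinatewise_then_product)
  show "continuous_on T (\<lambda>z. ((snd z)(0 := \<gamma> z)) i)" for i
    using assms by (cases "i = 0") (auto intro: continuous_on_snd_coord)
qed

text \<open>At the seam both maps are evaluated on a face of the cube, where they have the value
  \<open>y\<close>.\<close>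

lemma continuous_map_cube_concat:
  assumes n: "n \<ge> 1"
    and A: "continuous_map (prod_topology (top_of_set {0..1::real}) (cube n)) Y A"
      "\<And>t s. t \<in> {0..1} \<Longrightarrow> s \<in> cube_boundary n \<Longrightarrow> A (t, s) = y"
    and B: "continuous_map (prod_topology (top_of_set {0..1::real}) (cube n)) Y B"
      "\<And>t s. t \<in> {0..1} \<Longrightarrow> s \<in> cube_boundary n \<Longrightarrow> B (t, s) = y"
  shows "continuous_map (prod_topology (top_of_set {0..1::real}) (cube n)) Y
     (\<lambda>z. cube_concat (\<lambda>s. A (fst z, s)) (\<lambda>s. B (fst z, s)) (snd z))"
proof -
  let ?T = "{0..1::real} \<times> grid_box n 1"
  have A': "continuous_map (top_of_set ?T) Y A" and B': "continuous_map (top_of_set ?T) Y B"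
    using A(1) B(1) by (simp_all add: cube_eq_grid_box)
  have upd: "s(0 := c) \<in> grid_box n 1" if "s \<in> grid_box n 1" "c \<in> {0..1}" for s c
    using cube_upd[of s n c] n that by (simp add: cube_eq_grid_box)
  have "continuous_map (top_of_set ?T) Y
      (\<lambda>z. if snd z 0 \<le> 1/2 then A (fst z, (snd z)(0 := 2 * snd z 0)) else B (fst z, (snd z)(0 := 2 * snd z 0 - 1)))"
  proof (rule continuous_map_cases_le)
    show "continuous_map (top_of_set ?T) euclideanreal (\<lambda>z. snd z 0)"
      by (auto intro!: continuous_intros)
    show "continuous_map (top_of_set ?T) euclideanreal (\<lambda>z. 1/2)"
      by simp
    have "continuous_map (top_of_set (?T \<inter> {z. snd z 0 \<le> 1/2})) Y (\<lambda>z. A (fst z, (snd z)(0 := 2 * snd z 0)))"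
      by (rule continuous_map_top_of_set_comp[OF A' continuous_on_upd])
        (use upd n in \<open>auto intro!: continuous_intros simp: grid_box_def\<close>)
    then show "continuous_map (subtopology (top_of_set ?T) {z \<in> topspace (top_of_set ?T). snd z 0 \<le> 1/2}) Y
        (\<lambda>z. A (fst z, (snd z)(0 := 2 * snd z 0)))"
      by (simp add: subtopology_subtopology Int_def)
    have "continuous_map (top_of_set (?T \<inter> {z. 1/2 \<le> snd z 0})) Y (\<lambda>z. B (fst z, (snd z)(0 := 2 * snd z 0 - 1)))"
      by (rule continuous_map_top_of_set_comp[OF B' continuous_on_upd])
        (use upd n in \<open>auto intro!: continuous_intros simp: grid_box_def\<close>)
    then show "continuous_map (subtopology (top_of_set ?T) {z \<in> topspace (top_of_set ?T). 1/2 \<le> snd z 0}) Y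
        (\<lambda>z. B (fst z, (snd z)(0 := 2 * snd z 0 - 1)))"
      by (simp add: subtopology_subtopology Int_def)
    show "A (fst z, (snd z)(0 := 2 * snd z 0)) = B (fst z, (snd z)(0 := 2 * snd z 0 - 1))"
      if z: "z \<in> topspace (top_of_set ?T)" "snd z 0 = 1/2" for z
    proof -
      have t: "fst z \<in> {0..1}" and s: "snd z \<in> topspace (cube n)"
        using z(1) by (auto simp: cube_eq_grid_box)
      have e: "2 * snd z 0 = 1"
        using z(2) by simp
      show ?thesis
        using A(2)[OF t cube_upd_end[OF s n, of 1]] B(2)[OF t cube_upd_end[OF s n, of 0]] unfolding e by simp
    qed
  qed
  then show ?thesis
    by (simp add: cube_eq_grid_box cube_concat_def)
qed

lemma cube_concat_boundary:
  assumes "n \<ge> 1" "s \<in> cube_boundary n" "\<And>s. s \<in> cube_boundary n \<Longrightarrow> f s = y" "\<And>s. s \<in> cube_boundary n \<Longrightarrow> g s = y"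
  shows "cube_concat f g s = y"
proof -
  have s0: "0 \<le> s 0" "s 0 \<le> 1"
    using assms(1,2) by (auto simp: cube_boundary_def topspace_cube)
  show ?thesis
  proof (cases "s 0 \<le> 1/2")
    case True
    then show ?thesis
      using assms(3)[OF cube_upd_boundary[OF assms(2,1), of "2 * s 0"]] s0 by (auto simp: cube_concat_def)
  next
    case False
    then show ?thesis
      using assms(4)[OF cube_upd_boundary[OF assms(2,1), of "2 * s 0 - 1"]] s0 by (auto simp: cube_concat_def)
  qed
qed

lemma hawaiian_homotopic_eq:
  "hawaiian_homotopic n X x0 = homotopic_with (\<lambda>h. h ` {earring_base} \<subseteq> {x0}) (hawaiian_earring n) X"
  by (simp add: hawaiian_homotopic_def)

lemma earring_base_topspace: "{earring_base} \<subseteq> topspace (hawaiian_earring n)"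
  using earring_base_in_sphere[of 1 n] earring_sphere_subset[of 1 n] by (auto simp: hawaiian_earring_eq)

lemma earring_base_boundary: "n \<ge> 1 \<Longrightarrow> earring_base \<in> cube_boundary n"
  by (auto simp: cube_boundary_def topspace_cube intro!: exI[of _ 0])

lemma hawaiian_homotopicE:
  assumes "hawaiian_homotopic n X x0 p q"
  obtains H where "continuous_map (prod_topology (top_of_set {0..1::real}) (hawaiian_earring n)) X H"
    "\<And>r. H (0, r) = p r" "\<And>r. H (1, r) = q r" "\<And>t. t \<in> {0..1} \<Longrightarrow> H (t, earring_base) = x0"
  using assms unfolding hawaiian_homotopic_eq by (rule homotopic_with_imageE) blast

lemma hawaiian_homotopic_cubeI:
  assumes n: "n \<ge> 1" and y: "y \<in> topspace Y"
    and G: "\<And>k. k \<ge> 1 \<Longrightarrow> continuous_map (prod_topology (top_of_set {0..1::real}) (cube n)) Y (G k)"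
    and bd: "\<And>k t s. k \<ge> 1 \<Longrightarrow> t \<in> {0..1} \<Longrightarrow> s \<in> cube_boundary n \<Longrightarrow> G k (t, s) = y"
    and tail: "\<And>U. openin Y U \<Longrightarrow> y \<in> U \<Longrightarrow>
        \<exists>K. \<forall>k\<ge>K. k \<ge> 1 \<longrightarrow> (\<forall>t\<in>{0..1}. \<forall>s\<in>topspace (cube n). G k (t, s) \<in> U)"
    and p: "\<And>k s. k \<ge> 1 \<Longrightarrow> s \<in> topspace (cube n) \<Longrightarrow> G k (0, s) = p (sphere_param n k s)"
    and q: "\<And>k s. k \<ge> 1 \<Longrightarrow> s \<in> topspace (cube n) \<Longrightarrow> G k (1, s) = q (sphere_param n k s)"
  shows "hawaiian_homotopic n Y y p q"
proof -
  obtain F where F: "continuous_map (prod_topology (top_of_set {0..1::real}) (hawaiian_earring n)) Y F"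
    "\<And>k t s. k \<ge> 1 \<Longrightarrow> t \<in> {0..1} \<Longrightarrow> s \<in> topspace (cube n) \<Longrightarrow> F (t, sphere_param n k s) = G k (t, s)"
    using earring_lift[where G = G and Y = Y and y = y, OF n y G bd tail] by blast
  have pq: "F (0, r) = p r" "F (1, r) = q r" if r: "r \<in> topspace (hawaiian_earring n)" for r
  proof -
    have "r \<in> earring n"
      using r by (simp add: hawaiian_earring_eq)
    then obtain k s where "k \<ge> 1" "s \<in> topspace (cube n)" "sphere_param n k s = r"
      by (rule earring_point_param[OF n])
    then show "F (0, r) = p r" "F (1, r) = q r"
      using F(2)[of k _ s] p[of k s] q[of k s] by auto
  qed
  have "F (t, r) = y" if "t \<in> {0..1}" "r \<in> {earring_base}" for t r
  proof -
    note b = earring_base_boundary[OF n]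
    have "F (t, sphere_param n 1 earring_base) = y"
      using F(2)[of 1 t earring_base] bd[of 1 t earring_base] that(1) b by (simp add: cube_boundary_def)
    then show ?thesis
      using that(2) by (simp add: sphere_param_boundary[OF b])
  qed
  then show ?thesis
    unfolding hawaiian_homotopic_eq
    by (intro homotopic_with_imageI[OF F(1) earring_base_topspace]) (use pq in auto)
qed

lemma continuous_map_earring_param:
  assumes n: "n \<ge> 1" and k: "k \<ge> 1"
    and F: "continuous_map (prod_topology (top_of_set {0..1::real}) (hawaiian_earring n)) Y F"
  shows "continuous_map (prod_topology (top_of_set {0..1::real}) (cube n)) Y (\<lambda>z. F (fst z, sphere_param n k (snd z)))"
  unfolding cube_eq_grid_box prod_topology_subtopology_eu
proof (rule continuous_map_top_of_set_comp[OF F[unfolded hawaiian_earring_eq prod_topology_subtopology_eu]])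
  show "continuous_on ({0..1} \<times> grid_box n 1) (\<lambda>z. (fst z, sphere_param n k (snd z)))"
    by (intro continuous_on_Pair continuous_on_fst continuous_on_id
        continuous_on_compose2[OF continuous_on_sphere_param[of UNIV] continuous_on_snd]) auto
  show "(fst z, sphere_param n k (snd z)) \<in> {0..1} \<times> earring n" if "z \<in> {0..1} \<times> grid_box n 1" for z
  proof -
    have "snd z \<in> topspace (cube n)"
      using that by (auto simp: cube_eq_grid_box)
    then have "sphere_param n k (snd z) \<in> earring n"
      using sphere_param_in_sphere[OF k n] earring_sphere_subset[OF k] by blast
    then show ?thesis
      using that by auto
  qed
qed

text \<open>On each sphere a concatenation takes only values that its two parts take on the same
  sphere, so it inherits their tail conditions. With constant homotopies the lemma also yields the
  continuity of \<open>hawaiian_concat\<close>.\<close>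

lemma hawaiian_homotopic_concat:
  assumes n: "n \<ge> 1" and y: "y \<in> topspace Y"
    and "hawaiian_homotopic n Y y f f'" "hawaiian_homotopic n Y y g g'"
  shows "hawaiian_homotopic n Y y (hawaiian_concat n f g) (hawaiian_concat n f' g')"
proof -
  obtain F where F: "continuous_map (prod_topology (top_of_set {0..1::real}) (hawaiian_earring n)) Y F"
    "\<And>r. F (0, r) = f r" "\<And>r. F (1, r) = f' r" "\<And>t. t \<in> {0..1} \<Longrightarrow> F (t, earring_base) = y"
    using assms(3) by (rule hawaiian_homotopicE) blast
  obtain H where H: "continuous_map (prod_topology (top_of_set {0..1::real}) (hawaiian_earring n)) Y H"
    "\<And>r. H (0, r) = g r" "\<And>r. H (1, r) = g' r" "\<And>t. t \<in> {0..1} \<Longrightarrow> H (t, earring_base) = y"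
    using assms(4) by (rule hawaiian_homotopicE) blast
  define G where "G k z = cube_concat (\<lambda>s. F (fst z, sphere_param n k s)) (\<lambda>s. H (fst z, sphere_param n k s)) (snd z)" for k z
  have bd: "F (t, sphere_param n k s) = y" "H (t, sphere_param n k s) = y"
    if "t \<in> {0..1}" "s \<in> cube_boundary n" for t k s
    using that F(4) H(4) by (simp_all add: sphere_param_boundary)
  have e0: "f earring_base = g earring_base" "f' earring_base = g' earring_base"
    using F(4)[of 0] F(4)[of 1] H(4)[of 0] H(4)[of 1] by (simp_all add: F H)
  show ?thesis
  proof (rule hawaiian_homotopic_cubeI[OF n y])
    fix k :: nat assume k: "k \<ge> 1"
    have "continuous_map (prod_topology (top_of_set {0..1::real}) (cube n)) Y
       (\<lambda>z. cube_concat (\<lambda>s. F (fst (fst z, s), sphere_param n k (snd (fst z, s))))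
         (\<lambda>s. H (fst (fst z, s), sphere_param n k (snd (fst z, s)))) (snd z))"
      by (rule continuous_map_cube_concat[OF n continuous_map_earring_param[OF n k F(1)] _
            continuous_map_earring_param[OF n k H(1)]]) (simp_all add: bd)
    then show "continuous_map (prod_topology (top_of_set {0..1::real}) (cube n)) Y (G k)"
      by (simp add: G_def[abs_def])
    show "G k (t, s) = y" if "t \<in> {0..1}" "s \<in> cube_boundary n" for t s
      unfolding G_def using that by (intro cube_concat_boundary[OF n]) (simp_all add: bd)
    fix s assume s: "s \<in> topspace (cube n)"
    show "G k (0, s) = hawaiian_concat n f g (sphere_param n k s)"
      unfolding hawaiian_concat_sphere_param[where f = f and g = g, OF k s e0(1)] by (simp add: G_def F H o_def)
    show "G k (1, s) = hawaiian_concat n f' g' (sphere_param n k s)"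
      unfolding hawaiian_concat_sphere_param[where f = f' and g = g', OF k s e0(2)] by (simp add: G_def F H o_def)
  next
    fix U assume U: "openin Y U" "y \<in> U"
    obtain K1 where K1: "\<And>k t s. k \<ge> K1 \<Longrightarrow> k \<ge> 1 \<Longrightarrow> t \<in> {0..1} \<Longrightarrow> s \<in> topspace (cube n) \<Longrightarrow> F (t, sphere_param n k s) \<in> U"
      using earring_tail[OF n F(1,4) U] by blast
    obtain K2 where K2: "\<And>k t s. k \<ge> K2 \<Longrightarrow> k \<ge> 1 \<Longrightarrow> t \<in> {0..1} \<Longrightarrow> s \<in> topspace (cube n) \<Longrightarrow> H (t, sphere_param n k s) \<in> U"
      using earring_tail[OF n H(1,4) U] by blast
    have "G k (t, s) \<in> U" if k: "k \<ge> max K1 K2" "k \<ge> 1" and t: "t \<in> {0..1}" and s: "s \<in> topspace (cube n)" for k t s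
    proof -
      have s0: "0 \<le> s 0" "s 0 \<le> 1"
        using s n by (auto simp: topspace_cube)
      show ?thesis
        using K1[OF _ k(2) t cube_upd[OF s n, of "2 * s 0"]] K2[OF _ k(2) t cube_upd[OF s n, of "2 * s 0 - 1"]] k(1) s0
        by (auto simp: G_def cube_concat_def)
    qed
    then show "\<exists>K. \<forall>k\<ge>K. k \<ge> 1 \<longrightarrow> (\<forall>t\<in>{0..1}. \<forall>s\<in>topspace (cube n). G k (t, s) \<in> U)"
      by blast
  qed
qed

text \<open>The straight-line homotopy from \<open>\<gamma>\<close> to the identity in coordinate 0
  keeps points on their sphere, so its tail condition is that of \<open>f\<close>.\<close>

lemma hawaiian_homotopic_reparam:
  assumes n: "n \<ge> 1" and f: "continuous_map (hawaiian_earring n) Y f" "f earring_base = y"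
    and \<gamma>: "continuous_on {0..1} \<gamma>" "\<And>c. c \<in> {0..1} \<Longrightarrow> \<gamma> c \<in> {0..1}" "\<gamma> 0 = 0" "\<gamma> 1 = (1::real)"
    and p: "\<And>k s. k \<ge> 1 \<Longrightarrow> s \<in> topspace (cube n) \<Longrightarrow> p (sphere_param n k s) = f (sphere_param n k (s(0 := \<gamma> (s 0))))"
  shows "hawaiian_homotopic n Y y p f"
proof -
  let ?I = "{0..1::real}"
  have y: "y \<in> topspace Y"
    using f earring_base_topspace[of n] by (auto simp: continuous_map_def)
  have F: "continuous_map (prod_topology (top_of_set ?I) (hawaiian_earring n)) Y (\<lambda>z. f (snd z))"
    using continuous_map_compose[OF continuous_map_snd f(1)] by (simp add: o_def)
  define \<delta> where "\<delta> z = (1 - fst z) * \<gamma> (snd z 0) + fst z * snd z 0" for z :: "real \<times> (nat \<Rightarrow> real)"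
  define G where "G k z = f (sphere_param n k ((snd z)(0 := \<delta> z)))" for k z
  have s0: "s 0 \<in> ?I" if "s \<in> topspace (cube n)" for s
    using that n by (auto simp: topspace_cube)
  have \<delta>: "\<delta> (t, s) \<in> ?I" if "t \<in> ?I" "s \<in> topspace (cube n)" for t s
    using convex_comb_bounds[OF that(1), of 0 "\<gamma> (s 0)" 1 "s 0"] \<gamma>(2)[OF s0[OF that(2)]] s0[OF that(2)]
    by (auto simp: \<delta>_def)
  have c\<delta>: "continuous_on (?I \<times> grid_box n 1) \<delta>"
  proof -
    have "continuous_on (?I \<times> grid_box n 1) (\<lambda>z. \<gamma> (snd z 0))"
      by (rule continuous_on_compose2[OF \<gamma>(1) continuous_on_snd_coord]) (use s0 in \<open>auto simp: cube_eq_grid_box\<close>)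
    then show ?thesis
      unfolding \<delta>_def by (intro continuous_on_add continuous_on_mult continuous_on_diff continuous_on_const
          continuous_on_fst continuous_on_id continuous_on_snd_coord)
  qed
  show ?thesis
  proof (rule hawaiian_homotopic_cubeI[OF n y])
    fix k :: nat assume k: "k \<ge> 1"
    have "continuous_map (top_of_set (?I \<times> grid_box n 1)) Y (\<lambda>z. f (sphere_param n k (snd z)))"
      using continuous_map_earring_param[OF n k F] by (simp add: cube_eq_grid_box)
    from continuous_map_top_of_set_comp[OF this continuous_on_upd[OF c\<delta>]]
    have "continuous_map (top_of_set (?I \<times> grid_box n 1)) Y (G k)"
      using cube_upd[OF _ n] \<delta> by (auto simp: G_def[abs_def] cube_eq_grid_box)
    then show "continuous_map (prod_topology (top_of_set ?I) (cube n)) Y (G k)"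
      by (simp add: cube_eq_grid_box)
    show "G k (t, s) = y" if t: "t \<in> ?I" and s: "s \<in> cube_boundary n" for t s
    proof -
      have st: "s \<in> topspace (cube n)"
        using s by (simp add: cube_boundary_def)
      have "s 0 = 0 \<or> s 0 = 1 \<Longrightarrow> \<delta> (t, s) = 0 \<or> \<delta> (t, s) = 1"
        using \<gamma>(3,4) by (auto simp: \<delta>_def)
      then have "s(0 := \<delta> (t, s)) \<in> cube_boundary n"
        using cube_upd_boundary[OF s n \<delta>[OF t st]] by blast
      then show ?thesis
        using f(2) by (simp add: G_def sphere_param_boundary)
    qed
    fix s assume s: "s \<in> topspace (cube n)"
    show "G k (0, s) = p (sphere_param n k s)"
      using p[OF k s] by (simp add: G_def \<delta>_def)
    show "G k (1, s) = f (sphere_param n k s)"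
      by (simp add: G_def \<delta>_def)
  next
    fix U assume U: "openin Y U" "y \<in> U"
    obtain K where "\<And>k t s. k \<ge> K \<Longrightarrow> k \<ge> 1 \<Longrightarrow> t \<in> ?I \<Longrightarrow> s \<in> topspace (cube n) \<Longrightarrow> f (sphere_param n k s) \<in> U"
      using earring_tail[OF n F _ U] f(2) by auto
    then have "G k (t, s) \<in> U" if "k \<ge> K" "k \<ge> 1" "t \<in> ?I" "s \<in> topspace (cube n)" for k t s
      using that cube_upd[OF that(4) n \<delta>[OF that(3,4)]] by (simp add: G_def)
    then show "\<exists>K. \<forall>k\<ge>K. k \<ge> 1 \<longrightarrow> (\<forall>t\<in>?I. \<forall>s\<in>topspace (cube n). G k (t, s) \<in> U)"
      by blast
  qed
qed

text \<open>Concatenation with a constant traverses \<open>f\<close> in one half and waits in the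
  other. This is a reparametrization of \<open>f\<close> by \<open>min 1 (2 * c)\<close> or
  \<open>max 0 (2 * c - 1)\<close>, since waiting takes place on a face of the cube.\<close>

lemma hawaiian_concat_unit:
  assumes n: "n \<ge> 1" and f: "continuous_map (hawaiian_earring n) Y f" "f earring_base = y"
  shows hawaiian_concat_unit_right: "hawaiian_homotopic n Y y (hawaiian_concat n f (\<lambda>_. y)) f"
    and hawaiian_concat_unit_left: "hawaiian_homotopic n Y y (hawaiian_concat n (\<lambda>_. y) f) f"
proof -
  have bd: "f (sphere_param n k (s(0 := c))) = y" if "s \<in> topspace (cube n)" "c = 0 \<or> c = 1" for k s c
    using sphere_param_boundary[OF cube_upd_end[OF that(1) n that(2)]] f(2) by simp
  show "hawaiian_homotopic n Y y (hawaiian_concat n f (\<lambda>_. y)) f"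
  proof (rule hawaiian_homotopic_reparam[OF n f, of "\<lambda>c. min 1 (2 * c)"])
    show "hawaiian_concat n f (\<lambda>_. y) (sphere_param n k s) = f (sphere_param n k (s(0 := min 1 (2 * s 0))))"
      if k: "k \<ge> 1" and s: "s \<in> topspace (cube n)" for k s
      using bd[OF s, of 1 k] hawaiian_concat_sphere_param[where f = f and g = "\<lambda>_. y", OF k s f(2)]
      by (cases "s 0 \<le> 1/2") (simp_all add: cube_concat_def)
  qed (auto intro!: continuous_intros)
  show "hawaiian_homotopic n Y y (hawaiian_concat n (\<lambda>_. y) f) f"
  proof (rule hawaiian_homotopic_reparam[OF n f, of "\<lambda>c. max 0 (2 * c - 1)"])
    show "hawaiian_concat n (\<lambda>_. y) f (sphere_param n k s) = f (sphere_param n k (s(0 := max 0 (2 * s 0 - 1))))"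
      if k: "k \<ge> 1" and s: "s \<in> topspace (cube n)" for k s
      using bd[OF s, of 0 k] hawaiian_concat_sphere_param[where f = "\<lambda>_. y" and g = f, OF k s f(2)[symmetric]]
      by (cases "s 0 \<le> 1/2") (simp_all add: cube_concat_def)
  qed (auto intro!: continuous_intros)
qed

section \<open>The Hawaiian group of a wedge\<close>

text \<open>The source of injectivity: the two projections determine \<open>f\<close> up to
  homotopy.\<close>

lemma hawaiian_split:
  fixes X1 :: "'a topology" and X2 :: "'b topology"
  assumes n: "n \<ge> 2" and x: "x1 \<in> topspace X1" "x2 \<in> topspace X2"
    and wp: "well_pointed X1 x1" "well_pointed X2 x2"
    and conn: "m_connected_at (n - 1) X1 x1" "m_connected_at (n - 1) X2 x2"
    and f: "continuous_map (hawaiian_earring n) (wedge X1 x1 X2 x2) f" "f earring_base = Inl x1"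
  shows "hawaiian_homotopic n (wedge X1 x1 X2 x2) (Inl x1) f
     (hawaiian_concat n (\<lambda>r. wedge_pair x2 (wedge_fst x1 (f r)) x2) (\<lambda>r. wedge_pair x2 x1 (wedge_snd x2 (f r))))"
proof -
  let ?W = "wedge X1 x1 X2 x2" and ?HE = "hawaiian_earring n" and ?I = "top_of_set {0..1::real}"
  have n1: "n \<ge> 1"
    using n by simp
  obtain h1 N1 where h1: "continuous_map (prod_topology ?I X1) X1 h1"
    "\<And>y. y \<in> topspace X1 \<Longrightarrow> h1 (0, y) = y" "\<And>t. t \<in> {0..1} \<Longrightarrow> h1 (t, x1) = x1"
    and N1: "openin X1 N1" "x1 \<in> N1" "\<And>y. y \<in> N1 \<Longrightarrow> h1 (1, y) = x1"
    using wp(1) unfolding well_pointed_def by blast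
  obtain h2 N2 where h2: "continuous_map (prod_topology ?I X2) X2 h2"
    "\<And>y. y \<in> topspace X2 \<Longrightarrow> h2 (0, y) = y" "\<And>t. t \<in> {0..1} \<Longrightarrow> h2 (t, x2) = x2"
    and N2: "openin X2 N2" "x2 \<in> N2" "\<And>y. y \<in> N2 \<Longrightarrow> h2 (1, y) = x2"
    using wp(2) unfolding well_pointed_def by blast
  define f1 where "f1 r = wedge_fst x1 (f r)" for r
  define f2 where "f2 r = wedge_snd x2 (f r)" for r
  have f1: "continuous_map ?HE X1 f1" "f1 earring_base = x1"
    using continuous_map_compose[OF f(1) continuous_map_wedge_fst[OF x(1)]] f(2)
    by (simp_all add: f1_def[abs_def] o_def wedge_fst_def)
  have f2: "continuous_map ?HE X2 f2" "f2 earring_base = x2"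
    using continuous_map_compose[OF f(1) continuous_map_wedge_snd[OF x(2)]] f(2)
    by (simp_all add: f2_def[abs_def] o_def wedge_snd_def)
  have f12: "f1 r = x1 \<or> f2 r = x2" for r
    unfolding f1_def f2_def by (rule wedge_fst_or_snd)
  have f1X: "f1 r \<in> topspace X1" and f2X: "f2 r \<in> topspace X2" if "r \<in> topspace ?HE" for r
    using f1(1) f2(1) that by (auto simp: continuous_map_def)
  have F: "continuous_map (prod_topology ?I ?HE) X (\<lambda>z. h (fst z, g (snd z)))"
    if "continuous_map (prod_topology ?I X) X h" "continuous_map ?HE X g" for X :: "'c topology" and h g
  proof -
    have "continuous_map (prod_topology ?I ?HE) (prod_topology ?I X) (\<lambda>z. (fst z, g (snd z)))"
      using continuous_map_compose[OF continuous_map_snd that(2)]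
      by (intro continuous_map_pairedI continuous_map_fst) (simp add: o_def)
    from continuous_map_compose[OF this that(1)] show ?thesis
      by (simp add: o_def)
  qed
  note F1 = F[OF h1(1) f1(1)] and F2 = F[OF h2(1) f2(1)]
  have K: "continuous_map (prod_topology ?I ?HE) X (\<lambda>z. c)" if "c \<in> topspace X" for X :: "'c topology" and c
    using that by simp
  \<comment> \<open>The end of the deformation: \<open>e1\<close> is constant near every point at
    which \<open>f1\<close> is trivial, and likewise \<open>e2\<close>.\<close>
  define e1 where "e1 r = h1 (1, f1 r)" for r
  define e2 where "e2 r = h2 (1, f2 r)" for r
  have e1: "continuous_map ?HE X1 e1" "e1 earring_base = x1" and e2: "continuous_map ?HE X2 e2" "e2 earring_base = x2"
  proof -
    have "continuous_map ?HE (prod_topology ?I ?HE) (\<lambda>r. (1, r))"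
      by (intro continuous_map_pairedI) auto
    from continuous_map_compose[OF this F1] continuous_map_compose[OF this F2]
    show "continuous_map ?HE X1 e1" "continuous_map ?HE X2 e2"
      by (simp_all add: e1_def[abs_def] e2_def[abs_def] o_def)
  qed (simp_all add: e1_def e2_def h1 h2 f1(2) f2(2))
  note base = earring_base_topspace[of n]
  \<comment> \<open>The component that is at its base point stays there, because the deformations
    fix the base points.\<close>
  have 1: "hawaiian_homotopic n ?W (Inl x1) f (\<lambda>r. wedge_pair x2 (e1 r) (e2 r))"
    unfolding hawaiian_homotopic_eq
  proof (rule homotopic_with_wedge_pair[OF F1 F2 x _ base])
    show "h1 (fst (t, r), f1 (snd (t, r))) = x1 \<or> h2 (fst (t, r), f2 (snd (t, r))) = x2" if "t \<in> {0..1}" for t r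
      using f12[of r] h1(3)[OF that] h2(3)[OF that] by auto
    show "wedge_pair x2 (h1 (fst (0, r), f1 (snd (0, r)))) (h2 (fst (0, r), f2 (snd (0, r)))) = f r"
      if r: "r \<in> topspace ?HE" for r
    proof -
      have "f r \<in> topspace ?W"
        using f(1) r by (auto simp: continuous_map_def)
      then show ?thesis
        using wedge_pair_fst_snd[of "f r" X1 x1 X2 x2] h1(2)[OF f1X[OF r]] h2(2)[OF f2X[OF r]]
        by (simp add: f1_def f2_def)
    qed
  qed (auto simp: h1(3) h2(3) f1(2) f2(2) e1_def e2_def)
  \<comment> \<open>Concatenated and reversed, \<open>a\<close> and \<open>b\<close> lead from the
    product formed with \<open>e1\<close> and \<open>e2\<close> back to the one formed with
    \<open>f1\<close> and \<open>f2\<close>.\<close>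
  have a: "hawaiian_homotopic n ?W (Inl x1) (\<lambda>r. wedge_pair x2 (f1 r) x2) (\<lambda>r. wedge_pair x2 (e1 r) x2)"
    unfolding hawaiian_homotopic_eq
    by (rule homotopic_with_wedge_pair[OF F1 K[OF x(2)] x _ base])
      (auto simp: h1 f1X f1(2) e1_def)
  have b: "hawaiian_homotopic n ?W (Inl x1) (\<lambda>r. wedge_pair x2 x1 (f2 r)) (\<lambda>r. wedge_pair x2 x1 (e2 r))"
    unfolding hawaiian_homotopic_eq
    by (rule homotopic_with_wedge_pair[OF K[OF x(1)] F2 x _ base])
      (auto simp: h2 f2X f2(2) e2_def)
  have WX: "Inl x1 \<in> topspace ?W"
    using x by (auto simp: topspace_wedge)
  let ?a = "\<lambda>r. wedge_pair x2 (e1 r) x2" and ?b = "\<lambda>r. wedge_pair x2 x1 (e2 r)"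
  \<comment> \<open>Splitting homotopies exist for each sphere separately; \<open>P\<close> packages
    their properties for a simultaneous choice.\<close>
  define P where "P k G \<longleftrightarrow> continuous_map (prod_topology ?I (cube n)) ?W G \<and>
      (\<forall>s. G (0, s) = wedge_pair x2 (e1 (sphere_param n k s)) (e2 (sphere_param n k s))) \<and>
      (\<forall>s. G (1, s) = cube_concat (?a \<circ> sphere_param n k) (?b \<circ> sphere_param n k) s) \<and>
      (\<forall>t\<in>{0..1}. \<forall>s\<in>cube_boundary n. G (t, s) = Inl x1)" for k G
  have ex: "\<exists>G. P k G" if k: "k \<ge> 1" for k
  proof -
    let ?sp = "sphere_param n k"
    have cube_HE: "continuous_map (cube n) ?HE ?sp"
      unfolding cube_eq_grid_box hawaiian_earring_eq
      using continuous_on_sphere_param subsetD[OF earring_sphere_subset[OF k] sphere_param_in_sphere[OF k n1]]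
      by (auto simp: continuous_map_in_subtopology cube_eq_grid_box)
    have c1: "continuous_map (cube n) X1 (\<lambda>s. e1 (?sp s))" "continuous_map (cube n) X2 (\<lambda>s. e2 (?sp s))"
      using continuous_map_compose[OF cube_HE e1(1)] continuous_map_compose[OF cube_HE e2(1)] by (simp_all add: o_def)
    have "cube_homotopic n ?W (Inl x1) (\<lambda>s. wedge_pair x2 (e1 (?sp s)) (e2 (?sp s)))
       (cube_concat (\<lambda>s. wedge_pair x2 (e1 (?sp s)) x2) (\<lambda>s. wedge_pair x2 x1 (e2 (?sp s))))"
    proof (rule wedge_pair_split_cube[OF n x conn c1(1) _ c1(2)])
      show "(\<lambda>s. e1 (?sp s)) ` cube_boundary n \<subseteq> {x1}" "(\<lambda>s. e2 (?sp s)) ` cube_boundary n \<subseteq> {x2}"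
        by (simp_all add: image_subset_iff sphere_param_boundary e1(2) e2(2))
      fix s assume s: "s \<in> topspace (cube n)"
      have c2: "continuous_map (cube n) X1 (\<lambda>s. f1 (?sp s))" "continuous_map (cube n) X2 (\<lambda>s. f2 (?sp s))"
        using continuous_map_compose[OF cube_HE f1(1)] continuous_map_compose[OF cube_HE f2(1)] by (simp_all add: o_def)
      \<comment> \<open>Near a point with \<open>f1\<close> trivial, \<open>f1\<close> takes values
        in \<open>N1\<close>, which the end of the deformation sends to \<open>x1\<close>.\<close>
      consider "f1 (?sp s) = x1" | "f2 (?sp s) = x2"
        using f12 by blast
      then show "\<exists>U. openin (cube n) U \<and> s \<in> U \<and> ((\<forall>u\<in>U. e1 (?sp u) = x1) \<or> (\<forall>u\<in>U. e2 (?sp u) = x2))"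
      proof cases
        case 1
        then show ?thesis
          using openin_continuous_map_preimage[OF c2(1) N1(1)] N1(2,3) s
          by (intro exI[of _ "{u \<in> topspace (cube n). f1 (?sp u) \<in> N1}"]) (auto simp: e1_def)
      next
        case 2
        then show ?thesis
          using openin_continuous_map_preimage[OF c2(2) N2(1)] N2(2,3) s
          by (intro exI[of _ "{u \<in> topspace (cube n). f2 (?sp u) \<in> N2}"]) (auto simp: e2_def)
      qed
    qed
    then obtain H where H: "continuous_map (prod_topology ?I (cube n)) ?W H"
      "\<And>s. H (0, s) = wedge_pair x2 (e1 (?sp s)) (e2 (?sp s))"
      "\<And>s. H (1, s) = cube_concat (\<lambda>s. wedge_pair x2 (e1 (?sp s)) x2) (\<lambda>s. wedge_pair x2 x1 (e2 (?sp s))) s"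
      "\<And>t s. t \<in> {0..1} \<Longrightarrow> s \<in> cube_boundary n \<Longrightarrow> H (t, s) = Inl x1"
      unfolding cube_homotopic_def by (rule homotopic_with_imageE) blast
    then show ?thesis
      by (intro exI[of _ H]) (simp add: P_def o_def)
  qed
  define G where "G k = (SOME g. P k g)" for k
  have "P k (G k)" if "k \<ge> 1" for k
    unfolding G_def by (rule someI_ex[OF ex[OF that]])
  then have G: "\<And>k. k \<ge> 1 \<Longrightarrow> continuous_map (prod_topology ?I (cube n)) ?W (G k)"
    "\<And>k s. k \<ge> 1 \<Longrightarrow> G k (0, s) = wedge_pair x2 (e1 (sphere_param n k s)) (e2 (sphere_param n k s))"
    "\<And>k s. k \<ge> 1 \<Longrightarrow> G k (1, s) = cube_concat (?a \<circ> sphere_param n k) (?b \<circ> sphere_param n k) s"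
    "\<And>k t s. k \<ge> 1 \<Longrightarrow> t \<in> {0..1} \<Longrightarrow> s \<in> cube_boundary n \<Longrightarrow> G k (t, s) = Inl x1"
    unfolding P_def by simp_all
  have cs: "continuous_map (prod_topology ?I ?HE) X (\<lambda>z. g (snd z))" if "continuous_map ?HE X g" for X :: "'c topology" and g
    using continuous_map_compose[OF continuous_map_snd that] by (simp add: o_def)
  obtain K1 where K1: "\<And>k s. k \<ge> K1 \<Longrightarrow> k \<ge> 1 \<Longrightarrow> s \<in> topspace (cube n) \<Longrightarrow> f1 (sphere_param n k s) \<in> N1"
  proof -
    have "\<exists>K. \<forall>k\<ge>K. k \<ge> 1 \<longrightarrow> (\<forall>t\<in>{0..1::real}. \<forall>s\<in>topspace (cube n). f1 (snd (t, sphere_param n k s)) \<in> N1)"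
      by (rule earring_tail[OF n1 cs[OF f1(1)] _ N1(1,2)]) (simp add: f1(2))
    then obtain K where K: "\<forall>k\<ge>K. k \<ge> 1 \<longrightarrow> (\<forall>t\<in>{0..1::real}. \<forall>s\<in>topspace (cube n). f1 (snd (t, sphere_param n k s)) \<in> N1)"
      by (rule exE)
    show thesis
    proof (rule that)
      show "f1 (sphere_param n k s) \<in> N1" if k: "k \<ge> K" "k \<ge> 1" and s: "s \<in> topspace (cube n)" for k s
        using K[rule_format, OF k _ s, of 0] by simp
    qed
  qed
  obtain K2 where K2: "\<And>k s. k \<ge> K2 \<Longrightarrow> k \<ge> 1 \<Longrightarrow> s \<in> topspace (cube n) \<Longrightarrow> f2 (sphere_param n k s) \<in> N2"
  proof -
    have "\<exists>K. \<forall>k\<ge>K. k \<ge> 1 \<longrightarrow> (\<forall>t\<in>{0..1::real}. \<forall>s\<in>topspace (cube n). f2 (snd (t, sphere_param n k s)) \<in> N2)"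
      by (rule earring_tail[OF n1 cs[OF f2(1)] _ N2(1,2)]) (simp add: f2(2))
    then obtain K where K: "\<forall>k\<ge>K. k \<ge> 1 \<longrightarrow> (\<forall>t\<in>{0..1::real}. \<forall>s\<in>topspace (cube n). f2 (snd (t, sphere_param n k s)) \<in> N2)"
      by (rule exE)
    show thesis
    proof (rule that)
      show "f2 (sphere_param n k s) \<in> N2" if k: "k \<ge> K" "k \<ge> 1" and s: "s \<in> topspace (cube n)" for k s
        using K[rule_format, OF k _ s, of 0] by simp
    qed
  qed
  define K where "K = max K1 K2"
  have eK: "e1 (sphere_param n k s) = x1" "e2 (sphere_param n k s) = x2"
    if "k \<ge> K" "k \<ge> 1" "s \<in> topspace (cube n)" for k s
    using that K1[of k s] K2[of k s] N1(3) N2(3) by (auto simp: e1_def e2_def K_def)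
  \<comment> \<open>The chosen homotopies may be large, so only finitely many are kept. From
    \<open>K\<close> on both ends are constant and the constant homotopy serves, which settles the
    tail condition.\<close>
  define G' where "G' k z = (if k < K then G k z else Inl x1)" for k z
  have ab: "?a earring_base = ?b earring_base"
    by (simp add: e1(2) e2(2))
  have 2: "hawaiian_homotopic n ?W (Inl x1) (\<lambda>r. wedge_pair x2 (e1 r) (e2 r)) (hawaiian_concat n ?a ?b)"
  proof (rule hawaiian_homotopic_cubeI[OF n1 WX])
    fix k :: nat assume k: "k \<ge> 1"
    show "continuous_map (prod_topology ?I (cube n)) ?W (G' k)"
      using G(1)[OF k] WX by (cases "k < K") (simp_all add: G'_def[abs_def])
    show "G' k (t, s) = Inl x1" if "t \<in> {0..1}" "s \<in> cube_boundary n" for t s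
      using G(4)[OF k that] by (simp add: G'_def)
    fix s assume s: "s \<in> topspace (cube n)"
    show "G' k (0, s) = wedge_pair x2 (e1 (sphere_param n k s)) (e2 (sphere_param n k s))"
      using G(2)[OF k] eK[OF _ k s] by (simp add: G'_def wedge_pair_def not_less)
    show "G' k (1, s) = hawaiian_concat n ?a ?b (sphere_param n k s)"
      unfolding hawaiian_concat_sphere_param[where f = ?a and g = ?b, OF k s ab]
    proof (cases "k < K")
      case True
      then show "G' k (1, s) = cube_concat (?a \<circ> sphere_param n k) (?b \<circ> sphere_param n k) s"
        using G(3)[OF k] by (simp add: G'_def)
    next
      case False
      have s0: "0 \<le> s 0" "s 0 \<le> 1"
        using s n by (auto simp: topspace_cube)
      show "G' k (1, s) = cube_concat (?a \<circ> sphere_param n k) (?b \<circ> sphere_param n k) s"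
      proof (cases "s 0 \<le> 1/2")
        case True
        then have "s(0 := 2 * s 0) \<in> topspace (cube n)"
          using s0 by (intro cube_upd s n1) auto
        then show ?thesis
          using True False eK(1)[OF _ k] by (simp add: G'_def cube_concat_def wedge_pair_def)
      next
        case s1: False
        then have "s(0 := 2 * s 0 - 1) \<in> topspace (cube n)"
          using s0 by (intro cube_upd s n1) auto
        then show ?thesis
          using s1 False eK(2)[OF _ k] by (simp add: G'_def cube_concat_def wedge_pair_def)
      qed
    qed
  next
    fix U assume "openin ?W U" "Inl x1 \<in> U"
    then show "\<exists>K. \<forall>k\<ge>K. k \<ge> 1 \<longrightarrow> (\<forall>t\<in>{0..1}. \<forall>s\<in>topspace (cube n). G' k (t, s) \<in> U)"
      by (intro exI[of _ K]) (simp add: G'_def)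
  qed
  have 3: "hawaiian_homotopic n ?W (Inl x1) (hawaiian_concat n ?a ?b)
      (hawaiian_concat n (\<lambda>r. wedge_pair x2 (f1 r) x2) (\<lambda>r. wedge_pair x2 x1 (f2 r)))"
    using hawaiian_homotopic_concat[OF n1 WX a b] unfolding hawaiian_homotopic_eq by (rule homotopic_with_symD)
  show ?thesis
    using homotopic_with_trans[OF 1[unfolded hawaiian_homotopic_def]
        homotopic_with_trans[OF 2[unfolded hawaiian_homotopic_def] 3[unfolded hawaiian_homotopic_def]]]
    by (simp add: hawaiian_homotopic_def f1_def f2_def)
qed

section \<open>Calculating with representatives, and the isomorphism\<close>

lemma hawaiian_homotopic_refl:
  "continuous_map (hawaiian_earring n) X f \<Longrightarrow> f earring_base = x0 \<Longrightarrow> hawaiian_homotopic n X x0 f f"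
  by (simp add: hawaiian_homotopic_def)

lemma hawaiian_homotopic_sym: "hawaiian_homotopic n X x0 f g \<Longrightarrow> hawaiian_homotopic n X x0 g f"
  unfolding hawaiian_homotopic_def by (rule homotopic_with_symD)

lemma hawaiian_homotopic_trans:
  "hawaiian_homotopic n X x0 f g \<Longrightarrow> hawaiian_homotopic n X x0 g h \<Longrightarrow> hawaiian_homotopic n X x0 f h"
  unfolding hawaiian_homotopic_def by (rule homotopic_with_trans)

lemma hawaiian_class_eq_iff:
  assumes "continuous_map (hawaiian_earring n) X f" "f earring_base = x0"
  shows "Collect (hawaiian_homotopic n X x0 f) = Collect (hawaiian_homotopic n X x0 g) \<longleftrightarrow> hawaiian_homotopic n X x0 f g"
proof
  assume "Collect (hawaiian_homotopic n X x0 f) = Collect (hawaiian_homotopic n X x0 g)"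
  then have "f \<in> Collect (hawaiian_homotopic n X x0 g)"
    using hawaiian_homotopic_refl[OF assms] by blast
  then show "hawaiian_homotopic n X x0 f g"
    by (simp add: hawaiian_homotopic_sym)
next
  assume fg: "hawaiian_homotopic n X x0 f g"
  show "Collect (hawaiian_homotopic n X x0 f) = Collect (hawaiian_homotopic n X x0 g)"
    using hawaiian_homotopic_trans[OF fg] hawaiian_homotopic_trans[OF hawaiian_homotopic_sym[OF fg]]
    by (intro Collect_cong iffI)
qed

lemma hawaiian_homotopic_imp_pointed:
  assumes "hawaiian_homotopic n X x0 f g"
  shows "continuous_map (hawaiian_earring n) X f" "f earring_base = x0"
    "continuous_map (hawaiian_earring n) X g" "g earring_base = x0"
  using homotopic_with_imp_continuous_maps[OF assms[unfolded hawaiian_homotopic_def]]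
    homotopic_with_imp_property[OF assms[unfolded hawaiian_homotopic_def]] by auto

lemma hawaiian_homotopic_compose:
  assumes "hawaiian_homotopic n X x0 f g" "continuous_map X Y r" "r x0 = y0"
  shows "hawaiian_homotopic n Y y0 (r \<circ> f) (r \<circ> g)"
  using assms(1) unfolding hawaiian_homotopic_def
  by (rule homotopic_with_compose_continuous_map_left[OF _ assms(2)]) (simp add: assms(3))

lemma hawaiian_group_mult:
  assumes n: "n \<ge> 1" and f: "continuous_map (hawaiian_earring n) X f" "f earring_base = x0"
    and g: "continuous_map (hawaiian_earring n) X g" "g earring_base = x0"
  shows "Collect (hawaiian_homotopic n X x0 f) \<otimes>\<^bsub>hawaiian_group n X x0\<^esub> Collect (hawaiian_homotopic n X x0 g)
       = Collect (hawaiian_homotopic n X x0 (hawaiian_concat n f g))"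
proof -
  have x0: "x0 \<in> topspace X"
    using f earring_base_topspace[of n] by (auto simp: continuous_map_def)
  have "(\<exists>f'. hawaiian_homotopic n X x0 f f' \<and> (\<exists>g'. hawaiian_homotopic n X x0 g g' \<and>
           hawaiian_homotopic n X x0 (hawaiian_concat n f' g') h))
      \<longleftrightarrow> hawaiian_homotopic n X x0 (hawaiian_concat n f g) h" for h
  proof
    assume "\<exists>f'. hawaiian_homotopic n X x0 f f' \<and> (\<exists>g'. hawaiian_homotopic n X x0 g g' \<and>
           hawaiian_homotopic n X x0 (hawaiian_concat n f' g') h)"
    then obtain f' g' where fg: "hawaiian_homotopic n X x0 f f'" "hawaiian_homotopic n X x0 g g'"
      and h: "hawaiian_homotopic n X x0 (hawaiian_concat n f' g') h"
      by blast
    show "hawaiian_homotopic n X x0 (hawaiian_concat n f g) h"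
      by (rule hawaiian_homotopic_trans[OF hawaiian_homotopic_concat[OF n x0 fg] h])
  next
    assume "hawaiian_homotopic n X x0 (hawaiian_concat n f g) h"
    then show "\<exists>f'. hawaiian_homotopic n X x0 f f' \<and> (\<exists>g'. hawaiian_homotopic n X x0 g g' \<and>
           hawaiian_homotopic n X x0 (hawaiian_concat n f' g') h)"
      by (intro exI[of _ f] exI[of _ g] conjI hawaiian_homotopic_refl f g)
  qed
  then show ?thesis
    by (simp add: hawaiian_group_def)
qed

text \<open>An equality of maps, not just a homotopy, because the sphere and the point of the cube
  chosen in \<open>hawaiian_concat\<close> depend on \<open>n\<close> and the point of the earring
  alone.\<close>

lemma hawaiian_concat_compose: "r \<circ> hawaiian_concat n f g = hawaiian_concat n (r \<circ> f) (r \<circ> g)"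
  by (auto simp: fun_eq_iff hawaiian_concat_def cube_concat_def case_prod_unfold Let_def)

theorem corollary2p7:
  fixes X1 :: "'a topology" and X2 :: "'b topology" and x1 :: 'a and x2 :: 'b and n :: nat
  assumes "n \<ge> 2"
    and "locally_finite_CW_complex X1" and "m_connected (n - 1) X1" and "x1 \<in> topspace X1"
    and "locally_finite_CW_complex X2" and "m_connected (n - 1) X2" and "x2 \<in> topspace X2"
  shows "hawaiian_group n (wedge X1 x1 X2 x2) (Inl x1)
           \<cong> hawaiian_group n X1 x1 \<times>\<times> hawaiian_group n X2 x2"
proof -
  let ?W = "wedge X1 x1 X2 x2" and ?HE = "hawaiian_earring n"
  let ?hW = "hawaiian_homotopic n ?W (Inl x1)"
  let ?h1 = "hawaiian_homotopic n X1 x1" and ?h2 = "hawaiian_homotopic n X2 x2"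
  let ?r1 = "wedge_fst x1 :: 'a + 'b \<Rightarrow> 'a" and ?r2 = "wedge_snd x2 :: 'a + 'b \<Rightarrow> 'b"
  let ?i1 = "\<lambda>a. wedge_pair x2 a x2" and ?i2 = "\<lambda>b. wedge_pair x2 x1 b"
  note x = assms(4,7)
  have n: "n \<ge> 1"
    using assms(1) by simp
  have r1: "continuous_map ?W X1 ?r1" "?r1 (Inl x1) = x1" and r2: "continuous_map ?W X2 ?r2" "?r2 (Inl x1) = x2"
    using continuous_map_wedge_fst[OF x(1)] continuous_map_wedge_snd[OF x(2)]
    by (simp_all add: wedge_fst_def wedge_snd_def)
  have i1: "continuous_map X1 ?W ?i1" "?i1 x1 = Inl x1" and i2: "continuous_map X2 ?W ?i2" "?i2 x2 = Inl x1"
    using continuous_map_wedge_pair[of X1 X1 "\<lambda>a. a" X2 "\<lambda>_. x2" x1 x2]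
      continuous_map_wedge_pair[of X2 X1 "\<lambda>_. x1" X2 "\<lambda>b. b" x1 x2] x
    by (simp_all add: wedge_pair_def)
  have WX: "Inl x1 \<in> topspace ?W"
    using x by (auto simp: topspace_wedge)
  have split: "?hW f (hawaiian_concat n (?i1 \<circ> (?r1 \<circ> f)) (?i2 \<circ> (?r2 \<circ> f)))"
    if "continuous_map ?HE ?W f" "f earring_base = Inl x1" for f
    using hawaiian_split[OF assms(1) x locally_finite_CW_complex_well_pointed[OF assms(2) x(1)]
        locally_finite_CW_complex_well_pointed[OF assms(5) x(2)] _ _ that] assms(3,6) x
    by (simp add: m_connected_def o_def)
  \<comment> \<open>Defined through a chosen representative; the choice does not matter because the
    retractions preserve homotopies.\<close>
  define \<Psi> where "\<Psi> A = (Collect (?h1 (?r1 \<circ> (SOME f. f \<in> A))), Collect (?h2 (?r2 \<circ> (SOME f. f \<in> A))))" for A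
  have \<Psi>: "\<Psi> (Collect (?hW f)) = (Collect (?h1 (?r1 \<circ> f)), Collect (?h2 (?r2 \<circ> f)))"
    if f: "continuous_map ?HE ?W f" "f earring_base = Inl x1" for f
  proof -
    define g where "g = (SOME g. g \<in> Collect (?hW f))"
    have "?hW f g"
      unfolding g_def using someI[of "\<lambda>g. g \<in> Collect (?hW f)" f] hawaiian_homotopic_refl[OF f] by simp
    then have "?hW g f"
      by (rule hawaiian_homotopic_sym)
    from hawaiian_homotopic_compose[OF this r1] hawaiian_homotopic_compose[OF this r2]
    have "Collect (?h1 (?r1 \<circ> g)) = Collect (?h1 (?r1 \<circ> f))" "Collect (?h2 (?r2 \<circ> g)) = Collect (?h2 (?r2 \<circ> f))"
      using hawaiian_class_eq_iff hawaiian_homotopic_imp_pointed(1,2) by metis+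
    then show ?thesis
      by (simp add: \<Psi>_def g_def)
  qed
  have pointed1: "continuous_map ?HE X1 (?r1 \<circ> f)" "(?r1 \<circ> f) earring_base = x1"
    and pointed2: "continuous_map ?HE X2 (?r2 \<circ> f)" "(?r2 \<circ> f) earring_base = x2"
    if "continuous_map ?HE ?W f" "f earring_base = Inl x1" for f
    using that r1 r2 by (auto intro: continuous_map_compose)
  have concat_pointed: "continuous_map ?HE Y (hawaiian_concat n f g)" "hawaiian_concat n f g earring_base = y"
    if f: "continuous_map ?HE Y f" "f earring_base = y" and g: "continuous_map ?HE Y g" "g earring_base = y"
    for f g y and Y :: "'c topology"
  proof -
    have "y \<in> topspace Y"
      using f earring_base_topspace[of n] by (auto simp: continuous_map_def)
    from hawaiian_homotopic_concat[OF n this hawaiian_homotopic_refl[OF f] hawaiian_homotopic_refl[OF g]]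
    show "continuous_map ?HE Y (hawaiian_concat n f g)" "hawaiian_concat n f g earring_base = y"
      using hawaiian_homotopic_imp_pointed by metis+
  qed
  have carrier: "carrier (hawaiian_group n Y y) =
      {Collect (hawaiian_homotopic n Y y f) |f. continuous_map ?HE Y f \<and> f earring_base = y}" for y and Y :: "'c topology"
    by (simp add: hawaiian_group_def)
  have "\<Psi> \<in> iso (hawaiian_group n ?W (Inl x1)) (hawaiian_group n X1 x1 \<times>\<times> hawaiian_group n X2 x2)"
    unfolding iso_def mem_Collect_eq
  proof
    show "\<Psi> \<in> hom (hawaiian_group n ?W (Inl x1)) (hawaiian_group n X1 x1 \<times>\<times> hawaiian_group n X2 x2)"
    proof (rule homI)
      fix A assume "A \<in> carrier (hawaiian_group n ?W (Inl x1))"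
      then obtain f where f: "A = Collect (?hW f)" "continuous_map ?HE ?W f" "f earring_base = Inl x1"
        unfolding carrier by blast
      show "\<Psi> A \<in> carrier (hawaiian_group n X1 x1 \<times>\<times> hawaiian_group n X2 x2)"
        unfolding f(1) \<Psi>[OF f(2,3)] carrier_DirProd carrier
        using pointed1[OF f(2,3)] pointed2[OF f(2,3)] by blast
      fix B assume "B \<in> carrier (hawaiian_group n ?W (Inl x1))"
      then obtain g where g: "B = Collect (?hW g)" "continuous_map ?HE ?W g" "g earring_base = Inl x1"
        unfolding carrier by blast
      show "\<Psi> (A \<otimes>\<^bsub>hawaiian_group n ?W (Inl x1)\<^esub> B) = \<Psi> A \<otimes>\<^bsub>hawaiian_group n X1 x1 \<times>\<times> hawaiian_group n X2 x2\<^esub> \<Psi> B"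
        unfolding f(1) g(1) hawaiian_group_mult[OF n f(2,3) g(2,3)] \<Psi>[OF f(2,3)] \<Psi>[OF g(2,3)]
          \<Psi>[OF concat_pointed[OF f(2,3) g(2,3)]] mult_DirProd
          hawaiian_group_mult[OF n pointed1[OF f(2,3)] pointed1[OF g(2,3)]]
          hawaiian_group_mult[OF n pointed2[OF f(2,3)] pointed2[OF g(2,3)]] hawaiian_concat_compose
        by (rule refl)
    qed
    show "bij_betw \<Psi> (carrier (hawaiian_group n ?W (Inl x1))) (carrier (hawaiian_group n X1 x1 \<times>\<times> hawaiian_group n X2 x2))"
      unfolding bij_betw_def
    proof
      \<comment> \<open>Homotopic projections give homotopic products of their inclusions, and by
        \<open>split\<close> these products are homotopic to the two given maps.\<close>
      show "inj_on \<Psi> (carrier (hawaiian_group n ?W (Inl x1)))"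
      proof (rule inj_onI)
        fix A B assume A: "A \<in> carrier (hawaiian_group n ?W (Inl x1))" and B: "B \<in> carrier (hawaiian_group n ?W (Inl x1))"
          and eq: "\<Psi> A = \<Psi> B"
        obtain f where f: "A = Collect (?hW f)" "continuous_map ?HE ?W f" "f earring_base = Inl x1"
          using A unfolding carrier by blast
        obtain g where g: "B = Collect (?hW g)" "continuous_map ?HE ?W g" "g earring_base = Inl x1"
          using B unfolding carrier by blast
        have "?h1 (?r1 \<circ> f) (?r1 \<circ> g)" "?h2 (?r2 \<circ> f) (?r2 \<circ> g)"
          using eq hawaiian_class_eq_iff[OF pointed1[OF f(2,3)]] hawaiian_class_eq_iff[OF pointed2[OF f(2,3)]]
          unfolding f(1) g(1) \<Psi>[OF f(2,3)] \<Psi>[OF g(2,3)] by (simp_all only: prod.inject)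
        then have "?hW (hawaiian_concat n (?i1 \<circ> (?r1 \<circ> f)) (?i2 \<circ> (?r2 \<circ> f)))
            (hawaiian_concat n (?i1 \<circ> (?r1 \<circ> g)) (?i2 \<circ> (?r2 \<circ> g)))"
          by (intro hawaiian_homotopic_concat[OF n WX] hawaiian_homotopic_compose[OF _ i1] hawaiian_homotopic_compose[OF _ i2])
        then have "?hW f g"
          by (rule hawaiian_homotopic_trans[OF split[OF f(2,3)]
              hawaiian_homotopic_trans[OF _ hawaiian_homotopic_sym[OF split[OF g(2,3)]]]])
        then show "A = B"
          unfolding f(1) g(1) using hawaiian_class_eq_iff[OF f(2,3)] by simp
      qed
      have surj: "\<exists>A\<in>carrier (hawaiian_group n ?W (Inl x1)). \<Psi> A = (Collect (?h1 f1), Collect (?h2 f2))"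
        if f1: "continuous_map ?HE X1 f1" "f1 earring_base = x1" and f2: "continuous_map ?HE X2 f2" "f2 earring_base = x2"
        for f1 f2
      proof -
        \<comment> \<open>The product of the two inclusions. Each retraction turns the other factor
          into a constant, which the unit laws remove.\<close>
        define g where "g = hawaiian_concat n (?i1 \<circ> f1) (?i2 \<circ> f2)"
        have "continuous_map ?HE ?W (?i1 \<circ> f1)" "(?i1 \<circ> f1) earring_base = Inl x1"
          "continuous_map ?HE ?W (?i2 \<circ> f2)" "(?i2 \<circ> f2) earring_base = Inl x1"
          using continuous_map_compose[OF f1(1) i1(1)] continuous_map_compose[OF f2(1) i2(1)] f1(2) f2(2) i1(2) i2(2)
          by simp_all
        then have g: "continuous_map ?HE ?W g" "g earring_base = Inl x1"
          unfolding g_def by (rule concat_pointed)+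
        have "?r1 \<circ> g = hawaiian_concat n f1 (\<lambda>_. x1)" "?r2 \<circ> g = hawaiian_concat n (\<lambda>_. x2) f2"
          unfolding g_def hawaiian_concat_compose by (simp_all add: o_def wedge_fst_pair wedge_snd_pair)
        then have "?h1 (?r1 \<circ> g) f1" "?h2 (?r2 \<circ> g) f2"
          using hawaiian_concat_unit_right[OF n f1] hawaiian_concat_unit_left[OF n f2] by simp_all
        then have "\<Psi> (Collect (?hW g)) = (Collect (?h1 f1), Collect (?h2 f2))"
          unfolding \<Psi>[OF g]
          by (simp only: hawaiian_class_eq_iff[OF pointed1[OF g]] hawaiian_class_eq_iff[OF pointed2[OF g]] prod.inject)
        moreover have "Collect (?hW g) \<in> carrier (hawaiian_group n ?W (Inl x1))"
          unfolding carrier using g by blast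
        ultimately show ?thesis
          by blast
      qed
      have "carrier (hawaiian_group n X1 x1 \<times>\<times> hawaiian_group n X2 x2) \<subseteq> \<Psi> ` carrier (hawaiian_group n ?W (Inl x1))"
      proof
        fix p assume "p \<in> carrier (hawaiian_group n X1 x1 \<times>\<times> hawaiian_group n X2 x2)"
        then have "fst p \<in> carrier (hawaiian_group n X1 x1)" "snd p \<in> carrier (hawaiian_group n X2 x2)"
          by (simp_all add: mem_Times_iff)
        then obtain f1 f2 where "continuous_map ?HE X1 f1" "f1 earring_base = x1" "continuous_map ?HE X2 f2" "f2 earring_base = x2"
          and p: "fst p = Collect (?h1 f1)" "snd p = Collect (?h2 f2)"
          unfolding carrier by blast
        then obtain A where "A \<in> carrier (hawaiian_group n ?W (Inl x1))" "\<Psi> A = (fst p, snd p)"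
          using surj p by metis
        then show "p \<in> \<Psi> ` carrier (hawaiian_group n ?W (Inl x1))"
          by (metis imageI prod.collapse)
      qed
      moreover have "\<Psi> ` carrier (hawaiian_group n ?W (Inl x1)) \<subseteq> carrier (hawaiian_group n X1 x1 \<times>\<times> hawaiian_group n X2 x2)"
      proof (rule image_subsetI)
        fix A assume "A \<in> carrier (hawaiian_group n ?W (Inl x1))"
        then obtain f where f: "A = Collect (?hW f)" "continuous_map ?HE ?W f" "f earring_base = Inl x1"
          unfolding carrier by blast
        show "\<Psi> A \<in> carrier (hawaiian_group n X1 x1 \<times>\<times> hawaiian_group n X2 x2)"
          unfolding f(1) \<Psi>[OF f(2,3)] carrier_DirProd carrier
          using pointed1[OF f(2,3)] pointed2[OF f(2,3)] by blast
      qed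
      ultimately show "\<Psi> ` carrier (hawaiian_group n ?W (Inl x1)) = carrier (hawaiian_group n X1 x1 \<times>\<times> hawaiian_group n X2 x2)"
        by blast
    qed
  qed
  then show ?thesis
    by (rule is_isoI)
qed

end
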